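(* Let $0<|q|<1$ and $b\in\mathbb{C}\setminus\{0\}$. Let the Weyl group $W(F_4)$ act on $(\mathbb{C}\setminus\{0\})^4/\sim$ (where $z\sim-z$) by the multiplicative action with parameter $A=q/b$. Then \[ B_1(b;t;q)=B_1(b;w(t);q) \] for every $w\in W(F_4)$.
   Context: Notation. $(x;q)=\prod_{r\ge 0}(1-xq^r)$. Several arguments denote a product, $(a_1,\dots,a_k;q)=\prod_r (a_r;q)$, and $\pm$ signs denote products over both choices, e.g. $(az^{\pm1};q)=(az,a/z;q)$. The function $B_1$. For $t=(t_1,t_2,t_3,t_4)$, considered up to $t\sim-t$, \[ B_1(b;t;q)=\prod_{1\le r<s\le4}\Bigl(t_rt_s,\frac{qt_r}{bt_s},\frac{qt_s}{bt_r},\frac{q^2}{b^2t_rt_s};q\Bigr)\Bigl(\frac qb;q\Bigr)^4\frac{(q;q)}{2}\int_{\mathcal{C}}\frac{\bigl(\frac qb z^{\pm2},z^{\pm2};q\bigr)}{\prod_{r=1}^4\bigl(t_rz^{\pm1},\frac{q}{bt_r}z^{\pm1};q\bigr)}\frac{dz}{2\pi iz}, \] where $\mathcal{C}$ is a deformation of the unit circle traversed in positive direction which separates the poles at $z=t_rq^k$ and $z=\frac{1}{bt_r}q^{k+1}$ ($1\le r\le4$, $k\in\mathbb{Z}_{\ge0}$) from their reciprocals. If no such contour exists, $B_1$ is the analytic continuation (in $b$ and $t_r$) of the right hand side. Weyl group and its multiplicative action. With $e_1,\dots,e_4$ the standard orthonormal basis of $\mathbb{R}^4$, the root system $R(F_4)$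 consists of the 48 vectors $\pm e_j$ ($1\le j\le4$), $\frac12(\pm e_1\pm e_2\pm e_3\pm e_4)$, $\pm e_j\pm e_k$ ($1\le j<k\le4$). $W(F_4)$ is the group generated by the reflections $s_\alpha(\beta)=\beta-2\frac{\langle\alpha,\beta\rangle}{\langle\alpha,\alpha\rangle}\alpha$, $\alpha\in R(F_4)$; it acts linearly on $\mathbb{C}^4$ by complexification. For a constant $A\neq0$ the multiplicative action on $(\mathbb{C}\setminus\{0\})^4/\sim$ is $w(z)=\exp\circ T_A^{-1}\circ w\circ T_A\circ\log(z)$, where $\exp$ and $\log$ are taken coordinatewise, $T_A(z)=(z_1-\frac12\log A,\dots,z_4-\frac12\log A)$, and the inner $w$ is the linear action on $\mathbb{C}^4$; modulo $z\sim-z$ this does not depend on the choices of logarithms. For example $s_{-e_1}(z)=(A/z_1,z_2,z_3,z_4)$, $s_{e_1-e_2}$ swaps $z_1,z_2$, and $s_{\frac12(e_1+e_2+e_3+e_4)}(z)=\bigl(\frac{Az_j}{\sqrt{z_1z_2z_3z_4}}\bigr)_{j=1}^4$. *)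

theory Defs
  imports
    "HOL-Complex_Analysis.Complex_Analysis"
    "HOL-Algebra.Bij"
    "HOL-Algebra.Generated_Groups"
begin

unbundle no fps_syntax

definition qpoch :: "complex \<Rightarrow> complex \<Rightarrow> complex" where
  "qpoch x q = (\<Prod>r. 1 - x * q ^ r)"

definition qpochs :: "complex list \<Rightarrow> complex \<Rightarrow> complex" where
  "qpochs xs q = (\<Prod>x\<leftarrow>xs. qpoch x q)"

definition B1_integrand :: "complex \<Rightarrow> complex^4 \<Rightarrow> complex \<Rightarrow> complex \<Rightarrow> complex" where
  "B1_integrand b t q z =
     qpochs [q / b * z^2, q / b / z^2, z^2, 1 / z^2] q /
     (\<Prod>r\<in>UNIV. qpochs [t$r * z, t$r / z, q / (b * t$r) * z, q / (b * t$r) / z] q)"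

text \<open>The numeral type 4 is linearly ordered with 4 = 0 as its least element. This is harmless
  below, because each factor of the product is symmetric in its two indices.\<close>

definition B1_prefactor :: "complex \<Rightarrow> complex^4 \<Rightarrow> complex \<Rightarrow> complex" where
  "B1_prefactor b t q =
     (\<Prod>(r, s)\<in>{(r, s). r < s}.
        qpochs [t$r * t$s, q * t$r / (b * t$s), q * t$s / (b * t$r), q^2 / (b^2 * t$r * t$s)] q)
     * qpoch (q / b) q ^ 4 * (qpoch q q / 2)"

definition B1_inner_poles :: "complex \<Rightarrow> complex^4 \<Rightarrow> complex \<Rightarrow> complex set" where
  "B1_inner_poles b t q =
     {t$r * q ^ k | r k. True} \<union> {1 / (b * t$r) * q ^ (k + 1) | r k. True}"

text \<open>A deformation of the positively oriented unit circle is a closed path that is freely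
  homotopic to it in the punctured plane, and it separates the poles from their reciprocals if
  it winds once around each of the former and not at all around the latter. The integral does
  not depend on which such path is chosen.\<close>

definition B1_contour :: "complex \<Rightarrow> complex^4 \<Rightarrow> complex \<Rightarrow> (real \<Rightarrow> complex) \<Rightarrow> bool" where
  "B1_contour b t q \<gamma> \<longleftrightarrow>
     valid_path \<gamma> \<and> homotopic_loops (- {0}) (circlepath 0 1) \<gamma> \<and>
     (\<forall>p\<in>B1_inner_poles b t q.
        p \<notin> path_image \<gamma> \<and> winding_number \<gamma> p = 1 \<and>
        1 / p \<notin> path_image \<gamma> \<and> winding_number \<gamma> (1 / p) = 0)"

definition B1_integral :: "complex \<Rightarrow> complex^4 \<Rightarrow> complex \<Rightarrow> complex" where
  "B1_integral b t q =
     B1_prefactor b t q *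
     contour_integral (SOME \<gamma>. B1_contour b t q \<gamma>)
       (\<lambda>z. B1_integrand b t q z / (2 * of_real pi * \<i> * z))"

definition punctured_params :: "(complex \<times> (complex^4)) set" where
  "punctured_params = {(b, t). b \<noteq> 0 \<and> (\<forall>r. t$r \<noteq> 0)}"

text \<open>Holomorphy in five variables: the total derivative exists and is complex linear.\<close>

definition param_holomorphic_on ::
  "(complex \<times> (complex^4) \<Rightarrow> complex) \<Rightarrow> (complex \<times> (complex^4)) set \<Rightarrow> bool" where
  "param_holomorphic_on F V \<longleftrightarrow>
     (\<forall>x\<in>V. \<exists>D. (F has_derivative D) (at x) \<and> (\<forall>c h v. D (c * h, c *s v) = c * D (h, v)))"

text \<open>The parameters for which a contour exists are dense: one exists unless an inner pole is
  the reciprocal of an inner pole. Hence the value at a point of a holomorphic extension of the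
  integral to a neighbourhood of this point does not depend on the extension.\<close>

definition B1_continuation_value ::
  "complex \<Rightarrow> complex^4 \<Rightarrow> complex \<Rightarrow> complex \<Rightarrow> bool" where
  "B1_continuation_value b t q c \<longleftrightarrow>
     (\<exists>V F. open V \<and> (b, t) \<in> V \<and> V \<subseteq> punctured_params \<and> param_holomorphic_on F V \<and>
        (\<forall>(b', t')\<in>V. (\<exists>\<gamma>. B1_contour b' t' q \<gamma>) \<longrightarrow> F (b', t') = B1_integral b' t' q) \<and>
        F (b, t) = c)"

definition B1 :: "complex \<Rightarrow> complex^4 \<Rightarrow> complex \<Rightarrow> complex" where
  "B1 b t q =
     (if \<exists>\<gamma>. B1_contour b t q \<gamma> then B1_integral b t q
      else (THE c. B1_continuation_value b t q c))"

definition root_system_F4 :: "(real^4) set" where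
  "root_system_F4 =
     {c *\<^sub>R axis j 1 | c j. c \<in> {1, -1}} \<union>
     {v. \<forall>j. v$j \<in> {1/2, -1/2}} \<union>
     {c *\<^sub>R axis j 1 + d *\<^sub>R axis k 1 | c d j k. c \<in> {1, -1} \<and> d \<in> {1, -1} \<and> j \<noteq> k}"

definition root_reflection :: "real^4 \<Rightarrow> real^4 \<Rightarrow> real^4" where
  "root_reflection \<alpha> \<beta> = \<beta> - (2 * (\<alpha> \<bullet> \<beta>) / (\<alpha> \<bullet> \<alpha>)) *\<^sub>R \<alpha>"

definition weyl_group_F4 :: "(real^4 \<Rightarrow> real^4) set" where
  "weyl_group_F4 = generate (BijGroup UNIV) (root_reflection ` root_system_F4)"

definition complexify :: "(real^4 \<Rightarrow> real^4) \<Rightarrow> complex^4 \<Rightarrow> complex^4" where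
  "complexify w v = (\<chi> j. Complex (w (\<chi> i. Re (v$i)) $ j) (w (\<chi> i. Im (v$i)) $ j))"

text \<open>The class of w(z) modulo sign, as the set of its representatives; a is a logarithm of A
  and l is a coordinatewise logarithm of z, and all choices of them are admitted.\<close>

definition mult_action ::
  "complex \<Rightarrow> (real^4 \<Rightarrow> real^4) \<Rightarrow> complex^4 \<Rightarrow> (complex^4) set" where
  "mult_action A w z =
     {u. \<exists>a l v. exp a = A \<and> (\<forall>j. exp (l$j) = z$j) \<and>
        v = (\<chi> j. exp (complexify w (\<chi> i. l$i - a / 2) $ j + a / 2)) \<and> (u = v \<or> u = - v)}"

end

theory Submission
  imports Defs
begin

text \<open>In logarithmic coordinates q/b = exp a, t_r = exp l_r the Weyl group acts by linear maps that fix
the line l = (a/2, ..., a/2). It is generated by reflections of two kinds. Those in the roots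
\<plusminus> e_j and \<plusminus> e_j \<plusminus> e_k permute the four pairs {t_r, q/(b t_r)} or exchange the members of
a pair, and B1 is visibly symmetric under this (log_integral_permute). The theorem is therefore
about the reflections in the vectors (\<plusminus> e_1 \<plusminus> e_2 \<plusminus> e_3 \<plusminus> e_4)/2, which are all conjugate to one
of them by exchanges within pairs (refl_half_root).

With A = q/b and t = A^(1/2) (xy, x/y, uv, u/v), the reflection in (e_1 + e_2 - e_3 - e_4)/2
exchanges x and u. The integrand of B1 becomes the weight in z times
K(x,y,z) K(u,v,z), where K is the reciprocal of the product of the eight factors
(A^(1/2) x^(\<plusminus>1) y^(\<plusminus>1) z^(\<plusminus>1); q). As a function of v, for fixed x, y and u, it has to be compared
with the integral in which x and u are exchanged. Integration against a Rogers polynomial C_n(v), with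
parameter \<beta> = A, turns K(u,v,z) into a multiple of C_n(u) C_n(z): this is a product formula for
Rogers polynomials (rogers_product_formula), with the masses given by the Askey-Wilson integral
(aw_integral). A second application, to K(x,y,z), shows that the moments are a
symmetric function of x, y, u times C_n(x) C_n(y) C_n(u). Because the polynomials C_n
span the symmetric Laurent polynomials, the double integrals themselves agree
(double_kernel_symmetric).

The Askey-Wilson integral and the product formula both come from one observation
(aw_relation): a function that is odd under z \<rightarrow> q/z and has no poles between the unit circle and the
circle of radius |q|^(1/2) has mean value 0. Suitable functions give recurrences, for the total
mass in the parameters of the weight and for the moments in the degree n. The products
C_n(x) C_n(y) satisfy the same recurrence in n as the moments.

This proves the symmetry in an open set of parameters for which the unit circle is an admissible
contour (log_integral_half_root). The integral is holomorphic where a contour exists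
(log_integral_holomorphic). On a complex line in logarithmic coordinates the parameters
without a contour are the zeros of an entire function, so the remaining ones form a connected set
and the identity theorem spreads the symmetry. By density it passes to the values that
are defined by continuation (B1_invariant). The invariance under t \<rightarrow> -t results from the same
reflection: adding 2 \<pi> \<i> to one logarithm changes no t_r but moves the reflected point to its
negative (B1_minus).\<close>

section \<open>q-shifted factorials\<close>

locale nome =
  fixes q :: complex
  assumes q_nz: "q \<noteq> 0" and q_lt_1: "norm q < 1"
begin

lemma norm_q_pos: "norm q > 0"
  using q_nz by simp

lemma summable_qpoch: "summable (\<lambda>r. norm (x * q ^ r))"
  using q_lt_1 by (auto simp: norm_mult norm_power intro!: summable_mult summable_geometric)

lemma qpoch_has_prod: "(\<lambda>r. 1 - x * q ^ r) has_prod qpoch x q"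
proof -
  have "abs_convergent_prod (\<lambda>r. 1 - x * q ^ r)"
    unfolding abs_convergent_prod_conv_summable using summable_qpoch[of x] by simp
  thus ?thesis
    unfolding qpoch_def
    by (intro convergent_prod_has_prod abs_convergent_prod_imp_convergent_prod)
qed

lemma qpoch_eq_0_iff: "qpoch x q = 0 \<longleftrightarrow> (\<exists>k. x * q ^ k = 1)"
  using has_prod_eq_0_iff[OF qpoch_has_prod[of x]] by auto

lemma qpoch_nz: "norm x < 1 \<Longrightarrow> qpoch x q \<noteq> 0"
proof
  assume x: "norm x < 1" and "qpoch x q = 0"
  then obtain k where k: "x * q ^ k = 1" by (auto simp: qpoch_eq_0_iff)
  have "norm (x * q ^ k) \<le> norm x"
    using q_lt_1 by (auto simp: norm_mult norm_power intro!: mult_right_le_one_le power_le_one)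
  thus False using x k by simp
qed

lemma qpoch_tendsto: "(\<lambda>n. \<Prod>k<n. 1 - x * q ^ k) \<longlonglongrightarrow> qpoch x q"
  using has_prod_imp_tendsto'[OF qpoch_has_prod[of x]] .

lemma qpoch_rec: "qpoch x q = (1 - x) * qpoch (x * q) q"
proof -
  have "(\<lambda>n. \<Prod>k<Suc n. 1 - x * q ^ k) \<longlonglongrightarrow> qpoch x q"
    using LIMSEQ_Suc[OF qpoch_tendsto] .
  also have "(\<lambda>n. \<Prod>k<Suc n. 1 - x * q ^ k) = (\<lambda>n. (1 - x) * (\<Prod>k<n. 1 - x * q * q ^ k))"
    by (auto simp del: prod.lessThan_Suc simp: prod.lessThan_Suc_shift mult_ac)
  finally show ?thesis
    using LIMSEQ_unique tendsto_mult[OF tendsto_const qpoch_tendsto] by blast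
qed

lemma qpoch_0 [simp]: "qpoch 0 q = 1"
  unfolding qpoch_def by simp

lemma qpoch_holomorphic_UNIV: "(\<lambda>x. qpoch x q) holomorphic_on UNIV"
proof (rule holomorphic_uniform_sequence[of _ "\<lambda>n x. \<Prod>k<n. 1 - x * q ^ k"])
  fix x :: complex
  show "\<exists>d>0. cball x d \<subseteq> UNIV \<and>
      uniform_limit (cball x d) (\<lambda>n x. \<Prod>k<n. 1 - x * q ^ k) (\<lambda>x. qpoch x q) sequentially"
  proof (intro exI[of _ 1] conjI)
    let ?M = "\<lambda>k. (norm x + 1) * norm q ^ k"
    have "uniformly_convergent_on (cball x 1) (\<lambda>N y. \<Sum>n<N. norm ((1 - y * q ^ n) - 1))"
    proof (rule Weierstrass_m_test'[of _ _ ?M])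
      fix n y assume "y \<in> cball x 1"
      hence "norm y \<le> norm x + 1"
        by (metis dist_norm dist_commute mem_cball norm_triangle_sub add_left_mono order_trans)
      thus "norm (norm ((1 - y * q ^ n) - 1)) \<le> ?M n"
        by (auto simp: norm_mult norm_power intro!: mult_right_mono)
    qed (use q_lt_1 in \<open>auto intro!: summable_mult summable_geometric\<close>)
    hence "uniformly_convergent_on (cball x 1) (\<lambda>N y. \<Prod>n<N. 1 - y * q ^ n)"
      by (intro uniformly_convergent_on_prod') (auto intro!: continuous_intros)
    then obtain l where l: "uniform_limit (cball x 1) (\<lambda>N y. \<Prod>n<N. 1 - y * q ^ n) l sequentially"
      by (auto simp: uniformly_convergent_on_def)
    have "l y = qpoch y q" if "y \<in> cball x 1" for y
      using tendsto_uniform_limitI[OF l that] qpoch_tendsto[of y] LIMSEQ_unique by blast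
    hence "uniform_limit (cball x 1) (\<lambda>N y. \<Prod>n<N. 1 - y * q ^ n) l sequentially =
        uniform_limit (cball x 1) (\<lambda>N y. \<Prod>n<N. 1 - y * q ^ n) (\<lambda>x. qpoch x q) sequentially"
      by (intro uniform_limit_cong') auto
    thus "uniform_limit (cball x 1) (\<lambda>N y. \<Prod>n<N. 1 - y * q ^ n) (\<lambda>x. qpoch x q) sequentially"
      using l by simp
  qed auto
qed (auto intro!: holomorphic_intros)

lemma qpoch_holomorphic_on [holomorphic_intros]:
  "f holomorphic_on S \<Longrightarrow> (\<lambda>z. qpoch (f z) q) holomorphic_on S"
  using holomorphic_on_compose[of f S "\<lambda>x. qpoch x q"] qpoch_holomorphic_UNIV holomorphic_on_subset
  unfolding o_def by blast

lemma qpoch_continuous_on [continuous_intros]: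
  "continuous_on S f \<Longrightarrow> continuous_on S (\<lambda>z. qpoch (f z) q)"
  using continuous_on_compose2[OF holomorphic_on_imp_continuous_on[OF qpoch_holomorphic_UNIV]]
  by fastforce

lemma qpoch_tendsto_compose [tendsto_intros]:
  "(f \<longlongrightarrow> a) F \<Longrightarrow> ((\<lambda>z. qpoch (f z) q) \<longlongrightarrow> qpoch a q) F"
  using holomorphic_on_imp_continuous_on[OF qpoch_holomorphic_UNIV]
  by (auto simp: continuous_on_eq_continuous_at intro!: isCont_tendsto_compose[where g = "\<lambda>x. qpoch x q"])

end

text \<open>The integral of f z / (2 \<pi> \<i> z) over the unit circle, written as a real integral: means then exist
  for all continuous functions and obey Fubini without reference to paths.\<close>
section \<open>Means over the unit circle\<close>

definition circle_mean :: "(complex \<Rightarrow> complex) \<Rightarrow> complex" where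
  "circle_mean f = integral {0..1} (\<lambda>s. f (exp (2 * of_real pi * \<i> * of_real s)))"

lemma norm_exp_2pi [simp]: "norm (exp (2 * of_real pi * \<i> * of_real s)) = 1"
  by (simp add: norm_exp_eq_Re)

lemma continuous_on_circle_mean:
  fixes f :: "complex \<Rightarrow> 'a::topological_space"
  shows "continuous_on (sphere 0 1) f \<Longrightarrow> continuous_on {0..1::real} (\<lambda>s. f (exp (2 * of_real pi * \<i> * of_real s)))"
  by (rule continuous_on_compose2[of "sphere 0 1" f]) (auto intro!: continuous_intros)

lemma circle_mean_cong: "(\<And>z. norm z = 1 \<Longrightarrow> f z = g z) \<Longrightarrow> circle_mean f = circle_mean g"
  unfolding circle_mean_def by (intro integral_cong) auto

lemma circle_mean_add:
  assumes "continuous_on (sphere 0 1) f" "continuous_on (sphere 0 1) g"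
  shows "circle_mean (\<lambda>z. f z + g z) = circle_mean f + circle_mean g"
  unfolding circle_mean_def
  by (intro integral_add integrable_continuous_real continuous_on_circle_mean assms)

lemma circle_mean_diff:
  assumes "continuous_on (sphere 0 1) f" "continuous_on (sphere 0 1) g"
  shows "circle_mean (\<lambda>z. f z - g z) = circle_mean f - circle_mean g"
  unfolding circle_mean_def
  by (intro integral_diff integrable_continuous_real continuous_on_circle_mean assms)

lemma circle_mean_cmult: "circle_mean (\<lambda>z. c * f z) = c * circle_mean f"
  unfolding circle_mean_def by simp

lemma integral_01_reflect:
  fixes g :: "real \<Rightarrow> complex"
  shows "integral {0..1} (\<lambda>s. g (1 - s)) = integral {0..1} g"
proof -
  have im: "(\<lambda>x. 1 - x) ` {0..1::real} = {0..1}"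
    by (auto simp: image_iff intro!: bexI[of _ "1 - x" for x])
  have *: "((\<lambda>s. h (1 - s)) has_integral I) {0..1}" if "(h has_integral I) {0..1}" for I and h :: "real \<Rightarrow> complex"
    using has_integral_affinity01[OF that, of "-1" 1] by (simp add: im)
  have "((\<lambda>s. g (1 - s)) has_integral I) {0..1} \<longleftrightarrow> (g has_integral I) {0..1}" for I
    using *[of g I] *[of "\<lambda>s. g (1 - s)" I] by auto
  thus ?thesis unfolding integral_def integrable_on_def by simp
qed

lemma circle_mean_inverse: "circle_mean (\<lambda>z. f (1 / z)) = circle_mean f"
proof -
  have "integral {0..1} (\<lambda>s. f (exp (2 * of_real pi * \<i> * of_real s))) =
        integral {0..1} (\<lambda>s::real. f ((\<lambda>s. exp (2 * of_real pi * \<i> * of_real (1 - s))) s))"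
    by (rule integral_01_reflect[symmetric])
  also have "(\<lambda>s::real. exp (2 * of_real pi * \<i> * of_real (1 - s))) = (\<lambda>s. 1 / exp (2 * of_real pi * \<i> * of_real s))"
    by (simp add: algebra_simps exp_diff)
  finally show ?thesis by (simp add: circle_mean_def)
qed

lemma circle_mean_swap:
  assumes "continuous_on (sphere 0 1 \<times> sphere 0 1) (\<lambda>(z, w). f z w)"
  shows "circle_mean (\<lambda>z. circle_mean (\<lambda>w. f z w)) = circle_mean (\<lambda>w. circle_mean (\<lambda>z. f z w))"
proof -
  let ?e = "\<lambda>s::real. exp (2 * of_real pi * \<i> * of_real s)"
  have "continuous_on (cbox (0, 0) (1, 1)) (\<lambda>x. (\<lambda>(z, w). f z w) (?e (fst x), ?e (snd x)))"
    by (rule continuous_on_compose2[OF assms]) (auto intro!: continuous_intros)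
  hence "continuous_on (cbox (0, 0) (1, 1)) (\<lambda>(s, t). f (?e s) (?e t))"
    by (simp add: case_prod_unfold)
  from integral_swap_continuous[OF this] show ?thesis
    unfolding circle_mean_def by simp
qed

lemma circle_mean_contour:
  "contour_integral (circlepath 0 1) (\<lambda>z. f z / (2 * of_real pi * \<i> * z)) = circle_mean f"
  unfolding contour_integral_integral circle_mean_def
  by (intro integral_cong) (subst vector_derivative_circlepath, simp add: circlepath)

text \<open>The mean over a circle does not depend on the radius. The derivative of f(\<rho> z) with respect to \<rho>
  is, up to the factor 2 \<pi> \<i> \<rho>, its derivative with respect to the angle, which integrates to 0.
  A complex \<rho> also rotates the circle; aw_relation needs \<rho> with \<rho>^2 = q.\<close>
lemma circle_mean_scale:
  assumes f: "f holomorphic_on {z. r1 < norm z \<and> norm z < r2}" and r: "0 \<le> r1" "r1 < 1" "1 < r2"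
    and \<rho>: "r1 < norm \<rho>" "norm \<rho> < r2"
  shows "circle_mean (\<lambda>z. f (\<rho> * z)) = circle_mean f"
proof -
  define U where "U = {z::complex. r1 < norm z \<and> norm z < r2}"
  have opU: "open U" 
    unfolding U_def by (intro open_Collect_conj open_Collect_less continuous_intros)
  have "connected U"
    using connected_annulus(1)[where a = "0::complex"] by (simp add: U_def)
  let ?e = "\<lambda>s::real. exp (2 * of_real pi * \<i> * of_real s)"
  let ?J = "\<lambda>\<rho>. circle_mean (\<lambda>z. f (\<rho> * z))"
  have fd: "(f has_field_derivative deriv f x) (at x)" if "x \<in> U" for x
    using f that opU unfolding U_def by (metis holomorphic_derivI)
  have der: "(?J has_field_derivative 0) (at x)" if x: "x \<in> U" for x
  proof -
    obtain \<epsilon> where \<epsilon>: "\<epsilon> > 0" "ball x \<epsilon> \<subseteq> U" using opU x open_contains_ball by blast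
    have memU: "y * ?e s \<in> U \<longleftrightarrow> y \<in> U" for y s by (simp add: U_def norm_mult)
    have "((\<lambda>y. integral (cbox 0 1) (\<lambda>s. f (y * ?e s))) has_field_derivative
           integral (cbox 0 1) (\<lambda>s. deriv f (x * ?e s) * ?e s)) (at x within ball x \<epsilon>)"
    proof (rule leibniz_rule_field_derivative[where fx = "\<lambda>y s. deriv f (y * ?e s) * ?e s"])
      fix y and s :: real assume "y \<in> ball x \<epsilon>"
      hence "y * ?e s \<in> U" using \<epsilon> memU by blast
      moreover have "((\<lambda>y. y * ?e s) has_field_derivative ?e s) (at y within ball x \<epsilon>)"
        by (auto intro!: derivative_eq_intros)
      ultimately show "((\<lambda>y. f (y * ?e s)) has_field_derivative deriv f (y * ?e s) * ?e s) (at y within ball x \<epsilon>)"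
        using fd DERIV_chain2[where f = f and g = "\<lambda>y. y * ?e s"] by blast
    next
      fix y assume y: "y \<in> ball x \<epsilon>"
      show "(\<lambda>s. f (y * ?e s)) integrable_on cbox 0 1"
        using \<epsilon> memU y f
        by (intro integrable_continuous continuous_on_compose2[OF holomorphic_on_imp_continuous_on[of f U]])
           (auto intro!: continuous_intros simp: U_def subset_eq)
    next
      have "continuous_on (ball x \<epsilon> \<times> cbox 0 1) (\<lambda>z. deriv f (fst z * ?e (snd z)) * ?e (snd z))"
        using \<epsilon> memU f opU
        by (intro continuous_intros continuous_on_compose2[OF holomorphic_on_imp_continuous_on[OF holomorphic_deriv[of f U]]])
           (auto simp: U_def subset_eq)
      thus "continuous_on (ball x \<epsilon> \<times> cbox 0 1) (\<lambda>(y, s). deriv f (y * ?e s) * ?e s)"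
        by (simp add: case_prod_unfold)
    qed (use \<epsilon> in auto)
    moreover have "x \<noteq> 0" using x r by (auto simp: U_def)
    have "((\<lambda>s. deriv f (x * ?e s) * (?e s * (2 * pi * \<i> * x))) has_integral (f (x * ?e 1) - f (x * ?e 0))) {0..1}"
    proof (rule fundamental_theorem_of_calculus)
      fix s :: real
      have "x * ?e s \<in> U" using x memU by blast
      have "((\<lambda>s. x * exp (2 * of_real pi * \<i> * s)) has_field_derivative (?e s * (2 * pi * \<i> * x))) (at (of_real s))"
        by (auto intro!: derivative_eq_intros)
      from DERIV_chain2[OF fd[OF \<open>x * ?e s \<in> U\<close>] this]
      have "((\<lambda>s. f (x * exp (2 * of_real pi * \<i> * s))) has_field_derivative deriv f (x * ?e s) * (?e s * (2 * pi * \<i> * x))) (at (of_real s))" .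
      from has_vector_derivative_real_field[OF this]
      show "((\<lambda>s. f (x * ?e s)) has_vector_derivative deriv f (x * ?e s) * (?e s * (2 * pi * \<i> * x))) (at s within {0..1})"
        by (rule has_vector_derivative_at_within)
    qed auto
    hence "integral {0..1} (\<lambda>s. (2 * pi * \<i> * x) * (deriv f (x * ?e s) * ?e s)) = 0"
      by (simp add: integral_unique mult_ac del: integral_mult_right)
    hence "integral {0..1} (\<lambda>s. deriv f (x * ?e s) * ?e s) = 0"
      using \<open>x \<noteq> 0\<close> by simp
    ultimately have "((\<lambda>y. integral {0..1} (\<lambda>s. f (y * ?e s))) has_field_derivative 0) (at x within ball x \<epsilon>)"
      by simp
    moreover have "at x within ball x \<epsilon> = at x" using \<epsilon> by (intro at_within_open) auto
    ultimately show ?thesis by (simp add: circle_mean_def)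
  qed
  obtain c where c: "\<And>x. x \<in> U \<Longrightarrow> ?J x = c"
  proof (rule DERIV_zero_connected_constant[of U "{}" ?J])
    show "continuous_on U ?J"
      using der by (auto intro!: continuous_at_imp_continuous_on DERIV_isCont)
    show "\<forall>x\<in>U - {}. (?J has_field_derivative 0) (at x)" using der by auto
  qed (use opU \<open>connected U\<close> in auto)
  show ?thesis using c[of \<rho>] c[of 1] \<rho> r by (simp add: U_def)
qed

lemma circle_mean_norm_le:
  assumes "continuous_on (sphere 0 1) f" "\<And>z. norm z = 1 \<Longrightarrow> norm (f z) \<le> B"
  shows "norm (circle_mean f) \<le> B"
  using integral_bound[OF _ continuous_on_circle_mean[OF assms(1)], of B] assms(2)
  by (simp add: circle_mean_def)

lemma on_unit_circle:
  assumes "norm z = 1"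
  obtains s where "s \<in> {0..1}" "z = exp (2 * of_real pi * \<i> * of_real s)"
proof -
  have "z \<in> path_image (circlepath 0 1)" using assms by simp
  thus ?thesis using that by (auto simp: path_image_def circlepath)
qed

text \<open>By the Stone-Weierstrass theorem cnj f is a uniform limit of polynomials in Re z and Im z, which are
  Laurent polynomials on the unit circle. So f has mean 0 against cnj f.\<close>
lemma circle_mean_uniqueness:
  assumes f: "continuous_on (sphere 0 1) f"
    and zero: "\<And>n::int. circle_mean (\<lambda>z. f z * z powi n) = 0" and z: "norm z = 1"
  shows "f z = 0"
proof -
  (* The functions in M have vanishing Fourier coefficients; M is closed under multiplication by Re z and Im z. *)
  define M where "M h \<longleftrightarrow> continuous_on (sphere 0 1) h \<and> (\<forall>n::int. circle_mean (\<lambda>z. h z * z powi n) = 0)" for h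
  have powi_cont: "continuous_on (sphere 0 1) (\<lambda>z::complex. z powi n)" for n
    by (intro continuous_intros) auto
  have M_add: "M (\<lambda>z. h1 z + h2 z)" if "M h1" "M h2" for h1 h2
    using that unfolding M_def
    by (auto simp: distrib_right circle_mean_add continuous_on_mult powi_cont intro!: continuous_intros)
  have M_cmult: "M (\<lambda>z. c * h z)" if "M h" for h c
    using that unfolding M_def
    by (auto simp: mult.assoc circle_mean_cmult intro!: continuous_intros)
  have M_powi: "M (\<lambda>z. h z * z powi m)" if "M h" for h m
  proof -
    have "circle_mean (\<lambda>z. h z * z powi m * z powi n) = circle_mean (\<lambda>z. h z * z powi (m + n))" for n
      by (rule circle_mean_cong) (subst power_int_add, auto simp: mult_ac)
    thus ?thesis using that powi_cont unfolding M_def by (auto intro!: continuous_intros)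
  qed
  have M_cong: "M h1 \<longleftrightarrow> M h2" if "\<And>z. norm z = 1 \<Longrightarrow> h1 z = h2 z" for h1 h2
  proof -
    have "circle_mean (\<lambda>z. h1 z * z powi n) = circle_mean (\<lambda>z. h2 z * z powi n)" for n
      by (rule circle_mean_cong) (simp add: that)
    moreover have "continuous_on (sphere 0 1) h1 \<longleftrightarrow> continuous_on (sphere 0 1) h2"
      by (rule continuous_on_cong) (auto simp: that)
    ultimately show ?thesis by (simp add: M_def)
  qed
  have real_poly: "M (\<lambda>z. h z * of_real (p z))" if "real_polynomial_function p" "M h" for p h
    using that
  proof (induction arbitrary: h rule: real_polynomial_function.induct)
    case (linear p)
    have "M (\<lambda>z. (of_real (p 1) / 2) * (h z * z powi 1 + h z * z powi (-1)) +
                 (of_real (p \<i>) / (2 * \<i>)) * (h z * z powi 1 + (-1) * (h z * z powi (-1))))" (is "M ?r")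
      by (intro M_add M_cmult M_powi linear)
    moreover have "h z * of_real (p z) = ?r z" if "norm z = 1" for z :: complex
    proof -
      interpret bounded_linear p by (rule linear.hyps)
      have "p z = p (Re z *\<^sub>R 1 + Im z *\<^sub>R \<i>)" by (intro arg_cong[of _ _ p]) (simp add: complex_eq_iff)
      hence pz: "p z = Re z * p 1 + Im z * p \<i>"
        by (simp only: add scaleR real_scaleR_def)
      have "z * cnj z = 1" using complex_norm_square[of z] that by simp
      hence inv: "inverse z = cnj z" by (rule inverse_unique)
      have "of_real (Re z) = (z + inverse z) / 2" "of_real (Im z) = (z - inverse z) / (2 * \<i>)"
        unfolding inv by (simp_all add: complex_eq_iff)
      hence "h z * of_real (p z) = h z * (((z + inverse z) / 2) * of_real (p 1) + ((z - inverse z) / (2 * \<i>)) * of_real (p \<i>))"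
        unfolding pz by simp
      also have "\<dots> = ?r z"
        by (simp add: power_int_minus field_simps)
      finally show ?thesis .
    qed
    ultimately show ?case
      by (intro iffD2[OF M_cong[of "\<lambda>z. h z * of_real (p z)" ?r]])
  next
    case (const c)
    thus ?case using M_cmult[of h "of_real c"] by (simp add: mult.commute)
  next
    case (add p1 p2)
    thus ?case using M_add by (simp add: distrib_left)
  next
    case (mult p1 p2)
    have "M (\<lambda>z. (h z * of_real (p1 z)) * of_real (p2 z))" 
      by (intro mult.IH mult.prems)
    thus ?case by (simp add: mult.assoc)
  qed
  have M_f: "M f" using f zero by (simp add: M_def)
  have poly: "circle_mean (\<lambda>z. f z * g z) = 0" if "polynomial_function g" for g
  proof -
    have "real_polynomial_function (Re \<circ> g)" "real_polynomial_function (Im \<circ> g)"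
      using that unfolding polynomial_function_def by (auto simp: bounded_linear_Re bounded_linear_Im)
    hence "M (\<lambda>z. f z * of_real ((Re \<circ> g) z) + \<i> * (f z * of_real ((Im \<circ> g) z)))"
      by (intro M_add M_cmult real_poly M_f)
    also have "(\<lambda>z. f z * of_real ((Re \<circ> g) z) + \<i> * (f z * of_real ((Im \<circ> g) z))) = (\<lambda>z. f z * g z)"
      by (auto simp: fun_eq_iff complex_eq_iff algebra_simps)
    finally show ?thesis unfolding M_def by (auto dest: spec[of _ 0])
  qed
  have "bounded (f ` sphere 0 1)"
    by (intro compact_imp_bounded compact_continuous_image f) auto
  then obtain B where B: "B > 0" "\<And>z. norm z = 1 \<Longrightarrow> norm (f z) \<le> B"
    unfolding bounded_pos by auto
  have cnj_cont: "continuous_on (sphere 0 1) (\<lambda>z. cnj (f z))"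
    using f by (intro continuous_intros)
  have "norm (circle_mean (\<lambda>z. f z * cnj (f z))) \<le> e" if e: "e > 0" for e
  proof -
    obtain g where g: "polynomial_function g" "\<And>z. norm z = 1 \<Longrightarrow> norm (cnj (f z) - g z) < e / B"
      using Stone_Weierstrass_polynomial_function[OF compact_sphere cnj_cont divide_pos_pos[OF e B(1)]]
      by (metis mem_sphere_0)
    have gc: "continuous_on (sphere 0 1) g" using g continuous_on_polymonial_function by blast
    have "circle_mean (\<lambda>z. f z * cnj (f z)) = circle_mean (\<lambda>z. f z * cnj (f z)) - circle_mean (\<lambda>z. f z * g z)"
      using poly[OF g(1)] by simp
    also have "\<dots> = circle_mean (\<lambda>z. f z * cnj (f z) - f z * g z)"
      by (rule circle_mean_diff[symmetric]) (intro continuous_intros f cnj_cont gc)+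
    also have "norm \<dots> \<le> e"
    proof (rule circle_mean_norm_le)
      show "continuous_on (sphere 0 1) (\<lambda>z. f z * cnj (f z) - f z * g z)"
        by (intro continuous_intros f cnj_cont gc)
      fix z :: complex assume z: "norm z = 1"
      have "norm (f z * cnj (f z) - f z * g z) = norm (f z) * norm (cnj (f z) - g z)"
        by (simp add: norm_mult[symmetric] algebra_simps)
      also have "\<dots> \<le> B * (e / B)"
        using B(2)[OF z] g(2)[OF z] B(1) by (intro mult_mono) auto
      finally show "norm (f z * cnj (f z) - f z * g z) \<le> e" using B(1) by simp
    qed
    finally show ?thesis .
  qed
  hence "norm (circle_mean (\<lambda>z. f z * cnj (f z))) \<le> 0"
    by (rule field_le_epsilon) simp
  moreover have "of_real ((norm (f z))\<^sup>2) = f z * cnj (f z)" for z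
    by (metis complex_norm_square of_real_power)
  ultimately have circ0: "circle_mean (\<lambda>z. of_real ((norm (f z))\<^sup>2)) = 0"
    by simp
  have "(\<lambda>s. (norm (f (exp (2 * of_real pi * \<i> * of_real s))))\<^sup>2) integrable_on {0..1}"
    by (rule integrable_continuous_real, rule continuous_on_circle_mean[of "\<lambda>z. (norm (f z))\<^sup>2"])
       (intro continuous_intros f)
  from integral_linear[OF this bounded_linear_of_real[where 'a = complex]]
  have "of_real (integral {0..1} (\<lambda>s. (norm (f (exp (2 * of_real pi * \<i> * of_real s))))\<^sup>2)) = (0 :: complex)"
    using circ0 unfolding circle_mean_def o_def by simp
  hence int0: "integral {0..1} (\<lambda>s. (norm (f (exp (2 * of_real pi * \<i> * of_real s))))\<^sup>2) = 0"
    by simp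
  obtain s where s: "s \<in> {0..1}" "z = exp (2 * of_real pi * \<i> * of_real s)"
    using on_unit_circle[OF z] .
  have "\<forall>s\<in>{0..1}. (norm (f (exp (2 * of_real pi * \<i> * of_real s))))\<^sup>2 = 0"
    using int0 integral_eq_0_iff[of 0 1 "\<lambda>s. (norm (f (exp (2 * of_real pi * \<i> * of_real s))))\<^sup>2"]
      continuous_on_circle_mean[of "\<lambda>z. (norm (f z))\<^sup>2", OF continuous_on_power[OF continuous_on_norm[OF f]]]
    by simp
  with s(1) have "(norm (f (exp (2 * of_real pi * \<i> * of_real s))))\<^sup>2 = 0" by blast
  thus ?thesis using s(2) by simp
qed

context nome
begin

section \<open>The Askey-Wilson integral\<close>

definition aw_weight :: "complex \<Rightarrow> complex \<Rightarrow> complex \<Rightarrow> complex \<Rightarrow> complex \<Rightarrow> complex" where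
  "aw_weight a b c d z = qpoch (z^2) q * qpoch (1 / z^2) q /
     ((qpoch (a * z) q * qpoch (a / z) q) * (qpoch (b * z) q * qpoch (b / z) q) *
      (qpoch (c * z) q * qpoch (c / z) q) * (qpoch (d * z) q * qpoch (d / z) q))"

lemma aw_weight_continuous_on:
  assumes "norm a < 1" "norm b < 1" "norm c < 1" "norm d < 1"
  shows "continuous_on (sphere 0 1) (aw_weight a b c d)"
  unfolding aw_weight_def using assms
  by (intro continuous_intros) (auto simp: qpoch_nz norm_mult norm_divide)

text \<open>Inserts the factors in which aw_weight differs from its shifted forms. The bracketing is that of
  aw_weight, so that the rule applies by matching.\<close>
lemma cancel4:
  fixes a b c d X :: complex
  assumes "a \<noteq> 0" "b \<noteq> 0" "c \<noteq> 0" "d \<noteq> 0"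
  shows "X / ((u1 * v1) * (u2 * v2) * (u3 * v3) * (u4 * v4)) =
    (a * b * c * d) * (X / ((u1 * (a * v1)) * (u2 * (b * v2)) * (u3 * (c * v3)) * (u4 * (d * v4))))"
  using assms by (simp add: divide_inverse) (simp add: field_simps)

text \<open>The source of all relations between the moments of the weight. Let \<Phi> z be
  z s(z) (z^2, q/z^2; q) divided by the product of (t z, q t/z; q) over the four parameters t. The
  hypothesis on p says that p times the weight is \<Phi> z + \<Phi> (1/z) on the unit circle, so the mean in
  question is twice that of \<Phi>. But \<Phi> is odd under z \<rightarrow> q/z, which preserves the circle of radius
  |q|^(1/2), and it is holomorphic between this circle and the unit circle. So its mean is 0.\<close>
lemma aw_relation:
  assumes abcd: "norm a < 1" "norm b < 1" "norm c < 1" "norm d < 1"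
    and s: "s holomorphic_on -{0}" and sym: "\<And>z. z \<noteq> 0 \<Longrightarrow> s (q / z) = s z"
    and p: "\<And>z. norm z = 1 \<Longrightarrow> (z - 1 / z) * p z =
       z^2 * ((1 - a / z) * (1 - b / z) * (1 - c / z) * (1 - d / z)) * s z -
       1 / z^2 * ((1 - a * z) * (1 - b * z) * (1 - c * z) * (1 - d * z)) * s (1 / z)"
  shows "circle_mean (\<lambda>z. p z * aw_weight a b c d z) = 0"
proof -
  define \<Phi> where "\<Phi> z = z * s z * (qpoch (z^2) q * qpoch (q / z^2) q) /
     ((qpoch (a * z) q * qpoch (q * a / z) q) * (qpoch (b * z) q * qpoch (q * b / z) q) *
      (qpoch (c * z) q * qpoch (q * c / z) q) * (qpoch (d * z) q * qpoch (q * d / z) q))" for z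
  (* Any m strictly between the largest modulus of a parameter and 1 makes U an annulus without poles of \<Phi>
     that contains the unit circle and the circle of radius |q|^(1/2). *)
  define M where "M = max (max (norm a) (norm b)) (max (norm c) (norm d))"
  have M: "norm a \<le> M" "norm b \<le> M" "norm c \<le> M" "norm d \<le> M" "M < 1"
    using abcd by (auto simp: M_def)
  define m where "m = (M + 1) / 2"
  have m: "0 < m" "m < 1" "norm a < m" "norm b < m" "norm c < m" "norm d < m"
    using M order_trans[OF norm_ge_zero M(1)] by (simp_all add: m_def)
  define U where "U = {z :: complex. norm q * m < norm z \<and> norm z < 1 / m}"
  have den: "qpoch (x * z) q \<noteq> 0 \<and> qpoch (q * x / z) q \<noteq> 0" if "norm x < m" "z \<in> U" for x z :: complex
  proof -
    have z: "norm q * m < norm z" "norm z * m < 1" using that(2) m by (auto simp: U_def field_simps)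
    have "norm x * norm z \<le> m * norm z" using that m by (intro mult_right_mono) auto
    moreover have "norm q * norm x \<le> norm q * m" using that by (intro mult_left_mono) auto
    ultimately have "norm x * norm z < 1" "norm q * norm x < norm z" using z by (auto simp: mult_ac)
    moreover have "z \<noteq> 0" using z(1) mult_pos_pos[OF norm_q_pos m(1)] by auto
    ultimately show ?thesis by (auto intro!: qpoch_nz simp: norm_mult norm_divide)
  qed
  have U0: "0 \<notin> U" using m mult_pos_pos[OF norm_q_pos, of m] by (simp add: U_def)
  have "s holomorphic_on U" using s U0 by (rule_tac holomorphic_on_subset) auto
  hence hol: "\<Phi> holomorphic_on U"
    unfolding \<Phi>_def using U0 den m by (intro holomorphic_intros) auto
  have odd: "\<Phi> (q / z) = - \<Phi> z" if "z \<noteq> 0" for z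
  proof (cases "z^2 = q")
    case True
    hence "q / z = z" using that by (simp add: power2_eq_square field_simps)
    moreover have "\<Phi> z = 0" using True q_nz unfolding \<Phi>_def by (simp add: qpoch_rec[of 1])
    ultimately show ?thesis by simp
  next
    case False
    have e1: "qpoch (z^2 / q) q = (1 - z^2 / q) * qpoch (z^2) q"
      using qpoch_rec[of "z^2 / q"] q_nz by simp
    have e2: "qpoch (q / z^2) q = (1 - q / z^2) * qpoch (q^2 / z^2) q"
      using qpoch_rec[of "q / z^2"] by (simp add: power2_eq_square)
    define D where "D = ((qpoch (a * z) q * qpoch (q * a / z) q) * (qpoch (b * z) q * qpoch (q * b / z) q) *
      (qpoch (c * z) q * qpoch (q * c / z) q) * (qpoch (d * z) q * qpoch (q * d / z) q))"
    have "\<Phi> (q / z) = q / z * s z * (qpoch (q^2 / z^2) q * qpoch (z^2 / q) q) / D"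
      unfolding \<Phi>_def D_def using that q_nz sym[OF that]
      by (simp add: power_divide power2_eq_square mult_ac)
    also have "q / z * s z * (qpoch (q^2 / z^2) q * qpoch (z^2 / q) q) = - (z * s z * (qpoch (z^2) q * qpoch (q / z^2) q))"
      unfolding e1 e2 using that q_nz by (simp add: field_simps power2_eq_square)
    finally show ?thesis unfolding \<Phi>_def D_def by simp
  qed
  (* On the circle through \<rho>, the map z \<rightarrow> q/z is \<rho> w \<rightarrow> \<rho>/w, an inversion of the unit circle. *)
  define \<rho> where "\<rho> = csqrt q"
  have \<rho>: "\<rho>^2 = q" "\<rho> \<noteq> 0" using q_nz by (auto simp: \<rho>_def)
  hence n\<rho>: "(norm \<rho>)^2 = norm q" by (metis norm_power)
  have \<rho>1: "norm \<rho> < 1" using q_lt_1 abs_square_less_1[of "norm \<rho>"] by (simp add: n\<rho>)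
  have "circle_mean \<Phi> = circle_mean (\<lambda>z. \<Phi> (\<rho> * z))"
  proof (rule circle_mean_scale[symmetric, of _ "norm q * m" "1 / m"])
    have "norm q * m < norm q * 1" using m norm_q_pos by (intro mult_strict_left_mono) auto
    also have "norm q \<le> norm \<rho>" unfolding n\<rho>[symmetric] using \<rho>1
      by (simp add: power2_eq_square mult_left_le_one_le)
    finally show "norm q * m < norm \<rho>" by simp
    show "norm q * m < 1" using \<open>norm q * m < norm q * 1\<close> q_lt_1 by simp
    show "1 < 1 / m" using m by (simp add: field_simps)
    with \<rho>1 show "norm \<rho> < 1 / m" by linarith
  qed (use hol m in \<open>auto simp: U_def\<close>)
  also have "\<dots> = circle_mean (\<lambda>z. \<Phi> (\<rho> * (1 / z)))" by (rule circle_mean_inverse[symmetric])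
  also have "\<dots> = circle_mean (\<lambda>z. (-1) * \<Phi> (\<rho> * z))"
  proof (rule circle_mean_cong)
    fix z :: complex assume "norm z = 1"
    hence "\<rho> * z \<noteq> 0" using \<rho> by auto
    moreover from this have "q / (\<rho> * z) = \<rho> * (1 / z)"
      unfolding \<rho>(1)[symmetric] by (simp add: power2_eq_square)
    ultimately show "\<Phi> (\<rho> * (1 / z)) = (-1) * \<Phi> (\<rho> * z)"
      using odd[of "\<rho> * z"] by simp
  qed
  also have "\<dots> = - circle_mean (\<lambda>z. \<Phi> (\<rho> * z))" by (subst circle_mean_cmult) simp
  also have "circle_mean (\<lambda>z. \<Phi> (\<rho> * z)) = circle_mean \<Phi>"
    using \<open>circle_mean \<Phi> = circle_mean (\<lambda>z. \<Phi> (\<rho> * z))\<close> by simp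
  finally have zero: "circle_mean \<Phi> = 0" by simp
  have sphU: "sphere 0 1 \<subseteq> U"
  proof
    fix z :: complex assume "z \<in> sphere 0 1"
    moreover have "norm q * m < 1"
      using mult_strict_mono'[of "norm q" 1 m 1] m q_lt_1 by simp
    ultimately show "z \<in> U" using m by (auto simp: U_def field_simps)
  qed
  hence cont: "continuous_on (sphere 0 1) \<Phi>"
    using hol holomorphic_on_imp_continuous_on continuous_on_subset by blast
  have cont': "continuous_on (sphere 0 1) (\<lambda>z. \<Phi> (1 / z))"
    by (rule continuous_on_compose2[OF cont]) (auto intro!: continuous_intros simp: norm_divide)
  have "circle_mean (\<lambda>z. p z * aw_weight a b c d z) = circle_mean (\<lambda>z. \<Phi> z + \<Phi> (1 / z))"
  proof (rule circle_mean_cong)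
    fix z :: complex assume z: "norm z = 1"
    hence z0: "z \<noteq> 0" by auto
    have zi: "norm (1 / z) = 1" using z by (simp add: norm_divide)
    show "p z * aw_weight a b c d z = \<Phi> z + \<Phi> (1 / z)"
    proof (cases "z^2 = 1")
      case True
      thus ?thesis by (simp add: \<Phi>_def aw_weight_def qpoch_rec[of 1] power_one_over)
    next
      case False
      have den1: "qpoch (x * z) q \<noteq> 0 \<and> qpoch (x / z) q \<noteq> 0" if "norm x < 1" for x
        using that z by (auto intro!: qpoch_nz simp: norm_mult norm_divide)
      have e1: "qpoch (x / z) q = (1 - x / z) * qpoch (q * x / z) q" for x
        using qpoch_rec[of "x / z"] by (simp add: mult_ac)
      have e2: "qpoch (x * z) q = (1 - x * z) * qpoch (q * x * z) q" for x
        using qpoch_rec[of "x * z"] by (simp add: mult_ac)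
      have f1: "qpoch (1 / z^2) q = (1 - 1 / z^2) * qpoch (q / z^2) q"
        using qpoch_rec[of "1 / z^2"] by (simp add: mult_ac)
      have f2: "qpoch (z^2) q = (1 - z^2) * qpoch (q * z^2) q"
        using qpoch_rec[of "z^2"] by (simp add: mult_ac)
      define W where "W = qpoch (z^2) q * qpoch (1 / z^2) q"
      define D where "D = ((qpoch (a * z) q * qpoch (a / z) q) * (qpoch (b * z) q * qpoch (b / z) q) *
        (qpoch (c * z) q * qpoch (c / z) q) * (qpoch (d * z) q * qpoch (d / z) q))"
      have D: "D \<noteq> 0" unfolding D_def using den1 abcd by auto
      have nz: "1 - x / z \<noteq> 0" "1 - x * z \<noteq> 0" "qpoch (q * x / z) q \<noteq> 0" "qpoch (q * x * z) q \<noteq> 0" if "norm x < 1" for x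
        using den1[OF that] e1[of x] e2[of x] by auto
      have zz: "z - 1 / z \<noteq> 0" "1 - 1 / z^2 \<noteq> 0" "1 - z^2 \<noteq> 0"
        using False z0 by (auto simp: field_simps power2_eq_square)
      have g1: "\<Phi> z = z^2 / (z - 1 / z) * ((1 - a / z) * (1 - b / z) * (1 - c / z) * (1 - d / z)) * s z * (W / D)"
      proof -
        have WD: "W / D = qpoch (z^2) q * ((1 - 1 / z^2) * qpoch (q / z^2) q) /
          ((qpoch (a * z) q * ((1 - a / z) * qpoch (q * a / z) q)) * (qpoch (b * z) q * ((1 - b / z) * qpoch (q * b / z) q)) *
        (qpoch (c * z) q * ((1 - c / z) * qpoch (q * c / z) q)) * (qpoch (d * z) q * ((1 - d / z) * qpoch (q * d / z) q)))"
          unfolding W_def D_def f1 e1[of a] e1[of b] e1[of c] e1[of d] ..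
        have "z^2 * (1 - 1 / z^2) = z * (z - 1 / z)"
          using z0 by (simp add: field_simps power2_eq_square)
        hence z_eq: "z^2 / (z - 1 / z) * (1 - 1 / z^2) = z"
          using zz(1) by simp
        have "\<Phi> z = ((1 - a / z) * (1 - b / z) * (1 - c / z) * (1 - d / z)) *
            (z * s z * (qpoch (z^2) q * qpoch (q / z^2) q) /
          ((qpoch (a * z) q * ((1 - a / z) * qpoch (q * a / z) q)) * (qpoch (b * z) q * ((1 - b / z) * qpoch (q * b / z) q)) *
        (qpoch (c * z) q * ((1 - c / z) * qpoch (q * c / z) q)) * (qpoch (d * z) q * ((1 - d / z) * qpoch (q * d / z) q))))"
          unfolding \<Phi>_def by (intro cancel4 nz abcd)
        also have "z * s z * (qpoch (z^2) q * qpoch (q / z^2) q) =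
            (z^2 / (z - 1 / z) * s z) * (qpoch (z^2) q * ((1 - 1 / z^2) * qpoch (q / z^2) q))"
          by (subst z_eq[symmetric], simp only: mult_ac)
        finally show ?thesis unfolding WD by (simp only: mult_ac times_divide_eq_left times_divide_eq_right)
      qed
      have g2: "\<Phi> (1 / z) = - (1 / z^2 / (z - 1 / z) * ((1 - a * z) * (1 - b * z) * (1 - c * z) * (1 - d * z)) * s (1 / z) * (W / D))"
      proof -
        have \<Phi>inv: "\<Phi> (1 / z) = 1 / z * s (1 / z) * (qpoch (1 / z^2) q * qpoch (q * z^2) q) /
          ((qpoch (a / z) q * qpoch (q * a * z) q) * (qpoch (b / z) q * qpoch (q * b * z) q) *
           (qpoch (c / z) q * qpoch (q * c * z) q) * (qpoch (d / z) q * qpoch (q * d * z) q))"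
          unfolding \<Phi>_def by (simp add: power_one_over)
        have WD: "W / D = qpoch (1 / z^2) q * ((1 - z^2) * qpoch (q * z^2) q) /
          ((qpoch (a / z) q * ((1 - a * z) * qpoch (q * a * z) q)) * (qpoch (b / z) q * ((1 - b * z) * qpoch (q * b * z) q)) *
        (qpoch (c / z) q * ((1 - c * z) * qpoch (q * c * z) q)) * (qpoch (d / z) q * ((1 - d * z) * qpoch (q * d * z) q)))"
          unfolding W_def D_def f2 e2[of a] e2[of b] e2[of c] e2[of d] by (simp only: mult_ac)
        have h: "1 / z^2 * (1 - z^2) = - (1 / z) * (z - 1 / z)"
          using z0 by (simp add: field_simps power2_eq_square)
        have "- (1 / z^2 / (z - 1 / z) * (1 - z^2)) = - (1 / z^2 * (1 - z^2)) / (z - 1 / z)"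
          by simp
        also have "\<dots> = 1 / z" unfolding h using zz(1) by simp
        finally have z_eq: "- (1 / z^2 / (z - 1 / z) * (1 - z^2)) = 1 / z" .
        have "\<Phi> (1 / z) = ((1 - a * z) * (1 - b * z) * (1 - c * z) * (1 - d * z)) *
            (1 / z * s (1 / z) * (qpoch (1 / z^2) q * qpoch (q * z^2) q) /
          ((qpoch (a / z) q * ((1 - a * z) * qpoch (q * a * z) q)) * (qpoch (b / z) q * ((1 - b * z) * qpoch (q * b * z) q)) *
        (qpoch (c / z) q * ((1 - c * z) * qpoch (q * c * z) q)) * (qpoch (d / z) q * ((1 - d * z) * qpoch (q * d * z) q))))"
          unfolding \<Phi>inv by (intro cancel4 nz abcd)
        also have "1 / z * s (1 / z) * (qpoch (1 / z^2) q * qpoch (q * z^2) q) =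
            - ((1 / z^2 / (z - 1 / z) * s (1 / z)) * (qpoch (1 / z^2) q * ((1 - z^2) * qpoch (q * z^2) q)))"
          by (subst z_eq[symmetric]) (simp only: mult_ac minus_mult_left[symmetric] minus_mult_right[symmetric])
        finally show ?thesis unfolding WD
          by (simp only: mult_ac times_divide_eq_left times_divide_eq_right minus_mult_left[symmetric] minus_mult_right[symmetric] minus_divide_left[symmetric])
      qed
      have "p z = (z^2 * ((1 - a / z) * (1 - b / z) * (1 - c / z) * (1 - d / z)) * s z -
         1 / z^2 * ((1 - a * z) * (1 - b * z) * (1 - c * z) * (1 - d * z)) * s (1 / z)) / (z - 1 / z)"
        using p[OF z] zz by (simp add: eq_divide_eq mult.commute)
      hence "p z * (W / D) = \<Phi> z + \<Phi> (1 / z)"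
        unfolding g1 g2 by (simp add: diff_divide_distrib left_diff_distrib)
      thus ?thesis by (simp add: aw_weight_def W_def D_def)
    qed
  qed
  also have "\<dots> = 0"
    by (subst circle_mean_add[OF cont cont'], subst circle_mean_inverse) (simp add: zero)
  finally show ?thesis .
qed

text \<open>For s = 1 the polynomial p in aw_relation is a combination of z + 1/z and 1.\<close>
lemma aw_first_moment:
  assumes abcd: "norm a < 1" "norm b < 1" "norm c < 1" "norm d < 1"
  shows "(1 - a * b * c * d) * circle_mean (\<lambda>z. (z + 1 / z) * aw_weight a b c d z) =
    (a + b + c + d - (a * b * c + a * b * d + a * c * d + b * c * d)) * circle_mean (aw_weight a b c d)"
proof -
  define e1 where "e1 = a + b + c + d - (a * b * c + a * b * d + a * c * d + b * c * d)"
  note cont = aw_weight_continuous_on[OF abcd]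
  have "circle_mean (\<lambda>z. ((1 - a * b * c * d) * (z + 1 / z) - e1) * aw_weight a b c d z) = 0"
  proof (rule aw_relation[OF abcd, of "\<lambda>_. 1"])
    fix z :: complex assume "norm z = 1"
    hence "z \<noteq> 0" by auto
    thus "(z - 1 / z) * ((1 - a * b * c * d) * (z + 1 / z) - e1) =
       z^2 * ((1 - a / z) * (1 - b / z) * (1 - c / z) * (1 - d / z)) * 1 -
       1 / z^2 * ((1 - a * z) * (1 - b * z) * (1 - c * z) * (1 - d * z)) * 1"
      unfolding e1_def by (simp add: field_simps power2_eq_square)
  qed auto
  also have "(\<lambda>z. ((1 - a * b * c * d) * (z + 1 / z) - e1) * aw_weight a b c d z) =
     (\<lambda>z. (1 - a * b * c * d) * ((z + 1 / z) * aw_weight a b c d z) - e1 * aw_weight a b c d z)"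
    by (simp only: left_diff_distrib mult.assoc)
  also have "circle_mean \<dots> = (1 - a * b * c * d) * circle_mean (\<lambda>z. (z + 1 / z) * aw_weight a b c d z) - e1 * circle_mean (aw_weight a b c d)"
    by (subst circle_mean_diff) (auto intro!: continuous_intros cont simp: circle_mean_cmult)
  finally show ?thesis by (simp add: e1_def)
qed

lemma cancel2:
  fixes x y :: complex
  assumes "x \<noteq> 0" "y \<noteq> 0"
  shows "X / ((u * v) * B * C * D) = x * y * (X / (((x * u) * (y * v)) * B * C * D))"
  using assms by (simp add: divide_inverse) (simp add: field_simps)

text \<open>Replacing a by a q multiplies the weight by (1 - a z) (1 - a/z), which is a combination of z + 1/z
  and 1, so that aw_first_moment applies.\<close>
lemma aw_contiguous:
  assumes abcd: "norm a < 1" "norm b < 1" "norm c < 1" "norm d < 1"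
  shows "(1 - a * b * c * d) * circle_mean (aw_weight (a * q) b c d) =
    (1 - a * b) * (1 - a * c) * (1 - a * d) * circle_mean (aw_weight a b c d)"
proof -
  note cont = aw_weight_continuous_on[OF abcd]
  have "circle_mean (aw_weight (a * q) b c d) =
        circle_mean (\<lambda>z. (1 + a^2) * aw_weight a b c d z - a * ((z + 1 / z) * aw_weight a b c d z))"
  proof (rule circle_mean_cong)
    fix z :: complex assume z: "norm z = 1"
    hence z0: "z \<noteq> 0" by auto
    have e: "qpoch (a * z) q = (1 - a * z) * qpoch (a * q * z) q"
            "qpoch (a / z) q = (1 - a / z) * qpoch (a * q / z) q"
      using qpoch_rec[of "a * z"] qpoch_rec[of "a / z"] by (simp_all add: mult_ac)
    have "qpoch (a * z) q \<noteq> 0" "qpoch (a / z) q \<noteq> 0"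
      using abcd z by (auto intro!: qpoch_nz simp: norm_mult norm_divide)
    hence "1 - a * z \<noteq> 0" "1 - a / z \<noteq> 0" unfolding e by auto
    hence "aw_weight (a * q) b c d z = (1 - a * z) * (1 - a / z) * aw_weight a b c d z"
      unfolding aw_weight_def e by (rule cancel2)
    also have "(1 - a * z) * (1 - a / z) = (1 + a^2) - a * (z + 1 / z)"
      using z0 by (simp add: field_simps power2_eq_square)
    finally show "aw_weight (a * q) b c d z =
        (1 + a^2) * aw_weight a b c d z - a * ((z + 1 / z) * aw_weight a b c d z)"
      by (simp add: algebra_simps)
  qed
  also have "\<dots> = (1 + a^2) * circle_mean (aw_weight a b c d) - a * circle_mean (\<lambda>z. (z + 1 / z) * aw_weight a b c d z)"
    by (subst circle_mean_diff) (auto intro!: continuous_intros cont simp: circle_mean_cmult)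
  finally have eq: "circle_mean (aw_weight (a * q) b c d) = \<dots>" .
  have "(1 - a * b * c * d) * circle_mean (aw_weight (a * q) b c d) =
     (1 - a * b * c * d) * (1 + a^2) * circle_mean (aw_weight a b c d) -
     a * ((1 - a * b * c * d) * circle_mean (\<lambda>z. (z + 1 / z) * aw_weight a b c d z))"
    unfolding eq by (simp only: right_diff_distrib mult_ac)
  thus ?thesis unfolding aw_first_moment[OF abcd]
    by (simp add: algebra_simps power2_eq_square)
qed

lemma aw_param_limit:
  assumes abcd: "norm a < 1" "norm b < 1" "norm c < 1" "norm d < 1"
  shows "(\<lambda>n. circle_mean (aw_weight (a * q ^ n) b c d)) \<longlonglongrightarrow> circle_mean (aw_weight 0 b c d)"
proof -
  let ?e = "\<lambda>s::real. exp (2 * of_real pi * \<i> * of_real s)"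
  have "continuous_on (ball 0 1 \<times> cbox 0 1) (\<lambda>x. aw_weight (fst x) b c d (?e (snd x)))"
    unfolding aw_weight_def
    by (intro continuous_intros) (use abcd in \<open>auto simp: qpoch_nz norm_mult norm_divide\<close>)
  hence "continuous_on (ball 0 1) (\<lambda>a. integral (cbox 0 1) (\<lambda>s. aw_weight a b c d (?e s)))"
    by (intro integral_continuous_on_param) (simp add: case_prod_unfold)
  hence cont: "continuous_on (ball 0 1) (\<lambda>a. circle_mean (aw_weight a b c d))"
    by (simp add: circle_mean_def)
  have "(\<lambda>n. a * q ^ n) \<longlonglongrightarrow> 0"
    using q_lt_1 by (auto intro!: tendsto_mult_right_zero LIMSEQ_power_zero)
  moreover have "isCont (\<lambda>a. circle_mean (aw_weight a b c d)) 0"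
    using cont by (simp add: continuous_on_eq_continuous_at)
  ultimately show ?thesis by (rule isCont_tendsto_compose[rotated])
qed

text \<open>Iteration of aw_contiguous replaces a by a q^n, which tends to 0.\<close>
lemma aw_reduce:
  assumes abcd: "norm a < 1" "norm b < 1" "norm c < 1" "norm d < 1"
  shows "circle_mean (aw_weight a b c d) * (qpoch (a * b) q * qpoch (a * c) q * qpoch (a * d) q) =
    qpoch (a * b * c * d) q * circle_mean (aw_weight 0 b c d)"
proof -
  define G where "G n = circle_mean (aw_weight (a * q ^ n) b c d) *
     (qpoch (a * b * q ^ n) q * qpoch (a * c * q ^ n) q * qpoch (a * d * q ^ n) q)" for n
  have step: "G n * qpoch (a * b * c * d) q = G 0 * qpoch (a * b * c * d * q ^ n) q" for n
  proof (induction n)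
    case (Suc n)
    have an: "norm (a * q ^ n) < 1"
    proof -
      have "norm a * norm q ^ n \<le> norm a * 1"
        using q_lt_1 by (intro mult_left_mono power_le_one) auto
      thus ?thesis using abcd by (simp add: norm_mult norm_power)
    qed
    define A where "A = a * q ^ n"
    have r: "qpoch (A * x) q = (1 - A * x) * qpoch (A * q * x) q" for x
      using qpoch_rec[of "A * x"] by (simp add: mult_ac)
    have G: "G n = circle_mean (aw_weight A b c d) * (qpoch (A * b) q * qpoch (A * c) q * qpoch (A * d) q)"
      and G': "G (Suc n) = circle_mean (aw_weight (A * q) b c d) * (qpoch (A * q * b) q * qpoch (A * q * c) q * qpoch (A * q * d) q)"
      by (simp_all add: G_def A_def mult_ac)
    have "norm (A * b * c * d) < 1"
    proof -
      have "norm A * norm b \<le> 1" "norm c * norm d \<le> 1"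
        using abcd an by (auto simp: A_def intro!: mult_le_one)
      have "norm (A * b * c * d) = norm A * (norm b * (norm c * norm d))" by (simp add: norm_mult)
      also have "\<dots> \<le> norm A * 1" using abcd by (intro mult_left_mono mult_le_one) auto
      finally show ?thesis using an A_def by simp
    qed
    hence nz: "1 - A * b * c * d \<noteq> 0" by auto
    have key: "(1 - A * b * c * d) * G (Suc n) = G n"
      unfolding G G' r using aw_contiguous[of A b c d] an abcd unfolding A_def[symmetric]
      by (simp add: mult.assoc[symmetric])
    have "G n * qpoch (a * b * c * d) q = (1 - A * b * c * d) * (G (Suc n) * qpoch (a * b * c * d) q)"
      unfolding key[symmetric] by simp
    moreover have "qpoch (a * b * c * d * q ^ n) q = (1 - A * b * c * d) * qpoch (a * b * c * d * q ^ Suc n) q"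
      using qpoch_rec[of "a * b * c * d * q ^ n"] by (simp add: A_def mult_ac)
    ultimately show ?case using Suc nz by simp
  qed simp
  have qn: "(\<lambda>n. x * q ^ n) \<longlonglongrightarrow> 0" for x
    using q_lt_1 by (auto intro!: tendsto_mult_right_zero LIMSEQ_power_zero)
  have "G \<longlonglongrightarrow> circle_mean (aw_weight 0 b c d) * (qpoch 0 q * qpoch 0 q * qpoch 0 q)"
    unfolding G_def by (intro tendsto_intros aw_param_limit abcd qn)
  hence "(\<lambda>n. G n * qpoch (a * b * c * d) q) \<longlonglongrightarrow> circle_mean (aw_weight 0 b c d) * qpoch (a * b * c * d) q"
    by (auto intro!: tendsto_intros)
  moreover have "(\<lambda>n. G 0 * qpoch (a * b * c * d * q ^ n) q) \<longlonglongrightarrow> G 0 * qpoch 0 q"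
    by (intro tendsto_intros qn)
  ultimately have "circle_mean (aw_weight 0 b c d) * qpoch (a * b * c * d) q = G 0 * qpoch 0 q"
    unfolding step by (rule LIMSEQ_unique)
  thus ?thesis by (simp add: G_def mult_ac)
qed

lemma aw_weight_swap:
  "aw_weight a b c d = aw_weight b a c d" "aw_weight a b c d = aw_weight c b a d"
  "aw_weight a b c d = aw_weight d b c a"
  by (auto simp: aw_weight_def fun_eq_iff mult_ac)

text \<open>The dependence of the Askey-Wilson integral on its parameters, obtained by sending them to 0 one
  after the other. Only this dependence matters: the mean for vanishing parameters enters the double
  kernel as a constant factor.\<close>
theorem aw_integral:
  assumes abcd: "norm a < 1" "norm b < 1" "norm c < 1" "norm d < 1"
  shows "circle_mean (aw_weight a b c d) *
      (qpoch (a * b) q * qpoch (a * c) q * qpoch (a * d) q * qpoch (b * c) q * qpoch (b * d) q * qpoch (c * d) q) =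
    qpoch (a * b * c * d) q * circle_mean (aw_weight 0 0 0 0)"
proof -
  have 1: "circle_mean (aw_weight a b c d) * (qpoch (a * b) q * qpoch (a * c) q * qpoch (a * d) q) =
    qpoch (a * b * c * d) q * circle_mean (aw_weight 0 b c d)" by (rule aw_reduce[OF abcd])
  have 2: "circle_mean (aw_weight 0 b c d) * (qpoch (b * c) q * qpoch (b * d) q) = circle_mean (aw_weight 0 0 c d)"
    using aw_reduce[of b 0 c d] abcd aw_weight_swap(1)[of 0 b] by simp
  have 3: "circle_mean (aw_weight 0 0 c d) * qpoch (c * d) q = circle_mean (aw_weight 0 0 0 d)"
    using aw_reduce[of c 0 0 d] abcd aw_weight_swap(2)[of 0 0 c] by simp
  have 4: "circle_mean (aw_weight 0 0 0 d) = circle_mean (aw_weight 0 0 0 0)"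
    using aw_reduce[of d 0 0 0] abcd aw_weight_swap(3)[of 0 0 0 d] by simp
  show ?thesis using 1 unfolding 4[symmetric] 3[symmetric] 2[symmetric] by (simp add: mult_ac)
qed

end

context nome
begin

section \<open>Rogers polynomials\<close>

definition rogers_coeff :: "complex \<Rightarrow> nat \<Rightarrow> complex" where
  "rogers_coeff \<beta> k = (\<Prod>i<k. (1 - \<beta> * q ^ i) / (1 - q ^ Suc i))"

text \<open>The q-binomial series of (\<beta> x s; q) / (x s; q), as a formal power series in s.\<close>
definition rogers_fps :: "complex \<Rightarrow> complex \<Rightarrow> complex fps" where
  "rogers_fps \<beta> x = Abs_fps (\<lambda>k. rogers_coeff \<beta> k * x ^ k)"

text \<open>The continuous q-ultraspherical polynomials of Rogers in (z + 1/z)/2, defined by their generating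
  function (\<beta> z s, \<beta> s/z; q) / (z s, s/z; q).\<close>
definition rogers :: "complex \<Rightarrow> nat \<Rightarrow> complex \<Rightarrow> complex" where
  "rogers \<beta> n z = fps_nth (rogers_fps \<beta> z * rogers_fps \<beta> (1 / z)) n"

lemma one_minus_q_nz: "1 - q ^ Suc i \<noteq> 0"
proof -
  have "norm q * norm q ^ i \<le> norm q * 1"
    using q_lt_1 by (intro mult_left_mono power_le_one) auto
  hence "norm (q ^ Suc i) < 1" using q_lt_1 by (simp add: norm_mult norm_power)
  thus ?thesis by auto
qed

lemma rogers_coeff_0 [simp]: "rogers_coeff \<beta> 0 = 1"
  by (simp add: rogers_coeff_def)

lemma rogers_coeff_Suc: "(1 - q ^ Suc k) * rogers_coeff \<beta> (Suc k) = (1 - \<beta> * q ^ k) * rogers_coeff \<beta> k"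
  using one_minus_q_nz[of k] by (simp add: rogers_coeff_def)

text \<open>The functional equation of the quotient (\<beta> x s; q) / (x s; q): the first factors of both products
  split off.\<close>
lemma rogers_fps_shift:
  "(1 - fps_const x * fps_X) * rogers_fps \<beta> x = (1 - fps_const (\<beta> * x) * fps_X) * rogers_fps \<beta> (q * x)"
proof (rule fps_ext)
  fix n
  show "fps_nth ((1 - fps_const x * fps_X) * rogers_fps \<beta> x) n = fps_nth ((1 - fps_const (\<beta> * x) * fps_X) * rogers_fps \<beta> (q * x)) n"
  proof (cases n)
    case (Suc k)
    have "rogers_coeff \<beta> (Suc k) * x ^ Suc k - x * (rogers_coeff \<beta> k * x ^ k) -
       (rogers_coeff \<beta> (Suc k) * (q * x) ^ Suc k - \<beta> * x * (rogers_coeff \<beta> k * (q * x) ^ k)) =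
       x ^ Suc k * ((1 - q ^ Suc k) * rogers_coeff \<beta> (Suc k) - (1 - \<beta> * q ^ k) * rogers_coeff \<beta> k)"
      by (simp add: algebra_simps power_mult_distrib)
    also have "\<dots> = 0" by (simp only: rogers_coeff_Suc) simp
    finally show ?thesis using Suc
      by (simp add: left_diff_distrib mult.assoc rogers_fps_def)
  qed (simp add: left_diff_distrib mult.assoc rogers_fps_def)
qed

lemma rogers_fps_scale:
  "fps_nth (rogers_fps \<beta> (c * x) * rogers_fps \<beta> (c * y)) n = c ^ n * fps_nth (rogers_fps \<beta> x * rogers_fps \<beta> y) n"
  by (auto simp: fps_mult_nth rogers_fps_def sum_distrib_left power_mult_distrib mult_ac power_add[symmetric] intro!: sum.cong)

lemma rogers_0 [simp]: "rogers \<beta> 0 z = 1"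
  by (simp add: rogers_def rogers_fps_def)

lemma fps_linear_mult_nth:
  "fps_nth ((1 - fps_const u * fps_X) * f) 0 = fps_nth f 0"
  "fps_nth ((1 - fps_const u * fps_X) * f) (Suc n) = fps_nth f (Suc n) - u * fps_nth f n"
  for f :: "complex fps"
  by (simp_all add: left_diff_distrib mult.assoc)

text \<open>The functional equations for z and for 1/z, multiplied. Its coefficients give the three-term
  recurrence.\<close>
lemma rogers_quadratic:
  assumes "z \<noteq> 0"
  shows "(1 - fps_const z * fps_X) * ((1 - fps_const (1 / z) * fps_X) * (rogers_fps \<beta> z * rogers_fps \<beta> (1 / z))) =
   (1 - fps_const (\<beta> * z) * fps_X) * ((1 - fps_const (\<beta> * (1 / z)) * fps_X) * (rogers_fps \<beta> (q * z) * rogers_fps \<beta> (q * (1 / z))))"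
  using arg_cong2[OF rogers_fps_shift[of z \<beta>] rogers_fps_shift[of "1 / z" \<beta>], of "(*)"] by (simp only: mult_ac)

lemma rogers_1: "z \<noteq> 0 \<Longrightarrow> (1 - q) * rogers \<beta> 1 z = (1 - \<beta>) * (z + 1 / z)"
  using arg_cong[OF rogers_quadratic[of z \<beta>], of "\<lambda>f. fps_nth f (Suc 0)"]
  unfolding fps_linear_mult_nth rogers_fps_scale rogers_def[symmetric] by (simp add: field_simps)

lemma rogers_recurrence_aux:
  fixes z w C0 C1 C2 Q \<beta> p :: complex
  assumes "C2 - w * C1 - z * (C1 - w * C0) =
    p * (p * Q) * C2 - \<beta> * w * (p * Q * C1) - \<beta> * z * (p * Q * C1 - \<beta> * w * (Q * C0))" "z * w = 1"
  shows "(1 - p * (p * Q)) * C2 = (z + w) * (1 - \<beta> * (p * Q)) * C1 - (1 - \<beta>^2 * Q) * C0"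
  using assms by algebra

lemma rogers_recurrence:
  assumes "z \<noteq> 0"
  shows "(1 - q ^ (n + 2)) * rogers \<beta> (n + 2) z =
    (z + 1 / z) * (1 - \<beta> * q ^ (n + 1)) * rogers \<beta> (n + 1) z - (1 - \<beta>^2 * q ^ n) * rogers \<beta> n z"
proof -
  define w where "w = 1 / z"
  have zw: "z * w = 1" using assms by (simp add: w_def)
  note F = arg_cong[OF rogers_quadratic[OF assms, of \<beta>], of "\<lambda>f. fps_nth f (Suc (Suc n))",
      unfolded fps_linear_mult_nth rogers_fps_scale rogers_def[symmetric], folded w_def]
  have "rogers \<beta> (Suc (Suc n)) z - w * rogers \<beta> (Suc n) z - z * (rogers \<beta> (Suc n) z - w * rogers \<beta> n z) =
    q * (q * q ^ n) * rogers \<beta> (Suc (Suc n)) z - \<beta> * w * (q * q ^ n * rogers \<beta> (Suc n) z) -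
    \<beta> * z * (q * q ^ n * rogers \<beta> (Suc n) z - \<beta> * w * (q ^ n * rogers \<beta> n z))"
    using F by simp
  hence "(1 - q * (q * q ^ n)) * rogers \<beta> (Suc (Suc n)) z =
    (z + w) * (1 - \<beta> * (q * q ^ n)) * rogers \<beta> (Suc n) z - (1 - \<beta>^2 * q ^ n) * rogers \<beta> n z"
    using zw by (rule rogers_recurrence_aux)
  thus ?thesis by (simp add: w_def)
qed

lemma rogers_inverse: "rogers \<beta> n (1 / z) = rogers \<beta> n z"
  by (simp add: rogers_def mult.commute)

text \<open>The factor 1 - \<beta> x s/q completes (\<beta> x s; q) to (\<beta> x s/q; q), and the factor 1 - x s cancels the
  first one in (x s; q). Both results are series with parameter \<beta>/q.\<close>
lemma rogers_fps_lower:
  "(1 - fps_const (\<beta> * x / q) * fps_X) * rogers_fps \<beta> x = rogers_fps (\<beta> / q) x"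
  "(1 - fps_const x * fps_X) * rogers_fps \<beta> x = rogers_fps (\<beta> / q) (q * x)"
proof -
  have r: "rogers_coeff \<beta> (Suc k) - \<beta> / q * rogers_coeff \<beta> k = rogers_coeff (\<beta> / q) (Suc k) \<and>
           rogers_coeff \<beta> (Suc k) - rogers_coeff \<beta> k = q ^ Suc k * rogers_coeff (\<beta> / q) (Suc k)" for k
  proof -
    have e: "rogers_coeff (\<beta> / q) (Suc k) * (1 - q ^ Suc k) = (1 - \<beta> / q) * rogers_coeff \<beta> k" 
    proof (induction k)
      case (Suc k)
      have "rogers_coeff (\<beta> / q) (Suc (Suc k)) * (1 - q ^ Suc (Suc k)) = (1 - \<beta> * q ^ k) * rogers_coeff (\<beta> / q) (Suc k)"
        using rogers_coeff_Suc[of "Suc k" "\<beta> / q"] q_nz by (simp add: mult_ac)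
      also have "\<dots> * (1 - q ^ Suc k) = (1 - \<beta> * q ^ k) * ((1 - \<beta> / q) * rogers_coeff \<beta> k)"
        using Suc by simp
      also have "\<dots> = (1 - \<beta> / q) * rogers_coeff \<beta> (Suc k) * (1 - q ^ Suc k)"
        using rogers_coeff_Suc[of k \<beta>] by (simp add: mult_ac)
      finally show ?case using one_minus_q_nz[of k] by simp
    qed (use one_minus_q_nz[of 0] in \<open>simp add: rogers_coeff_def\<close>)
    have "(1 - q ^ Suc k) * (rogers_coeff \<beta> (Suc k) - \<beta> / q * rogers_coeff \<beta> k) = (1 - q ^ Suc k) * rogers_coeff (\<beta> / q) (Suc k)"
    proof -
      have "(1 - q ^ Suc k) * (rogers_coeff \<beta> (Suc k) - \<beta> / q * rogers_coeff \<beta> k) = (1 - \<beta> * q ^ k) * rogers_coeff \<beta> k - (1 - q ^ Suc k) * (\<beta> / q * rogers_coeff \<beta> k)"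
        by (simp only: right_diff_distrib rogers_coeff_Suc)
      also have "\<dots> = (1 - \<beta> / q) * rogers_coeff \<beta> k" using q_nz by (simp add: field_simps)
      finally show ?thesis unfolding e[symmetric] by (simp only: mult_ac)
    qed
    moreover have "(1 - q ^ Suc k) * (rogers_coeff \<beta> (Suc k) - rogers_coeff \<beta> k) = (1 - q ^ Suc k) * (q ^ Suc k * rogers_coeff (\<beta> / q) (Suc k))"
    proof -
      have "(1 - q ^ Suc k) * (rogers_coeff \<beta> (Suc k) - rogers_coeff \<beta> k) = (1 - \<beta> * q ^ k) * rogers_coeff \<beta> k - (1 - q ^ Suc k) * rogers_coeff \<beta> k"
        by (simp only: right_diff_distrib rogers_coeff_Suc)
      also have "\<dots> = q ^ Suc k * ((1 - \<beta> / q) * rogers_coeff \<beta> k)" using q_nz by (simp add: field_simps)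
      finally show ?thesis unfolding e[symmetric] by (simp only: mult_ac)
    qed
    ultimately show ?thesis using one_minus_q_nz[of k] by simp
  qed
  show "(1 - fps_const (\<beta> * x / q) * fps_X) * rogers_fps \<beta> x = rogers_fps (\<beta> / q) x"
  proof (rule fps_ext)
    fix n
    show "fps_nth ((1 - fps_const (\<beta> * x / q) * fps_X) * rogers_fps \<beta> x) n = fps_nth (rogers_fps (\<beta> / q) x) n"
    proof (cases n)
      case (Suc k)
      have "fps_nth ((1 - fps_const (\<beta> * x / q) * fps_X) * rogers_fps \<beta> x) n = x ^ Suc k * (rogers_coeff \<beta> (Suc k) - \<beta> / q * rogers_coeff \<beta> k)"
        unfolding Suc fps_linear_mult_nth by (simp add: rogers_fps_def algebra_simps)
      thus ?thesis unfolding conjunct1[OF r] by (simp add: Suc rogers_fps_def mult_ac)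
    qed (simp add: fps_linear_mult_nth rogers_fps_def)
  qed
  show "(1 - fps_const x * fps_X) * rogers_fps \<beta> x = rogers_fps (\<beta> / q) (q * x)"
  proof (rule fps_ext)
    fix n
    show "fps_nth ((1 - fps_const x * fps_X) * rogers_fps \<beta> x) n = fps_nth (rogers_fps (\<beta> / q) (q * x)) n"
    proof (cases n)
      case (Suc k)
      have "fps_nth ((1 - fps_const x * fps_X) * rogers_fps \<beta> x) n = x ^ Suc k * (rogers_coeff \<beta> (Suc k) - rogers_coeff \<beta> k)"
        unfolding Suc fps_linear_mult_nth by (simp add: rogers_fps_def algebra_simps)
      thus ?thesis unfolding conjunct2[OF r] by (simp add: Suc rogers_fps_def mult_ac power_mult_distrib)
    qed (simp add: fps_linear_mult_nth rogers_fps_def)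
  qed
qed

text \<open>A companion of the Rogers polynomials that is invariant under z \<rightarrow> q/z instead of z \<rightarrow> 1/z. This is
  what aw_relation requires of its function s.\<close>
definition rogers_half :: "complex \<Rightarrow> nat \<Rightarrow> complex \<Rightarrow> complex" where
  "rogers_half \<beta> n z = fps_nth (rogers_fps (\<beta> / q) z * rogers_fps (\<beta> / q) (q / z)) n"

lemma rogers_half_sym: "z \<noteq> 0 \<Longrightarrow> rogers_half \<beta> n (q / z) = rogers_half \<beta> n z"
  using q_nz by (simp add: rogers_half_def mult.commute)

lemma rogers_half_holomorphic: "rogers_half \<beta> n holomorphic_on -{0}"
  unfolding rogers_half_def fps_mult_nth rogers_fps_def
  by (auto intro!: holomorphic_intros)

text \<open>By rogers_fps_lower, the generating function of rogers_half is that of the Rogers polynomials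
  multiplied by (1 - \<beta> z s/q) (1 - s/z).\<close>
lemma rogers_half_eq: 
  assumes "z \<noteq> 0"
  shows "rogers_half \<beta> 1 z = rogers \<beta> 1 z - (\<beta> * z / q + 1 / z)"
    "rogers_half \<beta> (n + 2) z = rogers \<beta> (n + 2) z - (\<beta> * z / q + 1 / z) * rogers \<beta> (n + 1) z + \<beta> / q * rogers \<beta> n z"
proof -
  have "(1 - fps_const (\<beta> * z / q) * fps_X) * ((1 - fps_const (1 / z) * fps_X) * (rogers_fps \<beta> z * rogers_fps \<beta> (1 / z)))
     = rogers_fps (\<beta> / q) z * rogers_fps (\<beta> / q) (q / z)"
    using arg_cong2[OF rogers_fps_lower(1)[of \<beta> z] rogers_fps_lower(2)[of "1 / z" \<beta>], of "(*)"] by (simp add: mult_ac)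
  note * = arg_cong[OF this, of "\<lambda>f. fps_nth f n" for n, folded rogers_half_def]
  show "rogers_half \<beta> 1 z = rogers \<beta> 1 z - (\<beta> * z / q + 1 / z)"
    unfolding *[symmetric] One_nat_def fps_linear_mult_nth rogers_def[symmetric] by (simp add: algebra_simps)
  have h: "\<beta> * z / q * (1 / z * x) = \<beta> / q * x" for x
    using assms by simp
  have "rogers_half \<beta> (Suc (Suc n)) z = rogers \<beta> (Suc (Suc n)) z - (\<beta> * z / q + 1 / z) * rogers \<beta> (Suc n) z + \<beta> / q * rogers \<beta> n z"
    unfolding *[symmetric] fps_linear_mult_nth rogers_def[symmetric] right_diff_distrib h
    by (simp add: distrib_right)
  thus "rogers_half \<beta> (n + 2) z = rogers \<beta> (n + 2) z - (\<beta> * z / q + 1 / z) * rogers \<beta> (n + 1) z + \<beta> / q * rogers \<beta> n z"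
    by simp
qed

end

text \<open>The algebra behind pearson_values. The letters a and b followed by mm, m, 0, 1, 2 stand for the values
  of the polynomials of degree n - 2, ..., n + 2 at two points. The outermost values are eliminated
  by the recurrences at n + 1 and n - 1, and the recurrence at n does the rest. The recurrence at
  n - 1 is multiplied by H, which is 0 for n = 0.\<close>
section \<open>The product formula\<close>

lemma pearson_values_aux:
  fixes s G H u0 u1 um d0 d1 dm a0 a1 a2 am amm b0 b1 b2 bm bmm A B \<beta> t :: complex
  assumes "A * a0 = u0 * a1 + d0 * am" "B * b0 = u0 * b1 + d0 * bm"
    and "A * a1 = u1 * a2 + d1 * a0" "B * b1 = u1 * b2 + d1 * b0"
    and Ha: "H * (A * am) = H * (um * a0 + dm * amm)" and Hb: "H * (B * bm) = H * (um * b0 + dm * bmm)"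
    and "G * d1 = s * u0" "H * um = s * d0" "s * t = 1 + \<beta>" "u0 + d0 = t" "u1 + d1 = t" "um + dm = t" "s^2 = \<beta>"
  shows "s * G * u1^2 * (a2 * b2) + (s * G * u1 * d1 + s * H * dm * um + (\<beta> * (A^2 + B^2) - (1 + \<beta>)^2)) * (a0 * b0) +
    s * H * dm^2 * (amm * bmm) - s * A * B * G * (a1 * b1) - s * A * B * H * (am * bm) = 0"
proof -
  have "u1 * a2 = A * a1 - d1 * a0" "u1 * b2 = B * b1 - d1 * b0" using assms by algebra+
  hence 1: "s * G * u1^2 * (a2 * b2) = s * G * ((A * a1 - d1 * a0) * (B * b1 - d1 * b0))"
    by (simp add: power2_eq_square) (metis mult.assoc mult.left_commute)
  have 2: "s * H * dm^2 * (amm * bmm) = s * H * ((A * am - um * a0) * (B * bm - um * b0))"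
  proof (cases "H = 0")
    case False
    hence "dm * amm = A * am - um * a0" "dm * bmm = B * bm - um * b0" using Ha Hb by auto
    thus ?thesis by (simp add: power2_eq_square) (metis mult.assoc mult.left_commute)
  qed simp
  have "s * G * ((A * a1 - d1 * a0) * (B * b1 - d1 * b0)) - s * A * B * G * (a1 * b1) =
      - (s^2 * u0) * (A * a1 * b0 + B * b1 * a0) + s^2 * u0 * d1 * (a0 * b0)"
    using \<open>G * d1 = s * u0\<close> by algebra
  moreover have "s * H * ((A * am - um * a0) * (B * bm - um * b0)) - s * A * B * H * (am * bm) =
      - (s^2 * d0) * (A * am * b0 + B * bm * a0) + s^2 * d0 * um * (a0 * b0)"
    using \<open>H * um = s * d0\<close> by algebra
  moreover have "s^2 * u0 * (A * a1 * b0 + B * b1 * a0) + s^2 * d0 * (A * am * b0 + B * bm * a0) = \<beta> * (A^2 + B^2) * (a0 * b0)"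
    using assms(1,2,13) by algebra
  moreover have "s * G * u1 * d1 + s * H * dm * um + s^2 * u0 * d1 + s^2 * d0 * um = (1 + \<beta>)^2"
  proof -
    have "s * G * u1 * d1 + s * H * dm * um + s^2 * u0 * d1 + s^2 * d0 * um = s^2 * (u0 * (u1 + d1) + d0 * (um + dm))"
      using \<open>G * d1 = s * u0\<close> \<open>H * um = s * d0\<close> by algebra
    also have "\<dots> = (s * t)^2" unfolding assms(11,12) assms(10)[symmetric] by (simp add: algebra_simps power2_eq_square)
    finally show ?thesis unfolding assms(9) .
  qed
  ultimately show ?thesis unfolding 1 2 by algebra
qed

text \<open>The elementary symmetric functions of the four Askey-Wilson parameters
  \<sigma> a^(\<plusminus>1) b^(\<plusminus>1) are polynomials in a + 1/a and b + 1/b.\<close>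
lemma aw_quartic_expand:
  fixes a b a' b' w \<sigma> \<beta> :: complex
  assumes "a * a' = 1" "b * b' = 1" "\<sigma>^2 = \<beta>"
  shows "(1 - \<sigma> * a * b * w) * (1 - \<sigma> * a * b' * w) * (1 - \<sigma> * b * a' * w) * (1 - \<sigma> * (a' * b') * w) =
    1 - \<sigma> * (a + a') * (b + b') * w + \<beta> * ((a + a')^2 + (b + b')^2 - 2) * w^2 -
    \<beta> * \<sigma> * (a + a') * (b + b') * w^3 + \<beta>^2 * w^4"
  using assms by algebra

text \<open>The antisymmetrisation in aw_relation for s z = Y - T/z with symmetric Y and T, where w = 1/z and
  the product of the four linear factors is expanded by aw_quartic_expand.\<close>
lemma pearson_aux:
  fixes z w A B Y T \<sigma> \<beta> :: complex
  assumes "z * w = 1"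
  shows "(z - w) * ((z + w) * ((1 - \<beta>^2) * Y + \<beta>^2 * ((z + w) * T)) - (1 + \<beta>)^2 * T + \<beta> * (A^2 + B^2) * T -
     \<sigma> * A * B * ((1 - \<beta>) * Y + \<beta> * ((z + w) * T))) =
    z^2 * (1 - \<sigma> * A * B * w + \<beta> * (A^2 + B^2 - 2) * w^2 - \<beta> * \<sigma> * A * B * w^3 + \<beta>^2 * w^4) * (Y - T * w) -
    w^2 * (1 - \<sigma> * A * B * z + \<beta> * (A^2 + B^2 - 2) * z^2 - \<beta> * \<sigma> * A * B * z^3 + \<beta>^2 * z^4) * (Y - T * z)"
  using assms by algebra

text \<open>The Rogers polynomials are going to be normalised at \<sigma>. In positive degrees rogers_half has
  the factor 1 - \<beta>/q, which is to be divided out (rogers_half_nrogers); hence \<beta> \<noteq> q.\<close>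
locale rogers_product = nome +
  fixes \<beta> \<sigma> :: complex
  assumes \<sigma>: "\<sigma>^2 = \<beta>" and \<beta>_nz: "\<beta> \<noteq> 0" and \<beta>_lt_1: "norm \<beta> < 1" and \<beta>_ne_q: "\<beta> \<noteq> q"
begin

lemma \<sigma>_nz: "\<sigma> \<noteq> 0"
  using \<sigma> \<beta>_nz by auto

text \<open>The value of rogers \<beta> n at \<sigma>, where the generating function collapses to
  (\<beta> \<sigma> s; q) / (s/\<sigma>; q), again a q-binomial series.\<close>
definition rogers_at_sigma :: "nat \<Rightarrow> complex" where
  "rogers_at_sigma n = (\<Prod>i<n. (1 - \<beta>^2 * q ^ i) / ((1 - q ^ Suc i) * \<sigma>))"

definition nrogers :: "nat \<Rightarrow> complex \<Rightarrow> complex" where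
  "nrogers n z = rogers \<beta> n z / rogers_at_sigma n"

definition rec_up :: "nat \<Rightarrow> complex" where
  "rec_up n = (1 - \<beta>^2 * q ^ n) / (\<sigma> * (1 - \<beta> * q ^ n))"

definition rec_down :: "nat \<Rightarrow> complex" where
  "rec_down n = \<sigma> * (1 - q ^ n) / (1 - \<beta> * q ^ n)"

lemma one_minus_nz: "norm x < 1 \<Longrightarrow> 1 - x * q ^ n \<noteq> 0"
proof -
  assume "norm x < 1"
  moreover have "norm x * norm q ^ n \<le> norm x * 1"
    using q_lt_1 by (intro mult_left_mono power_le_one) auto
  ultimately have "norm (x * q ^ n) < 1" by (simp add: norm_mult norm_power)
  thus ?thesis by auto
qed

lemma \<beta>2_lt_1: "norm (\<beta>^2) < 1"
  using \<beta>_lt_1 by (simp add: norm_power power_less_one_iff abs_square_less_1)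

lemmas nzs = one_minus_nz[OF \<beta>_lt_1] one_minus_nz[OF \<beta>2_lt_1] one_minus_q_nz[simplified] \<sigma>_nz q_nz \<beta>_nz

lemma rogers_at_sigma_nz: "rogers_at_sigma n \<noteq> 0"
  using one_minus_nz[OF \<beta>2_lt_1] one_minus_q_nz \<sigma>_nz by (simp add: rogers_at_sigma_def)

lemma rogers_at_sigma_Suc: "rogers_at_sigma (Suc n) = rogers_at_sigma n * ((1 - \<beta>^2 * q ^ n) / ((1 - q ^ Suc n) * \<sigma>))"
  by (simp add: rogers_at_sigma_def)

lemma rec_up_nz: "rec_up n \<noteq> 0"
  using nzs by (simp add: rec_up_def)

text \<open>This is the three-term recurrence at \<sigma>, where the normalised polynomials are 1.\<close>
lemma rec_up_plus_rec_down: "rec_up n + rec_down n = (1 + \<beta>) / \<sigma>"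
proof -
  have "rec_down n = (\<sigma> * \<sigma>) * (1 - q ^ n) / (\<sigma> * (1 - \<beta> * q ^ n))"
    using \<sigma>_nz by (simp add: rec_down_def)
  also have "\<sigma> * \<sigma> = \<beta>" using \<sigma> by (simp add: power2_eq_square)
  finally have "rec_up n + rec_down n = ((1 - \<beta>^2 * q ^ n) + \<beta> * (1 - q ^ n)) / (\<sigma> * (1 - \<beta> * q ^ n))"
    by (simp add: rec_up_def add_divide_distrib)
  also have "(1 - \<beta>^2 * q ^ n) + \<beta> * (1 - q ^ n) = (1 + \<beta>) * (1 - \<beta> * q ^ n)"
    by (simp add: algebra_simps power2_eq_square)
  finally show ?thesis using nzs(1)[of n] by simp
qed

lemma nrogers_0 [simp]: "nrogers 0 z = 1"
  by (simp add: nrogers_def rogers_at_sigma_def)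

lemma rec_down_0 [simp]: "rec_down 0 = 0"
  by (simp add: rec_down_def)

lemma nrogers_inverse: "nrogers n (1 / z) = nrogers n z"
  by (simp add: nrogers_def rogers_inverse)

lemma rogers_rec_up: "rogers \<beta> (Suc n) z / rogers_at_sigma n = rec_up n * (1 - \<beta> * q ^ n) / (1 - q ^ Suc n) * nrogers (Suc n) z"
  unfolding nrogers_def rogers_at_sigma_Suc rec_up_def using nzs rogers_at_sigma_nz[of n] one_minus_q_nz[of n]
  by (simp add: divide_simps)

lemma rogers_rec_down: "rogers \<beta> n z / rogers_at_sigma (Suc n) = rec_down (Suc n) * (1 - \<beta> * q ^ Suc n) / (1 - \<beta>^2 * q ^ n) * nrogers n z"
  unfolding nrogers_def rogers_at_sigma_Suc rec_down_def using nzs nzs(1)[of "Suc n"] rogers_at_sigma_nz[of n] one_minus_q_nz[of n]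
  by (simp add: divide_simps)

lemma nrogers_rec:
  assumes "z \<noteq> 0"
  shows "(z + 1 / z) * nrogers n z = rec_up n * nrogers (Suc n) z + rec_down n * nrogers (n - 1) z"
proof (cases n)
  case 0
  have "rec_up 0 * nrogers (Suc 0) z = rec_up 0 / rogers_at_sigma 1 * rogers \<beta> 1 z" by (simp add: nrogers_def)
  also have "rec_up 0 / rogers_at_sigma 1 = (1 - q) / (1 - \<beta>)"
    using nzs(2)[of 0] \<sigma>_nz by (simp add: rec_up_def rogers_at_sigma_def)
  also have "\<dots> * rogers \<beta> 1 z = ((1 - q) * rogers \<beta> 1 z) / (1 - \<beta>)" by simp
  also have "\<dots> = z + 1 / z"
    unfolding rogers_1[OF assms] using nzs(1)[of 0] by simp
  finally show ?thesis using 0 by simp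
next
  case (Suc m)
  have "(1 - \<beta> * q ^ n) * ((z + 1 / z) * nrogers n z) = ((z + 1 / z) * (1 - \<beta> * q ^ (m + 1)) * rogers \<beta> (m + 1) z) / rogers_at_sigma n"
    by (simp add: Suc nrogers_def)
  also have "\<dots> = ((1 - q ^ (m + 2)) * rogers \<beta> (m + 2) z + (1 - \<beta>^2 * q ^ m) * rogers \<beta> m z) / rogers_at_sigma n"
    using rogers_recurrence[OF assms, of m \<beta>] by simp
  also have "\<dots> = (1 - q ^ Suc n) * (rogers \<beta> (Suc n) z / rogers_at_sigma n) + (1 - \<beta>^2 * q ^ m) * (rogers \<beta> m z / rogers_at_sigma (Suc m))"
    by (simp add: Suc add_divide_distrib)
  also have "\<dots> = (1 - \<beta> * q ^ n) * (rec_up n * nrogers (Suc n) z + rec_down n * nrogers (n - 1) z)"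
    unfolding rogers_rec_up rogers_rec_down using one_minus_q_nz[of n] nzs(2)[of m]
    by (simp add: Suc distrib_left del: power_Suc)
  finally show ?thesis using nzs(1)[of n] by simp
qed

text \<open>This quotient vanishes for n = 0. The formulas below that refer to degree n - 1 therefore hold for
  n = 0 as well, where n - 1 is 0 and not -1.\<close>
definition rec_down' :: "nat \<Rightarrow> complex" where
  "rec_down' n = rec_down n / (1 - \<beta>^2 * q ^ (n - 1))"

text \<open>By rogers_half_nrogers the function rogers_half is proportional to half_part n z - nrogers n z / z, and
  half_part is invariant under z \<rightarrow> 1/z.\<close>
definition half_part :: "nat \<Rightarrow> complex \<Rightarrow> complex" where
  "half_part n z = rec_up n / (1 - q ^ Suc n) * nrogers (Suc n) z - \<beta>^2 * q ^ (n - 1) * rec_down' n * nrogers (n - 1) z"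

lemma rec_down'_eq: "rec_down' n * (1 - \<beta>^2 * q ^ (n - 1)) = rec_down n"
  using nzs(2)[of "n - 1"] by (simp add: rec_down'_def)

lemma rec_down'_0: "rec_down' 0 = 0"
  by (simp add: rec_down'_def)

lemma rec_down'_power: "rec_down' n * (q * q ^ (n - 1)) = rec_down' n * q ^ n"
  by (cases n) (simp_all add: rec_down'_0)

text \<open>Splits rogers_half into a part that is invariant under z \<rightarrow> 1/z and a multiple of 1/z; in
  rogers_half_eq the three-term recurrence is used for the multiples of z + 1/z.\<close>
lemma rogers_half_nrogers:
  assumes "z \<noteq> 0"
  shows "rogers_half \<beta> (Suc n) z / (rogers_at_sigma n * (1 - \<beta> / q)) = half_part n z - nrogers n z / z"
proof -
  have bq: "1 - \<beta> / q \<noteq> 0" using \<beta>_ne_q q_nz by simp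
  have *: "rogers_half \<beta> (Suc n) z / rogers_at_sigma n =
     rogers \<beta> (Suc n) z / rogers_at_sigma n - (\<beta> * z / q + 1 / z) * nrogers n z + \<beta> / q * (rec_down' n * (1 - \<beta> * q ^ n) * nrogers (n - 1) z)"
  proof (cases n)
    case 0
    thus ?thesis using rogers_half_eq(1)[OF assms, of \<beta>] by (simp add: rogers_at_sigma_def rec_down'_0)
  next
    case (Suc m)
    have "rogers \<beta> m z / rogers_at_sigma n = rec_down' n * (1 - \<beta> * q ^ n) * nrogers (n - 1) z"
      using rogers_rec_down[of m z] by (simp add: Suc rec_down'_def)
    moreover have "rogers_half \<beta> (Suc n) z / rogers_at_sigma n = rogers \<beta> (Suc n) z / rogers_at_sigma n -
       (\<beta> * z / q + 1 / z) * (rogers \<beta> n z / rogers_at_sigma n) + \<beta> / q * (rogers \<beta> m z / rogers_at_sigma n)"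
      using rogers_half_eq(2)[OF assms, of \<beta> m] by (simp add: Suc diff_divide_distrib add_divide_distrib)
    ultimately show ?thesis by (simp only: nrogers_def[symmetric])
  qed
  define Q where "Q = q ^ n"
  define Q' where "Q' = q ^ (n - 1)"
  have QQ: "rec_down' n * (q * Q') = rec_down' n * Q" using rec_down'_power by (simp add: Q_def Q'_def)
  have nz: "1 - q * Q \<noteq> 0" using one_minus_q_nz[of n] by (simp add: Q_def)
  have "\<beta> * z / q + 1 / z = \<beta> / q * (z + 1 / z) + (1 - \<beta> / q) * (1 / z)"
    by (simp add: algebra_simps)
  hence "(\<beta> * z / q + 1 / z) * nrogers n z = \<beta> / q * ((z + 1 / z) * nrogers n z) + (1 - \<beta> / q) * (nrogers n z / z)"
    by (simp only: distrib_right mult.assoc) simp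
  hence "rogers_half \<beta> (Suc n) z / rogers_at_sigma n =
     (rec_up n * (1 - \<beta> * Q) / (1 - q * Q) - \<beta> / q * rec_up n) * nrogers (Suc n) z
     - \<beta> / q * (rec_down n - rec_down' n * (1 - \<beta> * Q)) * nrogers (n - 1) z
     - (1 - \<beta> / q) * (nrogers n z / z)"
    unfolding * nrogers_rec[OF assms] rogers_rec_up Q_def by (simp add: algebra_simps)
  also have "rec_up n * (1 - \<beta> * Q) / (1 - q * Q) - \<beta> / q * rec_up n = (1 - \<beta> / q) * (rec_up n / (1 - q * Q))"
    using nz q_nz by (simp add: field_simps)
  also have "\<beta> / q * (rec_down n - rec_down' n * (1 - \<beta> * Q)) = (1 - \<beta> / q) * (\<beta>^2 * Q' * rec_down' n)"
  proof -
    have D: "rec_down n - rec_down' n * (1 - \<beta> * Q) = \<beta> * (rec_down' n * Q) - \<beta>^2 * (rec_down' n * Q')"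
      using rec_down'_eq[of n] by (simp add: Q'_def algebra_simps)
    show ?thesis
      unfolding D QQ[symmetric] using q_nz by (simp add: field_simps power2_eq_square)
  qed
  also have "(1 - \<beta> / q) * (rec_up n / (1 - q * Q)) * nrogers (Suc n) z -
      (1 - \<beta> / q) * (\<beta>^2 * Q' * rec_down' n) * nrogers (n - 1) z - (1 - \<beta> / q) * (nrogers n z / z) =
      (1 - \<beta> / q) * (half_part n z - nrogers n z / z)"
    by (simp add: half_part_def Q_def Q'_def algebra_simps)
  finally show ?thesis using bq by (simp add: divide_divide_eq_left[symmetric])
qed

text \<open>Both half_part n z and (z + 1/z) * nrogers n z are combinations of the two neighbours of
  nrogers n z. These are the mixtures of them that occur in pearson.\<close>
lemma nrogers_span:
  assumes "z \<noteq> 0"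
  shows "(1 - \<beta>) * half_part n z + \<beta> * ((z + 1 / z) * nrogers n z) =
      rec_up n * (1 - \<beta> * q ^ Suc n) / (1 - q ^ Suc n) * nrogers (Suc n) z + \<beta> * rec_down' n * (1 - \<beta> * q ^ (n - 1)) * nrogers (n - 1) z"
    and "(1 - \<beta>^2) * half_part n z + \<beta>^2 * ((z + 1 / z) * nrogers n z) =
      rec_up n * (1 - \<beta>^2 * q ^ Suc n) / (1 - q ^ Suc n) * nrogers (Suc n) z + \<beta>^2 * rec_down' n * (1 - q ^ (n - 1)) * nrogers (n - 1) z"
proof -
  define D where "D = 1 - q ^ Suc n"
  have D: "D \<noteq> 0" "q ^ Suc n = 1 - D" using one_minus_q_nz[of n] by (simp_all add: D_def)
  have u: "rec_up n = rec_up n / D * D" using D by simp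
  have rec: "(z + 1 / z) * nrogers n z = rec_up n * nrogers (Suc n) z + rec_down' n * (1 - \<beta>^2 * q ^ (n - 1)) * nrogers (n - 1) z"
    unfolding rec_down'_eq by (rule nrogers_rec[OF assms])
  show "(1 - \<beta>) * half_part n z + \<beta> * ((z + 1 / z) * nrogers n z) =
      rec_up n * (1 - \<beta> * q ^ Suc n) / (1 - q ^ Suc n) * nrogers (Suc n) z + \<beta> * rec_down' n * (1 - \<beta> * q ^ (n - 1)) * nrogers (n - 1) z"
    unfolding half_part_def rec D(2) using D(1) by (simp add: field_simps power2_eq_square)
  show "(1 - \<beta>^2) * half_part n z + \<beta>^2 * ((z + 1 / z) * nrogers n z) =
      rec_up n * (1 - \<beta>^2 * q ^ Suc n) / (1 - q ^ Suc n) * nrogers (Suc n) z + \<beta>^2 * rec_down' n * (1 - q ^ (n - 1)) * nrogers (n - 1) z"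
    unfolding half_part_def rec D(2) using D(1) by (simp add: field_simps power2_eq_square)
qed

text \<open>The coefficients step_up and step_down are those in the first part of nrogers_span. By step_up_rec_up
  and step_down_rec_down, they are also contained in those of the second part.\<close>
definition step_up :: "nat \<Rightarrow> complex" where
  "step_up n = rec_up n * (1 - \<beta> * q ^ Suc n) / (1 - q ^ Suc n)"

definition step_down :: "nat \<Rightarrow> complex" where
  "step_down n = \<beta> * rec_down' n * (1 - \<beta> * q ^ (n - 1))"

lemma step_up_rec_down: "step_up n * rec_down (Suc n) = \<sigma> * rec_up n"
  unfolding step_up_def rec_down_def using one_minus_q_nz[of n] nzs(1)[of "Suc n"] by (simp del: power_Suc)

lemma step_up_rec_up: "rec_up n * (1 - \<beta>^2 * q ^ Suc n) / (1 - q ^ Suc n) = \<sigma> * step_up n * rec_up (Suc n)"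
  unfolding step_up_def rec_up_def[of "Suc n"] using one_minus_q_nz[of n] nzs(1)[of "Suc n"] \<sigma>_nz by (simp del: power_Suc)

lemma step_down_rec_up: "step_down n * rec_up (n - 1) = \<sigma> * rec_down n"
proof -
  have "step_down n * rec_up (n - 1) = \<beta> / \<sigma> * (rec_down' n * (1 - \<beta>^2 * q ^ (n - 1)))"
    unfolding step_down_def rec_up_def using nzs(1)[of "n - 1"] \<sigma>_nz by simp
  also have "\<beta> / \<sigma> = \<sigma>" using \<sigma>_nz \<sigma> by (simp add: power2_eq_square field_simps)
  finally show ?thesis by (simp only: rec_down'_eq)
qed

lemma step_down_rec_down: "\<beta>^2 * rec_down' n * (1 - q ^ (n - 1)) = \<sigma> * step_down n * rec_down (n - 1)"
proof -
  have "\<sigma> * step_down n * rec_down (n - 1) = (\<sigma> * \<sigma>) * \<beta> * rec_down' n * (1 - q ^ (n - 1))"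
    unfolding step_down_def rec_down_def using nzs(1)[of "n - 1"] by simp
  also have "\<sigma> * \<sigma> = \<beta>" using \<sigma> by (simp add: power2_eq_square)
  finally show ?thesis by (simp add: power2_eq_square)
qed

lemma step_down_nrogers_rec:
  assumes "z \<noteq> 0"
  shows "step_down n * ((z + 1 / z) * nrogers (n - 1) z) = step_down n * (rec_up (n - 1) * nrogers n z + rec_down (n - 1) * nrogers (n - 2) z)"
proof (cases n)
  case (Suc m)
  thus ?thesis using nrogers_rec[OF assms, of m] by simp
qed (simp add: step_down_def rec_down'_0)

text \<open>The polynomial p that aw_relation yields for s z = half_part n z - nrogers n z / z and the parameters
  \<sigma> a^(\<plusminus>1) b^(\<plusminus>1).\<close>
definition pearson :: "complex \<Rightarrow> complex \<Rightarrow> nat \<Rightarrow> complex \<Rightarrow> complex" where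
  "pearson a b n z = (z + 1 / z) * ((1 - \<beta>^2) * half_part n z + \<beta>^2 * ((z + 1 / z) * nrogers n z)) - (1 + \<beta>)^2 * nrogers n z +
     \<beta> * ((a + 1 / a)^2 + (b + 1 / b)^2) * nrogers n z -
     \<sigma> * (a + 1 / a) * (b + 1 / b) * ((1 - \<beta>) * half_part n z + \<beta> * ((z + 1 / z) * nrogers n z))"

text \<open>The function pearson as a combination of nrogers in the degrees n - 2, ..., n + 2. The
  polynomials are replaced by a variable sequence, because their moments and the products of their
  values are to be inserted as well.\<close>
definition pearson_comb :: "complex \<Rightarrow> complex \<Rightarrow> nat \<Rightarrow> (nat \<Rightarrow> complex) \<Rightarrow> complex" where
  "pearson_comb a b n f = \<sigma> * step_up n * rec_up (Suc n)^2 * f (n + 2) +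
    (\<sigma> * step_up n * rec_up (Suc n) * rec_down (Suc n) + \<sigma> * step_down n * rec_down (n - 1) * rec_up (n - 1) +
      (\<beta> * ((a + 1 / a)^2 + (b + 1 / b)^2) - (1 + \<beta>)^2)) * f n +
    \<sigma> * step_down n * rec_down (n - 1)^2 * f (n - 2) -
    \<sigma> * (a + 1 / a) * (b + 1 / b) * step_up n * f (n + 1) - \<sigma> * (a + 1 / a) * (b + 1 / b) * step_down n * f (n - 1)"

lemma pearson_expand:
  assumes z: "z \<noteq> 0"
  shows "pearson a b n z = pearson_comb a b n (\<lambda>k. nrogers k z)"
proof -
  have 1: "(z + 1 / z) * nrogers (Suc n) z = rec_up (Suc n) * nrogers (n + 2) z + rec_down (Suc n) * nrogers n z"
    using nrogers_rec[OF z, of "Suc n"] by simp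
  have "pearson a b n z = \<sigma> * step_up n * rec_up (Suc n) * ((z + 1 / z) * nrogers (Suc n) z) + \<sigma> * rec_down (n - 1) * (step_down n * ((z + 1 / z) * nrogers (n - 1) z)) +
    (\<beta> * ((a + 1 / a)^2 + (b + 1 / b)^2) - (1 + \<beta>)^2) * nrogers n z -
    \<sigma> * (a + 1 / a) * (b + 1 / b) * (step_up n * nrogers (n + 1) z + step_down n * nrogers (n - 1) z)"
    unfolding pearson_def nrogers_span[OF z] step_up_rec_up step_down_rec_down step_up_def[symmetric] step_down_def[symmetric]
    by (simp add: algebra_simps)
  thus ?thesis unfolding 1 step_down_nrogers_rec[OF z] pearson_comb_def
    by (simp add: algebra_simps power2_eq_square)
qed

text \<open>The products of values solve the recurrence which pearson_orthogonal gives for the moments.\<close>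
lemma pearson_values:
  assumes a: "a \<noteq> 0" and b: "b \<noteq> 0"
  shows "pearson_comb a b n (\<lambda>k. nrogers k a * nrogers k b) = 0"
  unfolding pearson_comb_def
proof (rule pearson_values_aux[where t = "(1 + \<beta>) / \<sigma>" and ?u0.0 = "rec_up n" and ?d0.0 = "rec_down n"])
  show "\<sigma> * ((1 + \<beta>) / \<sigma>) = 1 + \<beta>" using \<sigma>_nz by simp
  show "(a + 1 / a) * nrogers n a = rec_up n * nrogers (n + 1) a + rec_down n * nrogers (n - 1) a" using nrogers_rec[OF a] by simp
  show "(b + 1 / b) * nrogers n b = rec_up n * nrogers (n + 1) b + rec_down n * nrogers (n - 1) b" using nrogers_rec[OF b] by simp
  show "(a + 1 / a) * nrogers (n + 1) a = rec_up (Suc n) * nrogers (n + 2) a + rec_down (Suc n) * nrogers n a" using nrogers_rec[OF a, of "Suc n"] by simp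
  show "(b + 1 / b) * nrogers (n + 1) b = rec_up (Suc n) * nrogers (n + 2) b + rec_down (Suc n) * nrogers n b" using nrogers_rec[OF b, of "Suc n"] by simp
qed (simp_all only: step_down_nrogers_rec[OF a] step_down_nrogers_rec[OF b] step_up_rec_down step_down_rec_up rec_up_plus_rec_down \<sigma>)

lemma half_part_inverse: "half_part n (1 / z) = half_part n z"
  by (simp add: half_part_def nrogers_inverse)

lemma rogers_continuous: "continuous_on (sphere 0 1) (rogers \<beta> n)"
  unfolding rogers_def fps_mult_nth rogers_fps_def by (auto intro!: continuous_intros)

lemma nrogers_continuous: "continuous_on (sphere 0 1) (nrogers n)"
  unfolding nrogers_def using rogers_at_sigma_nz by (intro continuous_intros rogers_continuous) auto

text \<open>The Askey-Wilson weight with parameters \<sigma> a^(\<plusminus>1) b^(\<plusminus>1).\<close>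
definition kernel_weight :: "complex \<Rightarrow> complex \<Rightarrow> complex \<Rightarrow> complex" where
  "kernel_weight a b = aw_weight (\<sigma> * a * b) (\<sigma> * a * (1 / b)) (\<sigma> * b * (1 / a)) (\<sigma> * ((1 / a) * (1 / b)))"

lemma pearson_orthogonal:
  assumes ab: "a \<noteq> 0" "b \<noteq> 0" and small: "norm (\<sigma> * a * b) < 1" "norm (\<sigma> * a * (1 / b)) < 1"
      "norm (\<sigma> * b * (1 / a)) < 1" "norm (\<sigma> * ((1 / a) * (1 / b))) < 1"
  shows "circle_mean (\<lambda>z. pearson a b n z * kernel_weight a b z) = 0"
  unfolding kernel_weight_def
proof (rule aw_relation[OF small, of "\<lambda>z. rogers_half \<beta> (Suc n) z / (rogers_at_sigma n * (1 - \<beta> / q))"])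
  have nz: "rogers_at_sigma n * (1 - \<beta> / q) \<noteq> 0" using \<beta>_ne_q q_nz rogers_at_sigma_nz by simp
  show "(\<lambda>z. rogers_half \<beta> (Suc n) z / (rogers_at_sigma n * (1 - \<beta> / q))) holomorphic_on - {0}"
    using nz by (intro holomorphic_intros rogers_half_holomorphic) auto
  show "rogers_half \<beta> (Suc n) (q / z) / (rogers_at_sigma n * (1 - \<beta> / q)) = rogers_half \<beta> (Suc n) z / (rogers_at_sigma n * (1 - \<beta> / q))" if "z \<noteq> 0" for z
    using rogers_half_sym[OF that] by simp
  fix z :: complex assume "norm z = 1"
  hence z: "z \<noteq> 0" "1 / z \<noteq> 0" by auto
  have s1: "rogers_half \<beta> (Suc n) z / (rogers_at_sigma n * (1 - \<beta> / q)) = half_part n z - nrogers n z * (1 / z)"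
    using rogers_half_nrogers[OF z(1)] by simp
  have s2: "rogers_half \<beta> (Suc n) (1 / z) / (rogers_at_sigma n * (1 - \<beta> / q)) = half_part n z - nrogers n z * z"
    using rogers_half_nrogers[OF z(2)] by (simp add: half_part_inverse[simplified] nrogers_inverse[simplified])
  have P: "(1 - \<sigma> * a * b * w) * (1 - \<sigma> * a * (1 / b) * w) * (1 - \<sigma> * b * (1 / a) * w) * (1 - \<sigma> * (1 / a * (1 / b)) * w) =
    1 - \<sigma> * (a + 1 / a) * (b + 1 / b) * w + \<beta> * ((a + 1 / a)^2 + (b + 1 / b)^2 - 2) * w^2 -
    \<beta> * \<sigma> * (a + 1 / a) * (b + 1 / b) * w^3 + \<beta>^2 * w^4" for w
    using ab \<sigma> by (intro aw_quartic_expand) auto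
  have "z * (1 / z) = 1" using z by simp
  from pearson_aux[OF this]
  have "(z - 1 / z) * pearson a b n z =
     z^2 * ((1 - \<sigma> * a * b * (1 / z)) * (1 - \<sigma> * a * (1 / b) * (1 / z)) * (1 - \<sigma> * b * (1 / a) * (1 / z)) * (1 - \<sigma> * (1 / a * (1 / b)) * (1 / z))) * (half_part n z - nrogers n z * (1 / z)) -
     (1 / z)^2 * ((1 - \<sigma> * a * b * z) * (1 - \<sigma> * a * (1 / b) * z) * (1 - \<sigma> * b * (1 / a) * z) * (1 - \<sigma> * (1 / a * (1 / b)) * z)) * (half_part n z - nrogers n z * z)"
    unfolding P pearson_def .
  thus "(z - 1 / z) * pearson a b n z =
     z^2 * ((1 - \<sigma> * a * b / z) * (1 - \<sigma> * a * (1 / b) / z) * (1 - \<sigma> * b * (1 / a) / z) * (1 - \<sigma> * (1 / a * (1 / b)) / z)) *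
       (rogers_half \<beta> (Suc n) z / (rogers_at_sigma n * (1 - \<beta> / q))) -
     1 / z^2 * ((1 - \<sigma> * a * b * z) * (1 - \<sigma> * a * (1 / b) * z) * (1 - \<sigma> * b * (1 / a) * z) * (1 - \<sigma> * (1 / a * (1 / b)) * z)) *
       (rogers_half \<beta> (Suc n) (1 / z) / (rogers_at_sigma n * (1 - \<beta> / q)))"
    unfolding s1 s2 by (simp add: power_one_over)
qed

lemma step_up_nz: "step_up n \<noteq> 0"
  using rec_up_nz nzs(1)[of "Suc n"] one_minus_q_nz[of n] by (simp add: step_up_def del: power_Suc)

text \<open>The moments of kernel_weight and the products of values both solve the recurrence
  pearson_comb = 0, the former by pearson_orthogonal and the latter by pearson_values. Its leading
  coefficient is not 0, so they agree once they agree in the degrees 0 and 1. Degree 1 is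
  aw_first_moment.\<close>
theorem rogers_product_formula:
  assumes ab: "a \<noteq> 0" "b \<noteq> 0" and small: "norm (\<sigma> * a * b) < 1" "norm (\<sigma> * a * (1 / b)) < 1"
      "norm (\<sigma> * b * (1 / a)) < 1" "norm (\<sigma> * ((1 / a) * (1 / b))) < 1"
  shows "circle_mean (\<lambda>z. nrogers n z * kernel_weight a b z) = nrogers n a * nrogers n b * circle_mean (kernel_weight a b)"
proof (induction n rule: less_induct)
  case (less n)
  let ?W = "kernel_weight a b"
  define L where "L f = circle_mean (\<lambda>z. f z * ?W z)" for f
  have cW: "continuous_on (sphere 0 1) ?W"
    unfolding kernel_weight_def by (intro aw_weight_continuous_on small)
  have L_add: "L (\<lambda>z. f z + g z) = L f + L g" if "continuous_on (sphere 0 1) f" "continuous_on (sphere 0 1) g" for f g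
    unfolding L_def distrib_right by (rule circle_mean_add) (intro continuous_intros that cW)+
  have L_diff: "L (\<lambda>z. f z - g z) = L f - L g" if "continuous_on (sphere 0 1) f" "continuous_on (sphere 0 1) g" for f g
    unfolding L_def left_diff_distrib by (rule circle_mean_diff) (intro continuous_intros that cW)+
  have L_cmult: "L (\<lambda>z. c * f z) = c * L f" for c f
    unfolding L_def mult.assoc by (rule circle_mean_cmult)
  have IH: "L (nrogers m) = nrogers m a * nrogers m b * circle_mean ?W" if "m < n" for m
    using less.IH[OF that] by (simp add: L_def)
  consider "n = 0" | "n = 1" | m where "n = m + 2" by (metis One_nat_def Suc_1 add.commute add_2_eq_Suc' not0_implies_Suc)
  hence "L (nrogers n) = nrogers n a * nrogers n b * circle_mean ?W"
  proof cases
    case 1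
    thus ?thesis by (simp add: L_def)
  next
    case 2
    have X: "nrogers 1 z = (z + 1 / z) / rec_up 0" if "z \<noteq> 0" for z
      using nrogers_rec[OF that, of 0] rec_up_nz[of 0] by (simp add: field_simps)
    have "\<beta>^2 \<noteq> 1" using nzs(2)[of 0] by simp
    have "(1 - \<sigma> * a * b * (\<sigma> * a * (1 / b)) * (\<sigma> * b * (1 / a)) * (\<sigma> * ((1 / a) * (1 / b)))) = 1 - \<beta>^2"
      using ab unfolding \<sigma>[symmetric] by (simp add: field_simps power2_eq_square)
    moreover have "\<sigma> * a * b + \<sigma> * a * (1 / b) + \<sigma> * b * (1 / a) + \<sigma> * ((1 / a) * (1 / b)) -
       (\<sigma> * a * b * (\<sigma> * a * (1 / b)) * (\<sigma> * b * (1 / a)) + \<sigma> * a * b * (\<sigma> * a * (1 / b)) * (\<sigma> * ((1 / a) * (1 / b))) +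
        \<sigma> * a * b * (\<sigma> * b * (1 / a)) * (\<sigma> * ((1 / a) * (1 / b))) + \<sigma> * a * (1 / b) * (\<sigma> * b * (1 / a)) * (\<sigma> * ((1 / a) * (1 / b)))) =
       \<sigma> * (1 - \<beta>) * ((a + 1 / a) * (b + 1 / b))"
      using ab unfolding \<sigma>[symmetric] by (simp add: field_simps power2_eq_square)
    ultimately have F: "(1 - \<beta>^2) * circle_mean (\<lambda>z. (z + 1 / z) * ?W z) = \<sigma> * (1 - \<beta>) * ((a + 1 / a) * (b + 1 / b)) * circle_mean ?W"
      using aw_first_moment[OF small] unfolding kernel_weight_def by simp
    have U: "rec_up 0 * (\<sigma> * (1 - \<beta>)) = 1 - \<beta>^2"
      using \<sigma>_nz nzs(1)[of 0] by (simp add: rec_up_def)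
    have "\<sigma> * (1 - \<beta>) * (rec_up 0 * circle_mean (\<lambda>z. (z + 1 / z) * ?W z)) = \<sigma> * (1 - \<beta>) * (((a + 1 / a) * (b + 1 / b)) * circle_mean ?W)"
      using F unfolding U[symmetric] by (simp only: mult_ac)
    hence "rec_up 0 * circle_mean (\<lambda>z. (z + 1 / z) * ?W z) = (a + 1 / a) * (b + 1 / b) * circle_mean ?W"
      using \<sigma>_nz nzs(1)[of 0] by simp
    moreover have "L (nrogers 1) = 1 / rec_up 0 * circle_mean (\<lambda>z. (z + 1 / z) * ?W z)"
      unfolding L_def circle_mean_cmult[symmetric] by (rule circle_mean_cong) (subst X, auto)
    ultimately show ?thesis unfolding 2 X[OF ab(1)] X[OF ab(2)] using rec_up_nz[of 0] by (simp add: field_simps)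
  next
    case (3 m)
    have cont: "continuous_on (sphere 0 1) (nrogers k)" for k by (rule nrogers_continuous)
    have "0 = L (\<lambda>z. pearson_comb a b m (\<lambda>k. nrogers k z))"
      unfolding L_def by (subst pearson_orthogonal[OF ab small, of m, symmetric], rule circle_mean_cong) (subst pearson_expand, auto)
    also have "\<dots> = pearson_comb a b m (\<lambda>k. L (nrogers k))"
      unfolding pearson_comb_def by (simp add: L_add L_diff L_cmult cont continuous_intros del: add_2_eq_Suc')
    also have "\<dots> = pearson_comb a b m (\<lambda>k. L (nrogers k)) - pearson_comb a b m (\<lambda>k. nrogers k a * nrogers k b) * circle_mean ?W"
      by (simp add: pearson_values[OF ab])
    also have "\<dots> = \<sigma> * step_up m * rec_up (Suc m)^2 * (L (nrogers n) - nrogers n a * nrogers n b * circle_mean ?W)"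
      unfolding pearson_comb_def 3 using 3 by (simp add: IH algebra_simps del: add_2_eq_Suc')
    finally show ?thesis using step_up_nz[of m] rec_up_nz[of "Suc m"] \<sigma>_nz by simp
  qed
  thus ?case by (simp add: L_def)
qed

section \<open>Symmetry of the double kernel\<close>

definition kernel_denom :: "complex \<Rightarrow> complex \<Rightarrow> complex \<Rightarrow> complex" where
  "kernel_denom x y z =
     (qpoch (\<sigma> * (x * y * z)) q * qpoch (\<sigma> * (x * y / z)) q) * (qpoch (\<sigma> * (x / y * z)) q * qpoch (\<sigma> * (x / y / z)) q) *
     (qpoch (\<sigma> * (y / x * z)) q * qpoch (\<sigma> * (y / x / z)) q) * (qpoch (\<sigma> * (z / (x * y))) q * qpoch (\<sigma> * (1 / (x * y * z))) q)"

text \<open>The mass of kernel_weight a b is a constant divided by hgauge a * hgauge b (kernel_integral).\<close>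
definition hgauge :: "complex \<Rightarrow> complex" where
  "hgauge z = qpoch (\<beta> * z^2) q * qpoch (\<beta> / z^2) q"

definition weyl_denom :: "complex \<Rightarrow> complex" where
  "weyl_denom z = qpoch (z^2) q * qpoch (1 / z^2) q"

lemma kernel_denom_commute: "kernel_denom x y z = kernel_denom y x z" "kernel_denom x y z = kernel_denom x z y"
  by (simp_all add: kernel_denom_def mult_ac)

lemma kernel_denom_inverse: "kernel_denom x y (1 / z) = kernel_denom x y z"
  by (simp add: kernel_denom_def mult_ac)

lemma kernel_weight_eq: "kernel_weight a b z = weyl_denom z / kernel_denom a b z"
  by (simp add: kernel_weight_def aw_weight_def kernel_denom_def weyl_denom_def mult_ac)

text \<open>Two kernels composed through the variable z. Up to its prefactor this is the integral B1
  in the coordinates of product_coords (log_integral_double_kernel).\<close>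
definition double_kernel :: "complex \<Rightarrow> complex \<Rightarrow> complex \<Rightarrow> complex \<Rightarrow> complex" where
  "double_kernel a b c d = circle_mean (\<lambda>z. weyl_denom z * hgauge z / (kernel_denom a b z * kernel_denom c d z))"

end

text \<open>For a and b in the annulus given by \<rho>, all Askey-Wilson parameters
  \<sigma> a^(\<plusminus>1) b^(\<plusminus>1) have modulus less than 1.\<close>
locale rogers_annulus = rogers_product +
  fixes \<rho> :: real
  assumes \<rho>_ge_1: "\<rho> \<ge> 1" and \<rho>_small: "norm \<sigma> * \<rho>^2 < 1"
begin

definition annulus :: "complex set" where
  "annulus = {x. 1 / \<rho> \<le> norm x \<and> norm x \<le> \<rho>}"

lemma annulus_nz: "x \<in> annulus \<Longrightarrow> x \<noteq> 0"
  using \<rho>_ge_1 by (auto simp: annulus_def)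

lemma circle_annulus: "norm z = 1 \<Longrightarrow> z \<in> annulus"
  using \<rho>_ge_1 by (auto simp: annulus_def)

lemma annulus_inverse: "x \<in> annulus \<Longrightarrow> 1 / x \<in> annulus"
  using \<rho>_ge_1 annulus_nz[of x] by (auto simp: annulus_def norm_divide field_simps)

lemma annulus_prod: "x \<in> annulus \<Longrightarrow> y \<in> annulus \<Longrightarrow> norm (\<sigma> * (x * y)) < 1"
proof -
  assume "x \<in> annulus" "y \<in> annulus"
  hence "norm x * norm y \<le> \<rho> * \<rho>" using \<rho>_ge_1 by (intro mult_mono) (auto simp: annulus_def)
  hence "norm \<sigma> * (norm x * norm y) \<le> norm \<sigma> * \<rho>^2" unfolding power2_eq_square by (intro mult_left_mono) auto
  thus ?thesis using \<rho>_small by (simp add: norm_mult)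
qed

lemma annulus_small:
  assumes "a \<in> annulus" "b \<in> annulus"
  shows "norm (\<sigma> * a * b) < 1" "norm (\<sigma> * a * (1 / b)) < 1" "norm (\<sigma> * b * (1 / a)) < 1" "norm (\<sigma> * ((1 / a) * (1 / b))) < 1"
  using annulus_prod[of a b] annulus_prod[of a "1 / b"] annulus_prod[of b "1 / a"] annulus_prod[of "1 / a" "1 / b"] annulus_inverse assms
  by (simp_all add: mult.assoc)

lemma kernel_denom_nz:
  assumes "a \<in> annulus" "b \<in> annulus" "norm z = 1"
  shows "kernel_denom a b z \<noteq> 0"
proof -
  have n: "norm (\<sigma> * (x * y * w)) < 1" if "x \<in> annulus" "y \<in> annulus" "norm w = 1" for x y w
    using annulus_prod[of x y] that by (simp add: norm_mult)
  have w: "norm (1 / z) = 1" using assms by (simp add: norm_divide)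
  note i = annulus_inverse[OF assms(1)] annulus_inverse[OF assms(2)]
  have "qpoch (\<sigma> * (x * y * w)) q \<noteq> 0" if "x \<in> annulus" "y \<in> annulus" "norm w = 1" for x y w
    using n[OF that] by (rule qpoch_nz)
  note nz = this
  show ?thesis
    using nz[OF assms(1,2,3)] nz[OF assms(1,2) w] nz[OF assms(1) i(2) assms(3)] nz[OF assms(1) i(2) w]
      nz[OF assms(2) i(1) assms(3)] nz[OF assms(2) i(1) w] nz[OF i(1) i(2) assms(3)] nz[OF i(1) i(2) w]
    by (simp add: kernel_denom_def mult_ac)
qed

lemma hgauge_nz: "a \<in> annulus \<Longrightarrow> hgauge a \<noteq> 0"
proof -
  assume a: "a \<in> annulus"
  have e: "\<beta> * a^2 = (\<sigma> * (a * a)) * \<sigma>" "\<beta> / a^2 = (\<sigma> * (1 / a * (1 / a))) * \<sigma>"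
    unfolding \<sigma>[symmetric] by (simp_all add: power2_eq_square)
  have "norm \<sigma> * 1 \<le> norm \<sigma> * \<rho>^2" using \<rho>_ge_1 by (intro mult_left_mono) auto
  hence s: "norm \<sigma> < 1" using \<rho>_small by simp
  have "norm ((\<sigma> * (x * x)) * \<sigma>) < 1" if "x \<in> annulus" for x
    using mult_strict_mono'[OF annulus_prod[OF that that] s] by (simp add: norm_mult)
  hence "norm (\<beta> * a^2) < 1" "norm (\<beta> / a^2) < 1"
    unfolding e using a annulus_inverse[OF a] by blast+
  thus ?thesis by (simp add: hgauge_def qpoch_nz)
qed

definition kernel_const :: complex where
  "kernel_const = qpoch (\<beta>^2) q * circle_mean (aw_weight 0 0 0 0) / (qpoch \<beta> q)^2"

text \<open>For these parameters the six products in aw_integral are \<beta> a^(\<plusminus>2), \<beta> b^(\<plusminus>2) and twice \<beta>.\<close>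
lemma kernel_integral:
  assumes ab: "a \<in> annulus" "b \<in> annulus"
  shows "circle_mean (kernel_weight a b) = kernel_const / (hgauge a * hgauge b)"
proof -
  have nz: "a \<noteq> 0" "b \<noteq> 0" using assms annulus_nz by auto
  have e: "\<sigma> * a * b * (\<sigma> * a * (1 / b)) = \<beta> * a^2" "\<sigma> * a * b * (\<sigma> * b * (1 / a)) = \<beta> * b^2"
    "\<sigma> * a * b * (\<sigma> * (1 / a * (1 / b))) = \<beta>" "\<sigma> * a * (1 / b) * (\<sigma> * b * (1 / a)) = \<beta>"
    "\<sigma> * a * (1 / b) * (\<sigma> * (1 / a * (1 / b))) = \<beta> / b^2" "\<sigma> * b * (1 / a) * (\<sigma> * (1 / a * (1 / b))) = \<beta> / a^2"
    "\<beta> * a^2 * (\<sigma> * b * (1 / a)) * (\<sigma> * (1 / a * (1 / b))) = \<beta>^2"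
    using nz unfolding \<sigma>[symmetric] by (simp_all add: field_simps power2_eq_square)
  have "circle_mean (kernel_weight a b) * (qpoch (\<beta> * a^2) q * qpoch (\<beta> * b^2) q * qpoch \<beta> q * qpoch \<beta> q * qpoch (\<beta> / b^2) q * qpoch (\<beta> / a^2) q) =
    qpoch (\<beta>^2) q * circle_mean (aw_weight 0 0 0 0)"
    using aw_integral[OF annulus_small[OF ab]] unfolding kernel_weight_def[symmetric] e .
  hence "circle_mean (kernel_weight a b) * (hgauge a * hgauge b) * (qpoch \<beta> q)^2 = qpoch (\<beta>^2) q * circle_mean (aw_weight 0 0 0 0)"
    by (simp add: hgauge_def power2_eq_square mult_ac)
  thus ?thesis
    using hgauge_nz ab qpoch_nz[OF \<beta>_lt_1] by (simp add: kernel_const_def eq_divide_eq mult_ac)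
qed

lemma kernel_denom_cont:
  assumes "continuous_on S f" "continuous_on S g" "continuous_on S h" "\<And>x. x \<in> S \<Longrightarrow> f x \<noteq> 0 \<and> g x \<noteq> 0 \<and> h x \<noteq> 0"
  shows "continuous_on S (\<lambda>x. kernel_denom (f x) (g x) (h x))"
  unfolding kernel_denom_def using assms(4) by (intro continuous_intros assms(1-3)) auto

lemma weyl_denom_cont:
  assumes "continuous_on S f" "\<And>x. x \<in> S \<Longrightarrow> f x \<noteq> 0"
  shows "continuous_on S (\<lambda>x. weyl_denom (f x))" "continuous_on S (\<lambda>x. hgauge (f x))"
  unfolding weyl_denom_def hgauge_def using assms(2) by (intro continuous_intros assms(1); auto)+

lemma nrogers_cont:
  assumes "continuous_on S f" "\<And>x. x \<in> S \<Longrightarrow> norm (f x) = 1"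
  shows "continuous_on S (\<lambda>x. nrogers n (f x))"
  by (rule continuous_on_compose2[OF nrogers_continuous assms(1)]) (use assms(2) in auto)

text \<open>After exchanging the two integrations, the product formula evaluates the inner integral, where the mass
  of the kernel cancels hgauge z, and then the outer one. The result is symmetric in a, b, c, while
  the definition of double_kernel is not.\<close>
lemma double_kernel_moment:
  assumes abc: "a \<in> annulus" "b \<in> annulus" "c \<in> annulus"
  shows "circle_mean (\<lambda>d. nrogers n d * (weyl_denom d * double_kernel a b c d)) =
    kernel_const^2 * (nrogers n a * nrogers n b * nrogers n c) / (hgauge a * hgauge b * hgauge c)"
proof -
  have nz: "a \<noteq> 0" "b \<noteq> 0" "c \<noteq> 0" using assms annulus_nz by auto
  have s0: "norm z = 1 \<Longrightarrow> z \<noteq> 0" for z :: complex by auto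
  have "circle_mean (\<lambda>d. nrogers n d * (weyl_denom d * double_kernel a b c d)) =
     circle_mean (\<lambda>d. circle_mean (\<lambda>z. nrogers n d * weyl_denom d * (weyl_denom z * hgauge z / (kernel_denom a b z * kernel_denom c d z))))"
    unfolding double_kernel_def circle_mean_cmult by (simp add: mult.assoc)
  also have "\<dots> = circle_mean (\<lambda>z. circle_mean (\<lambda>d. nrogers n d * weyl_denom d * (weyl_denom z * hgauge z / (kernel_denom a b z * kernel_denom c d z))))"
  proof (rule circle_mean_swap)
    have "continuous_on (sphere 0 1 \<times> sphere 0 1) (\<lambda>x::complex\<times>complex. nrogers n (fst x) * weyl_denom (fst x) *
        (weyl_denom (snd x) * hgauge (snd x) / (kernel_denom a b (snd x) * kernel_denom c (fst x) (snd x))))"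
      by (intro continuous_on_mult continuous_on_divide weyl_denom_cont kernel_denom_cont nrogers_cont continuous_intros)
         (use nz kernel_denom_nz abc circle_annulus in \<open>auto\<close>)
    thus "continuous_on (sphere 0 1 \<times> sphere 0 1) (\<lambda>(d, z). nrogers n d * weyl_denom d * (weyl_denom z * hgauge z / (kernel_denom a b z * kernel_denom c d z)))"
      by (simp add: case_prod_unfold)
  qed
  also have "\<dots> = circle_mean (\<lambda>z. (nrogers n c * kernel_const / hgauge c) * (nrogers n z * kernel_weight a b z))"
  proof (rule circle_mean_cong)
    fix z :: complex assume z: "norm z = 1"
    have "circle_mean (\<lambda>d. nrogers n d * weyl_denom d * (weyl_denom z * hgauge z / (kernel_denom a b z * kernel_denom c d z))) =
       circle_mean (\<lambda>d. (weyl_denom z * hgauge z / kernel_denom a b z) * (nrogers n d * kernel_weight c z d))"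
      by (rule circle_mean_cong) (simp add: kernel_weight_eq kernel_denom_commute(2)[of c z])
    also have "\<dots> = (weyl_denom z * hgauge z / kernel_denom a b z) * (nrogers n c * nrogers n z * (kernel_const / (hgauge c * hgauge z)))"
      unfolding circle_mean_cmult using rogers_product_formula[OF nz(3) s0[OF z] annulus_small[OF abc(3) circle_annulus[OF z]], of n]
        kernel_integral[OF abc(3) circle_annulus[OF z]] by simp
    also have "\<dots> = (nrogers n c * kernel_const / hgauge c) * (nrogers n z * kernel_weight a b z)"
      using hgauge_nz[OF circle_annulus[OF z]] by (simp add: kernel_weight_eq mult_ac)
    finally show "circle_mean (\<lambda>d. nrogers n d * weyl_denom d * (weyl_denom z * hgauge z / (kernel_denom a b z * kernel_denom c d z))) = (nrogers n c * kernel_const / hgauge c) * (nrogers n z * kernel_weight a b z)" .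
  qed
  also have "\<dots> = (nrogers n c * kernel_const / hgauge c) * (nrogers n a * nrogers n b * (kernel_const / (hgauge a * hgauge b)))"
    unfolding circle_mean_cmult using rogers_product_formula[OF nz(1,2) annulus_small[OF abc(1,2)], of n] kernel_integral[OF abc(1,2)] by simp
  finally show ?thesis by (simp add: power2_eq_square mult_ac)
qed

lemma double_kernel_continuous:
  assumes abc: "a \<in> annulus" "b \<in> annulus" "c \<in> annulus"
  shows "continuous_on (sphere 0 1) (\<lambda>d. double_kernel a b c d)"
proof -
  let ?e = "\<lambda>s::real. exp (2 * of_real pi * \<i> * of_real s)"
  have nz: "a \<noteq> 0" "b \<noteq> 0" "c \<noteq> 0" using assms annulus_nz by auto
  have "continuous_on (sphere 0 1 \<times> cbox 0 1) (\<lambda>x. weyl_denom (?e (snd x)) * hgauge (?e (snd x)) / (kernel_denom a b (?e (snd x)) * kernel_denom c (fst x) (?e (snd x))))"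
    by (intro continuous_on_mult continuous_on_divide weyl_denom_cont kernel_denom_cont continuous_intros)
       (use nz kernel_denom_nz abc circle_annulus in \<open>auto\<close>)
  hence "continuous_on (sphere 0 1) (\<lambda>d. integral (cbox 0 1) (\<lambda>s. weyl_denom (?e s) * hgauge (?e s) / (kernel_denom a b (?e s) * kernel_denom c d (?e s))))"
    by (intro integral_continuous_on_param) (simp add: case_prod_unfold)
  thus ?thesis by (simp add: double_kernel_def circle_mean_def)
qed

lemma chebyshev_step:
  fixes z w P Q :: complex
  assumes "z * w = 1"
  shows "z * (z * P) + w * (w * Q) = (z + w) * (z * P + w * Q) - (P + Q)"
  using assms by algebra

text \<open>By the three-term recurrence f has mean 0 against (z + 1/z)^k, and by the Chebyshev recurrence
  against z^n + z^(-n). As f is symmetric, its Fourier coefficients vanish.\<close>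
lemma rogers_total:
  assumes f: "continuous_on (sphere 0 1) f" and sym: "\<And>z. norm z = 1 \<Longrightarrow> f (1 / z) = f z"
    and zero: "\<And>n. circle_mean (\<lambda>z. nrogers n z * f z) = 0" and z: "norm z = 1"
  shows "f z = 0"
proof (rule circle_mean_uniqueness[OF f _ z])
  let ?X = "\<lambda>z::complex. z + 1 / z"
  have c: "continuous_on (sphere 0 1) (\<lambda>z. ?X z ^ k * g z * f z)" if "continuous_on (sphere 0 1) g" for k g
    by (intro continuous_intros that f) auto
  have Xrp: "circle_mean (\<lambda>z. ?X z ^ k * nrogers n z * f z) = 0" for k n
  proof (induction k arbitrary: n)
    case (Suc k)
    have "circle_mean (\<lambda>z. ?X z ^ Suc k * nrogers n z * f z) =
       circle_mean (\<lambda>z. rec_up n * (?X z ^ k * nrogers (Suc n) z * f z) + rec_down n * (?X z ^ k * nrogers (n - 1) z * f z))"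
    proof (rule circle_mean_cong)
      fix z :: complex assume "norm z = 1"
      hence "z \<noteq> 0" by auto
      have "?X z ^ Suc k * nrogers n z * f z = ?X z ^ k * (?X z * nrogers n z) * f z" by simp
      thus "?X z ^ Suc k * nrogers n z * f z = rec_up n * (?X z ^ k * nrogers (Suc n) z * f z) + rec_down n * (?X z ^ k * nrogers (n - 1) z * f z)"
        unfolding nrogers_rec[OF \<open>z \<noteq> 0\<close>] by (simp only: distrib_left distrib_right mult_ac)
    qed
    also have "\<dots> = 0"
      by (subst circle_mean_add) (auto intro!: continuous_intros c nrogers_continuous simp: circle_mean_cmult Suc)
    finally show ?case .
  qed (simp add: zero)
  have Xe: "circle_mean (\<lambda>z. ?X z ^ k * (z ^ n + (1 / z) ^ n) * f z) = 0" for k n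
  proof (induction n arbitrary: k rule: less_induct)
    case (less n)
    consider "n = 0" | "n = 1" | m where "n = Suc (Suc m)" by (metis One_nat_def old.nat.exhaust)
    thus ?case
    proof cases
      case 1
      have "circle_mean (\<lambda>z. ?X z ^ k * (z ^ n + (1 / z) ^ n) * f z) = circle_mean (\<lambda>z. 2 * (?X z ^ k * nrogers 0 z * f z))"
        by (simp add: 1 mult_ac)
      thus ?thesis by (simp only: circle_mean_cmult Xrp mult_zero_right)
    next
      case 2
      have "circle_mean (\<lambda>z. ?X z ^ k * (z ^ n + (1 / z) ^ n) * f z) = circle_mean (\<lambda>z. ?X z ^ Suc k * nrogers 0 z * f z)"
        by (simp add: 2 mult_ac)
      thus ?thesis by (simp only: Xrp)
    next
      case (3 m)
      have "circle_mean (\<lambda>z. ?X z ^ k * (z ^ n + (1 / z) ^ n) * f z) =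
        circle_mean (\<lambda>z. ?X z ^ Suc k * (z ^ Suc m + (1 / z) ^ Suc m) * f z - ?X z ^ k * (z ^ m + (1 / z) ^ m) * f z)"
      proof (rule circle_mean_cong)
        fix z :: complex assume "norm z = 1"
        hence "z * (1 / z) = 1" by auto
        hence "z ^ n + (1 / z) ^ n = ?X z * (z ^ Suc m + (1 / z) ^ Suc m) - (z ^ m + (1 / z) ^ m)"
          unfolding 3 power_Suc by (rule chebyshev_step)
        thus "?X z ^ k * (z ^ n + (1 / z) ^ n) * f z = ?X z ^ Suc k * (z ^ Suc m + (1 / z) ^ Suc m) * f z - ?X z ^ k * (z ^ m + (1 / z) ^ m) * f z"
          by (simp only: power_Suc left_diff_distrib right_diff_distrib mult_ac)
      qed
      also have "\<dots> = 0"
        by (subst circle_mean_diff) (auto intro!: c continuous_intros simp del: power_Suc simp: less.IH 3)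
      finally show ?thesis .
    qed
  qed
  have pos: "circle_mean (\<lambda>z. f z * z ^ n) = 0 \<and> circle_mean (\<lambda>z. f z * (1 / z) ^ n) = 0" for n
  proof -
    have "0 = circle_mean (\<lambda>z. f z * z ^ n + f z * (1 / z) ^ n)"
      using Xe[of 0 n] by (simp add: algebra_simps)
    also have "\<dots> = circle_mean (\<lambda>z. f z * z ^ n) + circle_mean (\<lambda>z. f z * (1 / z) ^ n)"
      by (intro circle_mean_add continuous_intros f) auto
    also have "circle_mean (\<lambda>z. f z * z ^ n) = circle_mean (\<lambda>z. f (1 / z) * (1 / z) ^ n)"
      by (rule circle_mean_inverse[of "\<lambda>z. f z * z ^ n", symmetric])
    also have "\<dots> = circle_mean (\<lambda>z. f z * (1 / z) ^ n)"
      by (rule circle_mean_cong) (simp add: sym)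
    finally have "circle_mean (\<lambda>z. f z * (1 / z) ^ n) = 0" by simp
    moreover have "circle_mean (\<lambda>z. f z * z ^ n) = circle_mean (\<lambda>z. f z * (1 / z) ^ n)"
      using circle_mean_inverse[of "\<lambda>z. f z * z ^ n"] sym by (metis (mono_tags, lifting) circle_mean_cong)
    ultimately show ?thesis by simp
  qed
  fix n :: int
  show "circle_mean (\<lambda>z. f z * z powi n) = 0"
    using pos[of "nat \<bar>n\<bar>"] by (cases "n \<ge> 0") (auto simp: power_int_def power_one_over field_simps)
qed

text \<open>Both sides have the same moments against the Rogers polynomials in d. The weight of these moments
  contains weyl_denom d, which is 0 for d^2 = 1.\<close>
theorem double_kernel_symmetric:
  assumes abc: "a \<in> annulus" "b \<in> annulus" "c \<in> annulus" and d: "norm d = 1" "d^2 \<noteq> 1"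
  shows "double_kernel a b c d = double_kernel c b a d"
proof -
  define f where "f d = weyl_denom d * (double_kernel a b c d - double_kernel c b a d)" for d
  have cv: "continuous_on (sphere 0 1) weyl_denom"
    by (rule weyl_denom_cont(1)[OF continuous_on_id]) auto
  have "f d = 0"
  proof (rule rogers_total[OF _ _ _ d(1)])
    show "continuous_on (sphere 0 1) f"
      unfolding f_def by (intro continuous_intros cv double_kernel_continuous abc)
    show "f (1 / z) = f z" if "norm z = 1" for z
      using that by (simp add: f_def weyl_denom_def power_one_over double_kernel_def kernel_denom_inverse[simplified]
          kernel_denom_commute(2)[of _ "_" "1 / z"] kernel_denom_commute(2)[of c "1 / z"] kernel_denom_commute(2)[of a "1 / z"]
          kernel_denom_commute(2)[of c z] kernel_denom_commute(2)[of a z] mult_ac)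
    fix n
    have "circle_mean (\<lambda>z. nrogers n z * f z) = circle_mean (\<lambda>z. nrogers n z * (weyl_denom z * double_kernel a b c z) - nrogers n z * (weyl_denom z * double_kernel c b a z))"
      by (simp add: f_def right_diff_distrib)
    also have "\<dots> = 0"
    proof (subst circle_mean_diff)
      show "circle_mean (\<lambda>z. nrogers n z * (weyl_denom z * double_kernel a b c z)) - circle_mean (\<lambda>z. nrogers n z * (weyl_denom z * double_kernel c b a z)) = 0"
        unfolding double_kernel_moment[OF abc] double_kernel_moment[OF abc(3,2,1)] by (simp add: mult_ac)
    qed (intro continuous_intros cv nrogers_continuous double_kernel_continuous abc)+
    finally show "circle_mean (\<lambda>z. nrogers n z * f z) = 0" .
  qed
  moreover have "weyl_denom d \<noteq> 0"
  proof -
    have "qpoch x q \<noteq> 0" if "norm x = 1" "x \<noteq> 1" for x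
      using that q_lt_1 qpoch_nz[of "x * q"] by (subst qpoch_rec) (simp add: norm_mult)
    thus ?thesis using d by (auto simp: weyl_denom_def norm_power norm_divide)
  qed
  ultimately show ?thesis by (simp add: f_def)
qed

end

text \<open>The shape of the set of inner poles: discrete in the punctured plane, with 0 as the only possible
  accumulation point.\<close>
section \<open>Contours separating poles from their reciprocals\<close>

definition accumulates_at_0 :: "complex set \<Rightarrow> bool" where
  "accumulates_at_0 P \<longleftrightarrow> 0 \<notin> P \<and> (\<forall>\<delta>>0. finite {p\<in>P. norm p \<ge> \<delta>})"

definition separates :: "complex set \<Rightarrow> (real \<Rightarrow> complex) \<Rightarrow> bool" where
  "separates P \<gamma> \<longleftrightarrow> valid_path \<gamma> \<and> homotopic_loops (- {0}) (circlepath 0 1) \<gamma> \<and>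
     (\<forall>p\<in>P. p \<notin> path_image \<gamma> \<and> winding_number \<gamma> p = 1 \<and>
        1 / p \<notin> path_image \<gamma> \<and> winding_number \<gamma> (1 / p) = 0)"

lemma B1_contour_separates: "B1_contour b t q \<gamma> \<longleftrightarrow> separates (B1_inner_poles b t q) \<gamma>"
  by (simp add: B1_contour_def separates_def)

definition pole_free :: "complex set \<Rightarrow> complex set" where
  "pole_free P = {z. z \<noteq> 0 \<and> z \<notin> P \<and> 1 / z \<notin> P}"

lemma accumulates_at_0_subset: "accumulates_at_0 P \<Longrightarrow> S \<subseteq> P \<Longrightarrow> accumulates_at_0 S"
  unfolding accumulates_at_0_def
  by (auto intro!: finite_subset[of "{p\<in>S. \<delta> \<le> norm p}" "{p\<in>P. \<delta> \<le> norm p}" for \<delta>])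

lemma accumulates_at_0_finite: "accumulates_at_0 P \<Longrightarrow> \<delta> > 0 \<Longrightarrow> finite {p\<in>P. \<delta> \<le> norm p}"
  by (simp add: accumulates_at_0_def)

lemma accumulates_at_0_closed: "accumulates_at_0 P \<Longrightarrow> closed (insert 0 P)"
proof -
  assume P: "accumulates_at_0 P"
  have "open (- insert 0 P)"
  proof (rule openI)
    fix z assume z: "z \<in> - insert 0 P"
    define F where "F = {p\<in>P. norm p \<ge> norm z / 2}"
    have "finite F" unfolding F_def by (rule accumulates_at_0_finite[OF P]) (use z in auto)
    hence "open (ball z (norm z / 2) - F)" by (intro open_Diff finite_imp_closed) auto
    moreover have "z \<in> ball z (norm z / 2) - F" using z by (auto simp: F_def)
    ultimately obtain e where e: "e > 0" "ball z e \<subseteq> ball z (norm z / 2) - F"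
      using open_contains_ball by blast
    have "ball z (norm z / 2) - F \<subseteq> - insert 0 P"
    proof
      fix x assume x: "x \<in> ball z (norm z / 2) - F"
      have "norm z \<le> norm x + dist z x"
        by (metis dist_norm norm_triangle_sub add.commute)
      hence "norm x > norm z / 2" using x by simp
      thus "x \<in> - insert 0 P" using x by (auto simp: F_def)
    qed
    thus "\<exists>e>0. ball z e \<subseteq> - insert 0 P" using e by blast
  qed
  thus ?thesis by (simp add: closed_def)
qed

lemma accumulates_at_0_countable: "accumulates_at_0 P \<Longrightarrow> countable P"
proof -
  assume P: "accumulates_at_0 P"
  have "P \<subseteq> (\<Union>n::nat. {p\<in>P. norm p \<ge> 1 / real (Suc n)})"
  proof
    fix p assume "p \<in> P"
    hence "norm p > 0" using P by (auto simp: accumulates_at_0_def)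
    then obtain n where "inverse (real (Suc n)) < norm p" using reals_Archimedean by blast
    thus "p \<in> (\<Union>n::nat. {p\<in>P. norm p \<ge> 1 / real (Suc n)})" using \<open>p \<in> P\<close>
      by (auto intro!: exI[of _ n] simp: inverse_eq_divide)
  qed
  moreover have "countable (\<Union>n::nat. {p\<in>P. norm p \<ge> 1 / real (Suc n)})"
  proof (rule countable_UN)
    show "countable {p\<in>P. norm p \<ge> 1 / real (Suc n)}" for n
      by (intro countable_finite accumulates_at_0_finite[OF P]) simp
  qed simp
  ultimately show ?thesis by (rule countable_subset)
qed

lemma open_inverse_preimage:
  assumes "open T"
  shows "open {z::complex. z \<noteq> 0 \<and> 1 / z \<in> T}"
proof -
  have "open (- {0} \<inter> (\<lambda>z::complex. 1 / z) -` T)"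
    by (intro continuous_open_preimage assms) (auto intro!: continuous_intros)
  moreover have "- {0} \<inter> (\<lambda>z::complex. 1 / z) -` T = {z. z \<noteq> 0 \<and> 1 / z \<in> T}" by auto
  ultimately show ?thesis by simp
qed

lemma pole_free_open: "accumulates_at_0 P \<Longrightarrow> open (pole_free P)"
proof -
  assume P: "accumulates_at_0 P"
  have "pole_free P = - insert 0 P \<inter> {z. z \<noteq> 0 \<and> 1 / z \<in> - insert 0 P}"
    by (auto simp: pole_free_def)
  moreover have "open (- insert 0 P)" by (intro open_Compl accumulates_at_0_closed[OF P])
  ultimately show ?thesis using open_inverse_preimage by (simp only: open_Int)
qed

lemma pole_free_connected: "accumulates_at_0 P \<Longrightarrow> connected (pole_free P)"
proof -
  assume P: "accumulates_at_0 P"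
  have "z \<in> (\<lambda>p. 1 / p) ` P \<longleftrightarrow> 1 / z \<in> P" for z
    by (auto simp: image_iff intro!: bexI[of _ "1 / z"])
  hence "pole_free P = UNIV - ({0} \<union> P \<union> (\<lambda>p. 1 / p) ` P)"
    by (auto simp: pole_free_def simp del: image_iff)
  moreover have "connected (UNIV - ({0} \<union> P \<union> (\<lambda>p. 1 / p) ` P))"
    by (rule connected_open_diff_countable) (auto intro: accumulates_at_0_countable[OF P])
  ultimately show ?thesis by simp
qed

text \<open>The poles and their reciprocals are isolated in the punctured plane.\<close>
lemma pole_free_punctured_ball:
  assumes P: "accumulates_at_0 P" and w: "w \<noteq> 0"
  obtains e where "e > 0" "ball w e - {w} \<subseteq> pole_free P"
proof -
  define T where "T = pole_free (P - {w, 1 / w}) - ({1 / w} - {w})"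
  have "open T"
    unfolding T_def by (intro open_Diff pole_free_open[OF accumulates_at_0_subset[OF P]] finite_imp_closed) auto
  moreover have "w \<in> T" using w by (auto simp: pole_free_def T_def)
  ultimately obtain e where e: "e > 0" "ball w e \<subseteq> T"
    by (meson open_contains_ball)
  have "T - {w} \<subseteq> pole_free P"
  proof
    fix x assume x: "x \<in> T - {w}"
    hence "x \<noteq> 1 / w" "x \<noteq> w" "x \<noteq> 0" by (auto simp: T_def pole_free_def)
    moreover from this have "1 / x \<noteq> w" by auto
    moreover have "1 / x \<noteq> 1 / w" using \<open>x \<noteq> w\<close> by simp
    ultimately show "x \<in> pole_free P" using x by (auto simp: T_def pole_free_def)
  qed
  thus ?thesis using that[of e] e by blast
qed

text \<open>From the start of \<gamma> follow a path to a small circle around z0, run through it once, and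
  return.\<close>
lemma winding_modify:
  assumes U: "open U" "connected U" and z0: "z0 \<notin> U" "e > 0" "ball z0 e - {z0} \<subseteq> U"
    and \<gamma>: "valid_path \<gamma>" "pathfinish \<gamma> = pathstart \<gamma>" "path_image \<gamma> \<subseteq> U" and s: "s \<in> {1, -1}"
  obtains \<delta> where "valid_path \<delta>" "pathfinish \<delta> = pathstart \<delta>" "path_image \<delta> \<subseteq> U"
    "winding_number \<delta> z0 = winding_number \<gamma> z0 + s"
    "\<And>w. w \<notin> U \<Longrightarrow> w \<noteq> z0 \<Longrightarrow> winding_number \<delta> w = winding_number \<gamma> w"
proof -
  define C where "C = (if s = 1 then circlepath z0 (e / 2) else reversepath (circlepath z0 (e / 2)))"
  have Cim: "path_image C = sphere z0 (e / 2)" using z0 by (simp add: C_def)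
  have C: "valid_path C" "path C" "pathstart C = z0 + e / 2" "pathfinish C = z0 + e / 2" "path_image C \<subseteq> U"
    using z0 by (auto simp: C_def Cim intro!: subsetD[OF z0(3)]) 
  have s1: "pathstart \<gamma> \<in> U" using \<gamma> by auto
  have s2: "z0 + e / 2 \<in> U" using C by (metis pathstart_in_path_image subsetD)
  obtain g where g: "polynomial_function g" "path_image g \<subseteq> U" "pathstart g = pathstart \<gamma>" "pathfinish g = z0 + e / 2"
    using connected_open_polynomial_connected[OF U s1 s2] by blast
  have gv: "valid_path g" "path g" using g valid_path_polynomial_function path_polynomial_function by blast+
  have g': "path \<gamma>" using \<gamma> valid_path_imp_path by blast
  define \<delta> where "\<delta> = \<gamma> +++ (g +++ (C +++ reversepath g))"
  have wn: "winding_number \<delta> w = winding_number \<gamma> w + winding_number C w" if "w \<notin> U" for w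
  proof -
    have "w \<notin> path_image \<gamma>" "w \<notin> path_image g" "w \<notin> path_image C" using that \<gamma> g C by auto
    thus ?thesis unfolding \<delta>_def using gv g' C g \<gamma>
      by (simp add: winding_number_join path_image_join winding_number_reversepath)
  qed
  have wC: "winding_number C w = (if w = z0 then s else 0)" if "w \<notin> U" for w
  proof (cases "w = z0")
    case True
    thus ?thesis using s z0 by (auto simp: C_def winding_number_circlepath_centre winding_number_reversepath)
  next
    case False
    hence "w \<notin> cball z0 (e / 2)" using that z0 by (auto simp: subset_iff)
    hence "winding_number C w = 0"
      using C by (intro winding_number_zero_outside[of C "cball z0 (e/2)"]) (auto simp: Cim)
    thus ?thesis using False by simp
  qed
  show ?thesis
  proof
    show "valid_path \<delta>" "pathfinish \<delta> = pathstart \<delta>" 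
      unfolding \<delta>_def using gv \<gamma> C g by auto
    show "path_image \<delta> \<subseteq> U"
      unfolding \<delta>_def using \<gamma> C g by (simp add: path_image_join)
    show "winding_number \<delta> z0 = winding_number \<gamma> z0 + s" using wn wC z0 by simp
    show "winding_number \<delta> w = winding_number \<gamma> w" if "w \<notin> U" "w \<noteq> z0" for w
      using wn wC that by simp
  qed
qed

lemma winding_modify_finite:
  assumes U: "open U" "connected U" and F: "finite F" "\<And>z. z \<in> F \<Longrightarrow> z \<notin> U \<and> (\<exists>e>0. ball z e - {z} \<subseteq> U)"
    and s: "\<And>z. z \<in> F \<Longrightarrow> s z \<in> {1, -1}"
    and \<gamma>: "valid_path \<gamma>" "pathfinish \<gamma> = pathstart \<gamma>" "path_image \<gamma> \<subseteq> U"
  shows "\<exists>\<delta>. valid_path \<delta> \<and> pathfinish \<delta> = pathstart \<delta> \<and> path_image \<delta> \<subseteq> U \<and>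
    (\<forall>w. w \<notin> U \<longrightarrow> winding_number \<delta> w = winding_number \<gamma> w + (if w \<in> F then s w else 0))"
  using F s
proof (induction F rule: finite_induct)
  case empty
  thus ?case using \<gamma> by auto
next
  case (insert x F)
  then obtain \<delta> where \<delta>: "valid_path \<delta>" "pathfinish \<delta> = pathstart \<delta>" "path_image \<delta> \<subseteq> U"
    "\<And>w. w \<notin> U \<Longrightarrow> winding_number \<delta> w = winding_number \<gamma> w + (if w \<in> F then s w else 0)"
    by (metis insert_iff)
  obtain e where x: "x \<notin> U" "e > 0" "ball x e - {x} \<subseteq> U" using insert.prems by blast
  have "s x \<in> {1, -1}" using insert.prems by blast
  from winding_modify[OF U x \<delta>(1-3) this] obtain \<delta>' where
    "valid_path \<delta>'" "pathfinish \<delta>' = pathstart \<delta>'" "path_image \<delta>' \<subseteq> U"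
    "winding_number \<delta>' x = winding_number \<delta> x + s x"
    "\<And>w. w \<notin> U \<Longrightarrow> w \<noteq> x \<Longrightarrow> winding_number \<delta>' w = winding_number \<delta> w" by metis
  note d' = this
  have "winding_number \<delta>' w = winding_number \<gamma> w + (if w \<in> insert x F then s w else 0)" if "w \<notin> U" for w
    using d'(4,5) \<delta>(4)[OF that] insert.hyps(2) that by (cases "w = x") auto
  thus ?case using d' by blast
qed

lemma separates_path_image: "separates P \<gamma> \<Longrightarrow> path_image \<gamma> \<subseteq> pole_free P"
proof
  fix z assume "separates P \<gamma>" "z \<in> path_image \<gamma>"
  moreover from this have "z \<noteq> 0" using homotopic_loops_imp_subset[of "-{0}" "circlepath 0 1" \<gamma>] by (auto simp: separates_def)
  moreover have "1 / z \<notin> P"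
  proof
    assume "1 / z \<in> P"
    hence "1 / (1 / z) \<notin> path_image \<gamma>" using \<open>separates P \<gamma>\<close> unfolding separates_def by blast
    thus False using \<open>z \<in> path_image \<gamma>\<close> by simp
  qed
  ultimately show "z \<in> pole_free P" by (auto simp: pole_free_def separates_def)
qed

lemma separates_closed: "separates P \<gamma> \<Longrightarrow> pathfinish \<gamma> = pathstart \<gamma>"
  unfolding separates_def using homotopic_loops_imp_loop by blast

lemma separates_winding_0: "separates P \<gamma> \<Longrightarrow> winding_number \<gamma> 0 = 1"
  using winding_number_homotopic_loops[of 0 "circlepath 0 1" \<gamma>] by (simp add: separates_def winding_number_circlepath_centre)

text \<open>A closed path in the punctured plane is freely homotopic to the unit circle as soon as it winds
  once around 0.\<close>
lemma separatesI:
  assumes "valid_path \<gamma>" "pathfinish \<gamma> = pathstart \<gamma>" "path_image \<gamma> \<subseteq> pole_free P" "winding_number \<gamma> 0 = 1"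
    "\<And>p. p \<in> P \<Longrightarrow> winding_number \<gamma> p = 1" "\<And>p. p \<in> P \<Longrightarrow> winding_number \<gamma> (1 / p) = 0"
  shows "separates P \<gamma>"
proof -
  have "0 \<notin> path_image \<gamma>" using assms(3) by (auto simp: pole_free_def)
  hence "homotopic_loops (- {0}) (circlepath 0 1) \<gamma>"
    using assms winding_number_homotopic_loops_eq[of "circlepath 0 1" 0 \<gamma>]
    by (simp add: valid_path_imp_path winding_number_circlepath_centre)
  moreover have "p \<notin> path_image \<gamma>" "1 / p \<notin> path_image \<gamma>" if "p \<in> P" for p
    using that assms(3) by (auto simp: pole_free_def)
  ultimately show ?thesis using assms by (auto simp: separates_def)
qed

text \<open>A circle around 0 whose radius is not the modulus of a pole or of a reciprocal leaves only finitely
  many of these points on the wrong side. Each of them can be moved by winding_modify. These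
  corrections are independent of each other because no pole is the reciprocal of a pole.\<close>
theorem separates_exists:
  assumes P: "accumulates_at_0 P" and disj: "\<And>p p'. p \<in> P \<Longrightarrow> p' \<in> P \<Longrightarrow> p * p' \<noteq> 1"
  shows "\<exists>\<gamma>. separates P \<gamma>"
proof -
  have "countable (norm ` P \<union> (\<lambda>p. norm (1 / p)) ` P)"
    using accumulates_at_0_countable[OF P] by simp
  hence "\<not> {0<..<1::real} \<subseteq> norm ` P \<union> (\<lambda>p. norm (1 / p)) ` P"
    using uncountable_open_interval[of 0 "1::real"] countable_subset by auto
  then obtain r where "r \<in> {0<..<1}" and r': "r \<notin> norm ` P \<union> (\<lambda>p. norm (1 / p)) ` P"
    by blast
  hence r: "0 < r" "r < 1" "r \<notin> norm ` P \<union> (\<lambda>p. norm (1 / p)) ` P" by simp_all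
  have im: "path_image (circlepath 0 r) \<subseteq> pole_free P"
  proof
    fix z assume "z \<in> path_image (circlepath 0 r)"
    hence z: "norm z = r" using r by auto
    moreover have "1 / z \<notin> P"
    proof
      assume "1 / z \<in> P"
      hence "norm (1 / (1 / z)) \<in> (\<lambda>p. norm (1 / p)) ` P" by blast
      thus False using z r by simp
    qed
    ultimately show "z \<in> pole_free P" using r by (auto simp: pole_free_def)
  qed
  (* F1 consists of the poles outside the circle, F2 of the reciprocals of poles inside it. *)
  define F1 where "F1 = {p\<in>P. norm p > r}"
  define F2 where "F2 = (\<lambda>p. 1 / p) ` {p\<in>P. norm p > 1 / r}"
  have P0: "p \<noteq> 0" if "p \<in> P" for p using that P by (auto simp: accumulates_at_0_def)
  have fin: "finite F1" "finite F2"
  proof -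
    have "finite {p\<in>P. norm p \<ge> r}" "finite {p\<in>P. norm p \<ge> 1 / r}" using P r by (auto simp: accumulates_at_0_def)
    moreover have "F1 \<subseteq> {p\<in>P. norm p \<ge> r}" "{p\<in>P. norm p > 1 / r} \<subseteq> {p\<in>P. norm p \<ge> 1 / r}" by (auto simp: F1_def)
    ultimately show "finite F1" "finite F2" unfolding F2_def by (meson finite_subset finite_imageI)+
  qed
  define s where "s z = (if z \<in> F1 then 1 else -1 :: complex)" for z
  have "\<exists>\<delta>. valid_path \<delta> \<and> pathfinish \<delta> = pathstart \<delta> \<and> path_image \<delta> \<subseteq> pole_free P \<and>
    (\<forall>w. w \<notin> pole_free P \<longrightarrow> winding_number \<delta> w = winding_number (circlepath 0 r) w + (if w \<in> F1 \<union> F2 then s w else 0))"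
  proof (rule winding_modify_finite[OF pole_free_open[OF P] pole_free_connected[OF P]])
    fix z assume z: "z \<in> F1 \<union> F2"
    hence "z \<noteq> 0" "z \<notin> pole_free P" using P0 by (auto simp: F1_def F2_def pole_free_def)
    thus "z \<notin> pole_free P \<and> (\<exists>e>0. ball z e - {z} \<subseteq> pole_free P)" using pole_free_punctured_ball[OF P] by metis
  qed (use fin im in \<open>auto simp: s_def\<close>)
  then obtain \<delta> where \<delta>: "valid_path \<delta>" "pathfinish \<delta> = pathstart \<delta>" "path_image \<delta> \<subseteq> pole_free P"
    "\<And>w. w \<notin> pole_free P \<Longrightarrow> winding_number \<delta> w = winding_number (circlepath 0 r) w + (if w \<in> F1 \<union> F2 then s w else 0)"
    by blast
  have wc: "winding_number (circlepath 0 r) w = (if norm w < r then 1 else 0)" if "norm w \<noteq> r" for w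
  proof (cases "norm w < r")
    case True
    thus ?thesis using winding_number_circlepath[of w 0 r] by simp
  next
    case False
    hence "w \<notin> cball 0 r" using that by simp
    hence "winding_number (circlepath 0 r) w = 0"
      using r by (intro winding_number_zero_outside[of _ "cball 0 r"]) auto
    thus ?thesis using False by simp
  qed
  have "separates P \<delta>"
  proof (rule separatesI[OF \<delta>(1-3)])
    have "0 \<notin> F1 \<union> F2" "0 \<notin> pole_free P" using P0 r by (auto simp: F1_def F2_def pole_free_def)
    thus "winding_number \<delta> 0 = 1" using \<delta>(4) wc[of 0] r by simp
  next
    fix p assume p: "p \<in> P"
    hence n: "norm p \<noteq> r" "norm (1 / p) \<noteq> r" using r by auto
    have pole_free: "p \<notin> pole_free P" "1 / p \<notin> pole_free P" using p by (auto simp: pole_free_def)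
    have "p \<notin> F2"
    proof
      assume "p \<in> F2"
      then obtain p' where "p' \<in> P" "p = 1 / p'" by (auto simp: F2_def)
      thus False using disj[OF p, of p'] P0[of p'] by simp
    qed
    moreover have "p \<in> F1 \<longleftrightarrow> norm p > r" using p by (simp add: F1_def)
    ultimately show "winding_number \<delta> p = 1"
      using \<delta>(4)[OF pole_free(1)] wc[OF n(1)] n by (auto simp: s_def)
    have F1: "1 / p \<notin> F1" using disj[OF p, of "1 / p"] P0[OF p] by (auto simp: F1_def)
    have "1 / p \<in> F2 \<longleftrightarrow> norm (1 / p) < r"
    proof -
      have "1 / p \<in> F2 \<longleftrightarrow> norm p > 1 / r" using p by (auto simp: F2_def image_iff)
      also have "\<dots> \<longleftrightarrow> norm (1 / p) < r" using P0[OF p] r by (simp add: norm_divide field_simps)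
      finally show ?thesis .
    qed
    thus "winding_number \<delta> (1 / p) = 0"
      using \<delta>(4)[OF pole_free(2)] wc[OF n(2)] n F1 by (auto simp: s_def)
  qed
  thus ?thesis by blast
qed

text \<open>Joined by a path in pole_free P, the loop \<gamma> and the reverse of \<delta> form a loop whose winding
  numbers around all points outside pole_free P are 0. So the homology form of Cauchy's theorem
  applies.\<close>
theorem separates_integral_unique:
  assumes P: "accumulates_at_0 P" and \<gamma>: "separates P \<gamma>" and \<delta>: "separates P \<delta>" and f: "f holomorphic_on pole_free P"
  shows "contour_integral \<gamma> f = contour_integral \<delta> f"
proof -
  have v: "valid_path \<gamma>" "valid_path \<delta>" using assms by (auto simp: separates_def)
  hence product_coords: "path \<gamma>" "path \<delta>" by (auto intro: valid_path_imp_path)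
  note im = separates_path_image[OF \<gamma>] separates_path_image[OF \<delta>]
  note cl = separates_closed[OF \<gamma>] separates_closed[OF \<delta>]
  have s: "pathstart \<gamma> \<in> pole_free P" "pathstart \<delta> \<in> pole_free P" using im by auto
  obtain g where g: "polynomial_function g" "path_image g \<subseteq> pole_free P" "pathstart g = pathstart \<gamma>" "pathfinish g = pathstart \<delta>"
    using connected_open_polynomial_connected[OF pole_free_open[OF P] pole_free_connected[OF P] s] by blast
  have gv: "valid_path g" "path g" using g valid_path_polynomial_function path_polynomial_function by blast+
  define \<Gamma> where "\<Gamma> = \<gamma> +++ (g +++ (reversepath \<delta> +++ reversepath g))"
  have "(f has_contour_integral 0) \<Gamma>"
  proof (rule Cauchy_theorem_global[OF pole_free_open[OF P] f])
    show "valid_path \<Gamma>" "pathfinish \<Gamma> = pathstart \<Gamma>" "path_image \<Gamma> \<subseteq> pole_free P"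
      unfolding \<Gamma>_def using v gv g cl im by (auto simp: path_image_join)
    fix w assume w: "w \<notin> pole_free P"
    hence "w \<notin> path_image \<gamma>" "w \<notin> path_image \<delta>" "w \<notin> path_image g" using im g by auto
    hence "winding_number \<Gamma> w = winding_number \<gamma> w - winding_number \<delta> w"
      unfolding \<Gamma>_def using gv g product_coords cl
      by (simp add: winding_number_join path_image_join winding_number_reversepath)
    also have "\<dots> = 0"
    proof -
      consider "w = 0" | "w \<in> P" | "1 / w \<in> P" using w by (auto simp: pole_free_def)
      thus ?thesis
      proof cases
        case 1 thus ?thesis using separates_winding_0 assms by simp
      next
        case 2 thus ?thesis using \<gamma> \<delta> by (auto simp: separates_def)
      next
        case 3
        hence "winding_number \<gamma> (1 / (1 / w)) = 0" "winding_number \<delta> (1 / (1 / w)) = 0"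
          using \<gamma> \<delta> unfolding separates_def by blast+
        thus ?thesis by simp
      qed
    qed
    finally show "winding_number \<Gamma> w = 0" .
  qed
  hence "contour_integral \<Gamma> f = 0" by (rule contour_integral_unique)
  moreover have "f contour_integrable_on \<gamma>" "f contour_integrable_on \<delta>" "f contour_integrable_on g"
    using contour_integrable_holomorphic_simple[OF f pole_free_open[OF P]] v gv im g by blast+
  ultimately show ?thesis unfolding \<Gamma>_def using v gv g cl
    by (simp add: contour_integral_join contour_integrable_join contour_integrable_reversepath contour_integral_reversepath)
qed

text \<open>A polynomial path close to \<gamma> is homotopic to it in pole_free P. Differentiation under the integral
  sign needs a path with a continuous derivative.\<close>
lemma separates_polynomial:
  assumes P: "accumulates_at_0 P" and \<gamma>: "separates P \<gamma>"
  obtains \<delta> where "polynomial_function \<delta>" "separates P \<delta>"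
proof -
  have "path \<gamma>" using \<gamma> by (auto simp: separates_def valid_path_imp_path)
  from homotopic_nearby_loops[OF this pole_free_open[OF P] separates_path_image[OF \<gamma>] separates_closed[OF \<gamma>]]
  obtain e where e: "e > 0" "\<And>h. path h \<Longrightarrow> pathfinish h = pathstart h \<Longrightarrow> \<forall>t\<in>{0..1}. norm (h t - \<gamma> t) < e \<Longrightarrow> homotopic_loops (pole_free P) \<gamma> h"
    by blast
  obtain \<delta> where d: "polynomial_function \<delta>" "pathstart \<delta> = pathstart \<gamma>" "pathfinish \<delta> = pathfinish \<gamma>"
      "\<And>t. t \<in> {0..1} \<Longrightarrow> norm (\<delta> t - \<gamma> t) < e"
    using path_approx_polynomial_function[OF \<open>path \<gamma>\<close> e(1)] by blast
  have h: "homotopic_loops (pole_free P) \<gamma> \<delta>"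
    using d separates_closed[OF \<gamma>] by (intro e(2)) (auto intro: path_polynomial_function)
  have wn: "winding_number \<delta> w = winding_number \<gamma> w" if "w \<notin> pole_free P" for w
  proof -
    have "homotopic_loops (-{w}) \<gamma> \<delta>" using that by (intro homotopic_loops_subset[OF h]) auto
    thus ?thesis using winding_number_homotopic_loops by metis
  qed
  have "separates P \<delta>"
  proof (rule separatesI)
    show "path_image \<delta> \<subseteq> pole_free P" using homotopic_loops_imp_subset[OF h] by simp
    show "winding_number \<delta> 0 = 1" using wn[of 0] separates_winding_0[OF \<gamma>] by (simp add: pole_free_def)
    fix p assume p: "p \<in> P"
    show "winding_number \<delta> p = 1" "winding_number \<delta> (1 / p) = 0"
      using wn[of p] wn[of "1 / p"] p \<gamma> by (auto simp: pole_free_def separates_def)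
  qed (use d separates_closed[OF \<gamma>] in \<open>auto intro: valid_path_polynomial_function\<close>)
  thus ?thesis using that d by blast
qed

text \<open>A pair (a, l) denotes the parameters b = q exp (-a) and t_r = exp l_r, so that A = q/b is exp a and
  q/(b t_r) is exp (a - l_r). The multiplicative action is linear in these coordinates, and any two
  points can be joined by a complex line without meeting b = 0 or t_r = 0. Continuation values at the
  same point b, t do not depend on the logarithms.\<close>
section \<open>Logarithmic parameters\<close>

type_synonym param = "complex \<times> (complex^4)"

context nome
begin

text \<open>The eight numbers t_r and q/(b t_r), whose multiples by powers of q are the inner poles.\<close>
definition base_pole :: "param \<Rightarrow> 4 \<times> bool \<Rightarrow> complex" where
  "base_pole p i = (if snd i then exp (snd p $ fst i) else exp (fst p - snd p $ fst i))"

definition poles :: "param \<Rightarrow> complex set" where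
  "poles p = {base_pole p i * q ^ k | i k. True}"

definition b_of :: "param \<Rightarrow> complex" where
  "b_of p = q * exp (- fst p)"

definition t_of :: "param \<Rightarrow> complex^4" where
  "t_of p = (\<chi> r. exp (snd p $ r))"

text \<open>No inner pole is the reciprocal of an inner pole. This is equivalent to the existence of a contour
  (separable_iff_contour).\<close>
definition separable :: "param \<Rightarrow> bool" where
  "separable p \<longleftrightarrow> (\<forall>i j k. base_pole p i * base_pole p j * q ^ k \<noteq> 1)"

text \<open>An entire function of the parameters that vanishes exactly where no contour exists.\<close>
definition collision_prod :: "param \<Rightarrow> complex" where
  "collision_prod p = (\<Prod>i\<in>UNIV. \<Prod>j\<in>UNIV. qpoch (base_pole p i * base_pole p j) q)"

lemma separable_iff_collision_prod: "separable p \<longleftrightarrow> collision_prod p \<noteq> 0"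
  by (auto simp: separable_def collision_prod_def qpoch_eq_0_iff)

lemma b_of_nz: "b_of p \<noteq> 0" using q_nz by (simp add: b_of_def)

lemma q_div_b_of: "q / b_of p = exp (fst p)"
  using q_nz by (simp add: b_of_def exp_minus field_simps)

lemma q_div_b_of_t_of: "q / (b_of p * t_of p $ r) = exp (fst p - snd p $ r)"
  using q_nz by (simp add: b_of_def t_of_def exp_minus exp_diff field_simps)

lemma inner_poles_eq: "B1_inner_poles (b_of p) (t_of p) q = poles p"
proof -
  have "1 / (b_of p * t_of p $ r) * q ^ (k + 1) = exp (fst p - snd p $ r) * q ^ k" for r k
    unfolding q_div_b_of_t_of[symmetric] by simp
  hence "B1_inner_poles (b_of p) (t_of p) q = {exp (snd p $ r) * q ^ k | r k. True} \<union> {exp (fst p - snd p $ r) * q ^ k | r k. True}"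
    unfolding B1_inner_poles_def by (simp add: t_of_def)
  also have "\<dots> = poles p"
    unfolding poles_def base_pole_def by (auto simp: split_paired_Ex)
  finally show ?thesis .
qed

lemma polesI: "base_pole p i * q ^ k \<in> poles p"
  unfolding poles_def by blast

lemma polesE:
  assumes "z \<in> poles p"
  obtains i k where "z = base_pole p i * q ^ k"
  using assms unfolding poles_def by blast

lemma base_pole_nz: "base_pole p i \<noteq> 0"
  by (simp add: base_pole_def)

lemma accumulates_at_0_poles: "accumulates_at_0 (poles p)"
proof -
  have "finite {z\<in>poles p. norm z \<ge> \<delta>}" if "\<delta> > 0" for \<delta>
  proof -
    have "\<exists>N. \<forall>k\<ge>N. norm (base_pole p i * q ^ k) < \<delta>" for i
    proof -
      have "(\<lambda>k. base_pole p i * q ^ k) \<longlonglongrightarrow> 0"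
        using q_lt_1 by (auto intro!: tendsto_mult_right_zero LIMSEQ_power_zero)
      from LIMSEQ_D[OF this that] show ?thesis by simp
    qed
    then obtain N where N: "\<And>i k. k \<ge> N i \<Longrightarrow> norm (base_pole p i * q ^ k) < \<delta>" by metis
    have "{z\<in>poles p. norm z \<ge> \<delta>} \<subseteq> (\<Union>i. (\<lambda>k. base_pole p i * q ^ k) ` {..<N i})"
    proof
      fix z assume "z \<in> {z\<in>poles p. norm z \<ge> \<delta>}"
      then obtain i k where z: "z = base_pole p i * q ^ k" "norm z \<ge> \<delta>" by (blast elim: polesE)
      hence "k < N i" using N[of i k] by (cases "k \<ge> N i") auto
      thus "z \<in> (\<Union>i. (\<lambda>k. base_pole p i * q ^ k) ` {..<N i})" using z(1) by blast
    qed
    thus ?thesis by (rule finite_subset) auto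
  qed
  thus ?thesis using q_nz by (auto simp: accumulates_at_0_def poles_def base_pole_def)
qed

text \<open>A contour would have to wind once and not at all around a pole that is the reciprocal of a pole.\<close>
lemma separable_iff_contour: "separable p \<longleftrightarrow> (\<exists>\<gamma>. B1_contour (b_of p) (t_of p) q \<gamma>)"
proof
  assume g: "separable p"
  have "x * y \<noteq> 1" if xy: "x \<in> poles p" "y \<in> poles p" for x y
  proof -
    obtain i k where x: "x = base_pole p i * q ^ k" using xy(1) by (rule polesE)
    obtain j m where y: "y = base_pole p j * q ^ m" using xy(2) by (rule polesE)
    have "x * y = base_pole p i * base_pole p j * q ^ (k + m)" by (simp add: x y power_add)
    thus ?thesis using g unfolding separable_def by metis
  qed
  thus "\<exists>\<gamma>. B1_contour (b_of p) (t_of p) q \<gamma>"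
    unfolding B1_contour_separates inner_poles_eq by (intro separates_exists accumulates_at_0_poles) blast
next
  assume "\<exists>\<gamma>. B1_contour (b_of p) (t_of p) q \<gamma>"
  then obtain \<gamma> where s: "separates (poles p) \<gamma>" unfolding B1_contour_separates inner_poles_eq by blast
  show "separable p"
    unfolding separable_def
  proof (intro allI notI)
    fix i j k assume e: "base_pole p i * base_pole p j * q ^ k = 1"
    define x where "x = base_pole p i"
    define y where "y = base_pole p j * q ^ k"
    have "x \<in> poles p" using polesI[of p i 0] by (simp add: x_def)
    moreover have "y \<in> poles p" unfolding y_def by (rule polesI)
    moreover have "x = 1 / y" using e base_pole_nz q_nz by (simp add: x_def y_def field_simps)
    ultimately have "winding_number \<gamma> x = 1" "winding_number \<gamma> x = 0" using s unfolding separates_def by blast+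
    thus False by simp
  qed
qed

lemma base_pole_tendsto: "((\<lambda>p. base_pole p i) \<longlongrightarrow> base_pole p0 i) (at p0 within S)"
  unfolding base_pole_def by (cases "snd i") (auto intro!: tendsto_intros)

text \<open>Points close to 0 are on the correct side of \<gamma>, and so are their reciprocals. For all parameters
  near p0 this leaves the same finitely many indices, and the corresponding poles move continuously.\<close>
lemma separates_nearby:
  assumes \<gamma>: "separates (poles p0) \<gamma>"
  shows "eventually (\<lambda>p. separates (poles p) \<gamma>) (nhds p0)"
proof -
  have v: "valid_path \<gamma>" "path \<gamma>" "pathfinish \<gamma> = pathstart \<gamma>"
    using \<gamma> separates_closed by (auto simp: separates_def valid_path_imp_path)
  have K: "compact (path_image \<gamma>)" by (rule compact_path_image[OF v(2)])
  have K0: "0 \<notin> path_image \<gamma>" using separates_path_image[OF \<gamma>] by (auto simp: pole_free_def)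
  obtain \<delta>1 where d1: "\<delta>1 > 0" "ball 0 \<delta>1 \<subseteq> - path_image \<gamma>"
    using open_contains_ball[of "- path_image \<gamma>"] K0 K compact_imp_closed by blast
  obtain B where B: "B > 0" "\<And>z. z \<in> path_image \<gamma> \<Longrightarrow> norm z \<le> B"
    using compact_imp_bounded[OF K] by (auto simp: bounded_pos)
  (* Within \<delta> of 0 the winding number is 1, and reciprocals lie outside of a disc containing the path. *)
  define \<delta> where "\<delta> = min \<delta>1 (1 / (B + 1))"
  have d: "\<delta> > 0" "\<delta> \<le> \<delta>1" "\<delta> \<le> 1 / (B + 1)" using d1 B by (auto simp: \<delta>_def)
  (* Open sets of admissible positions for a pole and, via its reciprocal, for its mirror image. *)
  define O1 where "O1 = {z. z \<notin> path_image \<gamma> \<and> winding_number \<gamma> z = 1}"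
  define O2 where "O2 = {z. z \<noteq> 0 \<and> 1 / z \<in> {z. z \<notin> path_image \<gamma> \<and> winding_number \<gamma> z = 0}}"
  have op: "open (O1 \<inter> O2)"
    unfolding O1_def O2_def by (intro open_Int open_inverse_preimage open_winding_number_levelsets v)
  have small: "z \<in> O1 \<inter> O2" if "z \<noteq> 0" "norm z < \<delta>" for z
  proof -
    have "winding_number \<gamma> z = winding_number \<gamma> 0"
      by (rule winding_number_eq[of _ _ "ball 0 \<delta>1"]) (use v d d1 that in \<open>auto simp: subset_iff\<close>)
    moreover have "z \<notin> path_image \<gamma>" using that d d1 by (auto simp: subset_iff)
    moreover have z_out: "1 / z \<notin> cball 0 B"
    proof -
      have "norm z < 1 / (B + 1)" using that d(3) by simp
      hence "norm z * (B + 1) < 1" using B by (simp add: pos_less_divide_eq)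
      hence "norm z * B + norm z < 1" by (simp only: distrib_left mult_1_right)
      hence "B * norm z < 1" using norm_ge_zero[of z] by (simp only: mult.commute[of B])
      thus ?thesis using that by (simp add: norm_divide not_le field_simps)
    qed
    moreover have "winding_number \<gamma> (1 / z) = 0" 
      by (rule winding_number_zero_outside[of _ "cball 0 B"]) (use v B z_out in auto)
    ultimately show ?thesis using that separates_winding_0[OF \<gamma>] B by (auto simp: O1_def O2_def)
  qed
  define C where "C = (\<Sum>i\<in>UNIV. norm (base_pole p0 i)) + 1"
  have Cp: "C > 0" unfolding C_def by (intro add_nonneg_pos sum_nonneg) auto
  have "(\<lambda>k. C * norm q ^ k) \<longlonglongrightarrow> 0"
    using q_lt_1 by (auto intro!: tendsto_mult_right_zero LIMSEQ_power_zero)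
  then obtain N where N: "\<And>k. k \<ge> N \<Longrightarrow> C * norm q ^ k < \<delta>"
    using LIMSEQ_D[of "\<lambda>k. C * norm q ^ k" 0 \<delta>] d(1) Cp by (auto simp: norm_mult abs_mult)
  have tend: "((\<lambda>p. base_pole p i) \<longlongrightarrow> base_pole p0 i) (nhds p0)" for i
    using base_pole_tendsto[of i p0 UNIV] tendsto_at_iff_tendsto_nhds[of "\<lambda>p. base_pole p i" p0] by blast
  have "eventually (\<lambda>p. norm (base_pole p i) < C) (nhds p0)" for i
  proof (rule order_tendstoD(2)[OF tendsto_norm[OF tend]])
    have "norm (base_pole p0 i) \<le> (\<Sum>i\<in>UNIV. norm (base_pole p0 i))"
      by (rule member_le_sum) auto
    thus "norm (base_pole p0 i) < C" by (simp add: C_def)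
  qed
  hence ev1: "eventually (\<lambda>p. \<forall>i\<in>UNIV. norm (base_pole p i) < C) (nhds p0)"
    by (intro eventually_ball_finite) auto
  have "eventually (\<lambda>p. base_pole p i * q ^ k \<in> O1 \<inter> O2) (nhds p0)" for i k
  proof (rule topological_tendstoD[OF _ op])
    show "((\<lambda>p. base_pole p i * q ^ k) \<longlongrightarrow> base_pole p0 i * q ^ k) (nhds p0)"
      by (intro tendsto_intros tend)
    have "base_pole p0 i * q ^ k \<in> poles p0" by (rule polesI)
    moreover have "base_pole p0 i * q ^ k \<noteq> 0" using q_nz by (simp add: base_pole_def)
    ultimately show "base_pole p0 i * q ^ k \<in> O1 \<inter> O2" using \<gamma> unfolding separates_def O1_def O2_def by blast
  qed
  hence "eventually (\<lambda>p. \<forall>ik\<in>UNIV \<times> {..<N}. base_pole p (fst ik) * q ^ snd ik \<in> O1 \<inter> O2) (nhds p0)"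
    by (intro eventually_ball_finite) auto
  from this ev1 show ?thesis
  proof eventually_elim
    case (elim p)
    have "z \<in> O1 \<inter> O2" if "z \<in> poles p" for z
    proof -
      obtain i k where z: "z = base_pole p i * q ^ k" using \<open>z \<in> poles p\<close> by (rule polesE)
      show ?thesis
      proof (cases "k < N")
        case True
        hence "(i, k) \<in> UNIV \<times> {..<N}" by simp
        thus ?thesis using bspec[OF elim(1)] z by (metis fst_conv snd_conv)
      next
        case False
        have "norm (base_pole p i) \<le> C" using bspec[OF elim(2), of i] by simp
        hence "norm z \<le> C * norm q ^ k" unfolding z norm_mult norm_power by (rule mult_right_mono) simp
        also have "\<dots> < \<delta>" using False by (intro N) auto
        finally show ?thesis using z q_nz by (intro small) (auto simp: base_pole_def)
      qed
    qed
    thus ?case using \<gamma> unfolding separates_def O1_def O2_def by blast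
  qed
qed

end

text \<open>The derivative is complex linear, and continuous in the parameters and in the variable of
  integration together, as the Leibniz rule requires.\<close>
section \<open>Holomorphic dependence on the parameters\<close>

definition param_has_deriv ::
  "(param \<times> complex \<Rightarrow> complex) \<Rightarrow> (param \<times> complex \<Rightarrow> param \<Rightarrow> complex) \<Rightarrow>
   (param \<times> complex) set \<Rightarrow> bool" where
  "param_has_deriv G G' S \<longleftrightarrow> (\<forall>p z. (p, z) \<in> S \<longrightarrow> ((\<lambda>p. G (p, z)) has_derivative G' (p, z)) (at p)) \<and>
      (\<forall>p z c h v. (p, z) \<in> S \<longrightarrow> G' (p, z) (c * h, c *s v) = c * G' (p, z) (h, v)) \<and>
      continuous_on S G \<and> (\<forall>u. continuous_on S (\<lambda>x. G' x u))"

definition param_C1 :: "(param \<times> complex \<Rightarrow> complex) \<Rightarrow> (param \<times> complex) set \<Rightarrow> bool" where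
  "param_C1 G S \<longleftrightarrow> (\<exists>G'. param_has_deriv G G' S)"

lemma param_has_derivD:
  assumes "param_has_deriv G G' S"
  shows "\<And>p z. (p, z) \<in> S \<Longrightarrow> ((\<lambda>p. G (p, z)) has_derivative G' (p, z)) (at p)"
    "\<And>p z c h v. (p, z) \<in> S \<Longrightarrow> G' (p, z) (c * h, c *s v) = c * G' (p, z) (h, v)"
    "continuous_on S G" "\<And>u. continuous_on S (\<lambda>x. G' x u)"
  using assms unfolding param_has_deriv_def by blast+

lemma param_C1_const: "continuous_on S (\<lambda>x. g (snd x)) \<Longrightarrow> param_C1 (\<lambda>x. g (snd x)) S"
  unfolding param_C1_def param_has_deriv_def by (intro exI[of _ "\<lambda>_ _. 0"]) (auto simp: case_prod_unfold)

lemma param_C1_mult: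
  assumes "param_C1 F S" "param_C1 G S"
  shows "param_C1 (\<lambda>x. F x * G x) S"
proof -
  from assms obtain F' G' where "param_has_deriv F F' S" "param_has_deriv G G' S"
    unfolding param_C1_def by blast
  note F = param_has_derivD[OF this(1)] and G = param_has_derivD[OF this(2)]
  show ?thesis unfolding param_C1_def param_has_deriv_def
  proof (intro exI[of _ "\<lambda>x u. F x * G' x u + F' x u * G x"] conjI allI impI)
    fix p z assume "(p, z) \<in> S"
    show "((\<lambda>p. F (p, z) * G (p, z)) has_derivative (\<lambda>u. F (p, z) * G' (p, z) u + F' (p, z) u * G (p, z))) (at p)"
      by (intro has_derivative_mult F G \<open>(p, z) \<in> S\<close>)
    fix c h v
    show "F (p, z) * G' (p, z) (c * h, c *s v) + F' (p, z) (c * h, c *s v) * G (p, z) =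
        c * (F (p, z) * G' (p, z) (h, v) + F' (p, z) (h, v) * G (p, z))"
      using F(2) G(2) \<open>(p, z) \<in> S\<close> by (simp add: algebra_simps)
  next
    show "continuous_on S (\<lambda>x. F x * G x)" by (intro continuous_intros F G)
    show "continuous_on S (\<lambda>x. F x * G' x u + F' x u * G x)" for u by (intro continuous_intros F G)
  qed
qed

lemma param_C1_compose:
  assumes "param_C1 F S" and \<phi>: "\<phi> holomorphic_on T" "open T" and T: "\<And>x. x \<in> S \<Longrightarrow> F x \<in> T"
  shows "param_C1 (\<lambda>x. \<phi> (F x)) S"
proof -
  from assms obtain F' where "param_has_deriv F F' S"
    unfolding param_C1_def by blast
  note F = param_has_derivD[OF this]
  show ?thesis unfolding param_C1_def param_has_deriv_def
  proof (intro exI[of _ "\<lambda>x u. deriv \<phi> (F x) * F' x u"] conjI allI impI)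
    fix p z assume pz: "(p, z) \<in> S"
    have "(\<phi> has_field_derivative deriv \<phi> (F (p, z))) (at (F (p, z)))"
      using holomorphic_derivI[OF \<phi> T[OF pz]] .
    from has_derivative_compose[OF F(1)[OF pz] this[unfolded has_field_derivative_def]]
    show "((\<lambda>p. \<phi> (F (p, z))) has_derivative (\<lambda>u. deriv \<phi> (F (p, z)) * F' (p, z) u)) (at p)" .
    fix c h v
    show "deriv \<phi> (F (p, z)) * F' (p, z) (c * h, c *s v) = c * (deriv \<phi> (F (p, z)) * F' (p, z) (h, v))"
      using F(2) pz by simp
  next
    show "continuous_on S (\<lambda>x. \<phi> (F x))"
      by (rule continuous_on_compose2[OF holomorphic_on_imp_continuous_on[OF \<phi>(1)] F(3)]) (use T in auto)
    have "continuous_on S (\<lambda>x. deriv \<phi> (F x))"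
      by (rule continuous_on_compose2[OF holomorphic_on_imp_continuous_on[OF holomorphic_deriv[OF \<phi>]] F(3)]) (use T in auto)
    thus "continuous_on S (\<lambda>x. deriv \<phi> (F x) * F' x u)" for u by (intro continuous_intros F)
  qed
qed

lemma param_C1_linear:
  assumes "bounded_linear L" "\<And>c h v. L (c * h, c *s v) = c * L (h, v)"
  shows "param_C1 (\<lambda>x. L (fst x)) S"
  unfolding param_C1_def param_has_deriv_def
proof (intro exI[of _ "\<lambda>x. L"] conjI allI impI)
  show "((\<lambda>p. L (fst (p, z))) has_derivative L) (at p)" for p z
    using bounded_linear_imp_has_derivative[OF assms(1)] by simp
  show "continuous_on S (\<lambda>x. L (fst x))"
    by (intro continuous_on_compose2[OF linear_continuous_on[OF assms(1), of UNIV]] continuous_intros) auto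
qed (auto simp: assms)

lemma param_C1_inverse:
  assumes "param_C1 F S" "\<And>x. x \<in> S \<Longrightarrow> F x \<noteq> 0"
  shows "param_C1 (\<lambda>x. inverse (F x)) S"
  using assms by (intro param_C1_compose[of F S inverse "-{0}"]) (auto intro!: holomorphic_intros)

lemma param_C1_divide:
  assumes "param_C1 F S" "param_C1 G S" "\<And>x. x \<in> S \<Longrightarrow> G x \<noteq> 0"
  shows "param_C1 (\<lambda>x. F x / G x) S"
  unfolding divide_inverse using assms by (intro param_C1_mult param_C1_inverse)

lemma param_C1_1: "param_C1 (\<lambda>x. c) S"
  using param_C1_const[of S "\<lambda>_. c"] by simp

lemma param_C1_prod: "finite I \<Longrightarrow> (\<And>i. i \<in> I \<Longrightarrow> param_C1 (F i) S) \<Longrightarrow> param_C1 (\<lambda>x. \<Prod>i\<in>I. F i x) S"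
  by (induction I rule: finite_induct) (auto intro!: param_C1_1 param_C1_mult)

lemma param_C1_power: "param_C1 F S \<Longrightarrow> param_C1 (\<lambda>x. F x ^ n) S"
  by (induction n) (auto intro!: param_C1_1 param_C1_mult)

lemma param_C1_imp_holomorphic:
  assumes "param_C1 G (V \<times> {z})"
  shows "param_holomorphic_on (\<lambda>p. G (p, z)) V"
  using assms unfolding param_C1_def param_has_deriv_def param_holomorphic_on_def by (metis mem_Sigma_iff singletonI)

lemma param_holomorphic_mult:
  assumes "param_holomorphic_on F V" "param_holomorphic_on G V"
  shows "param_holomorphic_on (\<lambda>p. F p * G p) V"
  unfolding param_holomorphic_on_def
proof
  fix p assume p: "p \<in> V"
  obtain F' where F: "(F has_derivative F') (at p)" "\<And>c h v. F' (c * h, c *s v) = c * F' (h, v)"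
    using assms(1) p unfolding param_holomorphic_on_def by blast
  obtain G' where G: "(G has_derivative G') (at p)" "\<And>c h v. G' (c * h, c *s v) = c * G' (h, v)"
    using assms(2) p unfolding param_holomorphic_on_def by blast
  show "\<exists>D. ((\<lambda>p. F p * G p) has_derivative D) (at p) \<and> (\<forall>c h v. D (c * h, c *s v) = c * D (h, v))"
    by (intro exI[of _ "\<lambda>u. F p * G' u + F' u * G p"] conjI has_derivative_mult F G)
       (simp add: F G algebra_simps)
qed

text \<open>The Leibniz rule gives a real derivative. It is complex linear because it is the integral of the
  complex linear derivatives of the integrand.\<close>
lemma param_integral_holomorphic:
  fixes g :: "real \<Rightarrow> complex" and \<gamma> :: "real \<Rightarrow> complex"
  assumes G: "param_C1 G (V \<times> K)" and V: "open V" "convex V" and \<gamma>: "continuous_on {0..1} \<gamma>" "\<gamma> ` {0..1} \<subseteq> K"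
    and g: "continuous_on {0..1} g"
  shows "param_holomorphic_on (\<lambda>p. integral {0..1} (\<lambda>s. G (p, \<gamma> s) * g s)) V"
proof -
  from G obtain G' where "param_has_deriv G G' (V \<times> K)"
    unfolding param_C1_def by blast
  note G0 = param_has_derivD[OF this]
  have G: "\<And>p z. p \<in> V \<Longrightarrow> z \<in> K \<Longrightarrow> ((\<lambda>p. G (p, z)) has_derivative G' (p, z)) (at p)"
       "\<And>p z c h v. p \<in> V \<Longrightarrow> z \<in> K \<Longrightarrow> G' (p, z) (c * h, c *s v) = c * G' (p, z) (h, v)"
    using G0(1,2) by blast+
  note G = G G0(3,4)
  have \<gamma>K: "\<gamma> s \<in> K" if "s \<in> {0..1}" for s using that \<gamma> by auto
  define fx where "fx p s = Blinfun (\<lambda>u. G' (p, \<gamma> s) u * g s)" for p s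
  have bl: "bounded_linear (\<lambda>u. G' (p, \<gamma> s) u * g s)" if "p \<in> V" "s \<in> {0..1}" for p s
    using has_derivative_bounded_linear[OF G(1)[OF that(1) \<gamma>K[OF that(2)]]]
    by (rule bounded_linear_mult_const)
  have fx: "blinfun_apply (fx p s) u = G' (p, \<gamma> s) u * g s" if "p \<in> V" "s \<in> {0..1}" for p s u
    unfolding fx_def by (simp add: bounded_linear_Blinfun_apply[OF bl[OF that]])
  have cont\<gamma>: "continuous_on (V \<times> {0..1}) (\<lambda>x. (fst x, \<gamma> (snd x)))"
    by (intro continuous_intros continuous_on_compose2[OF \<gamma>(1)]) auto
  have contg: "continuous_on (V \<times> {0..1}) (\<lambda>x. g (snd x))"
    by (intro continuous_on_compose2[OF g] continuous_intros) auto
  have contfx: "continuous_on (V \<times> {0..1}) (\<lambda>x. fx (fst x) (snd x))"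
  proof (rule continuous_on_blinfun_componentwise)
    fix i :: "param"
    have "continuous_on (V \<times> {0..1}) (\<lambda>x. G' (fst x, \<gamma> (snd x)) i * g (snd x))"
      by (intro continuous_intros contg continuous_on_compose2[OF G(4) cont\<gamma>]) (use \<gamma>K in auto)
    thus "continuous_on (V \<times> {0..1}) (\<lambda>x. blinfun_apply (fx (fst x) (snd x)) i)"
      by (rule continuous_on_eq) (auto simp: fx)
  qed
  show ?thesis unfolding param_holomorphic_on_def
  proof
    fix p assume p: "p \<in> V"
    have contp: "continuous_on {0..1} (fx p)"
      using continuous_on_compose2[OF contfx continuous_on_Pair[OF continuous_on_const[of _ p] continuous_on_id]] p
      by auto
    have "((\<lambda>p. integral (cbox 0 1) (\<lambda>s. G (p, \<gamma> s) * g s)) has_derivative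
        blinfun_apply (integral (cbox 0 1) (fx p))) (at p within V)"
    proof (rule leibniz_rule[OF _ _ _ p V(2)])
      fix x and s :: real assume x: "x \<in> V" "s \<in> cbox 0 1"
      hence "((\<lambda>p. G (p, \<gamma> s) * g s) has_derivative (\<lambda>u. G' (x, \<gamma> s) u * g s)) (at x within V)"
        by (intro has_derivative_mult_left has_derivative_at_withinI[OF G(1)] \<gamma>K) auto
      moreover have "(\<lambda>u. G' (x, \<gamma> s) u * g s) = blinfun_apply (fx x s)" using x by (auto simp: fx)
      ultimately show "((\<lambda>p. G (p, \<gamma> s) * g s) has_derivative blinfun_apply (fx x s)) (at x within V)" by simp
    next
      fix x assume x: "x \<in> V"
      show "(\<lambda>s. G (x, \<gamma> s) * g s) integrable_on cbox 0 1"
      proof (rule integrable_continuous)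
        show "continuous_on (cbox 0 1) (\<lambda>s. G (x, \<gamma> s) * g s)"
          by (intro continuous_intros continuous_on_compose2[OF G(3), of _ "\<lambda>s. (x, \<gamma> s)"]) (use \<gamma> g x \<gamma>K in auto)
      qed
    next
      show "continuous_on (V \<times> cbox 0 1) (\<lambda>(x, t). fx x t)" using contfx by (simp add: case_prod_unfold)
    qed
    hence der: "((\<lambda>p. integral {0..1} (\<lambda>s. G (p, \<gamma> s) * g s)) has_derivative
        blinfun_apply (integral {0..1} (fx p))) (at p)"
      using at_within_open[OF p V(1)] by simp
    have app: "blinfun_apply (integral {0..1} (fx p)) u = integral {0..1} (\<lambda>s. G' (p, \<gamma> s) u * g s)" for u
    proof -
      have "integral {0..1} ((\<lambda>f. blinfun_apply f u) \<circ> fx p) = blinfun_apply (integral {0..1} (fx p)) u"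
        by (rule integral_linear) (auto intro: integrable_continuous_real contp bounded_linear_intros)
      moreover have "integral {0..1} ((\<lambda>f. blinfun_apply f u) \<circ> fx p) = integral {0..1} (\<lambda>s. G' (p, \<gamma> s) u * g s)"
        by (rule integral_cong) (simp add: fx p)
      ultimately show ?thesis by simp
    qed
    have "blinfun_apply (integral {0..1} (fx p)) (c * h, c *s v) = c * blinfun_apply (integral {0..1} (fx p)) (h, v)" for c h v
    proof -
      have "integral {0..1} (\<lambda>s. G' (p, \<gamma> s) (c * h, c *s v) * g s) = integral {0..1} (\<lambda>s. c * (G' (p, \<gamma> s) (h, v) * g s))"
        by (rule integral_cong) (simp add: G(2) p \<gamma>K)
      thus ?thesis unfolding app by simp
    qed
    thus "\<exists>D. ((\<lambda>p. integral {0..1} (\<lambda>s. G (p, \<gamma> s) * g s)) has_derivative D) (at p) \<and>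
        (\<forall>c h v. D (c * h, c *s v) = c * D (h, v))" using der by blast
  qed
qed

lemma has_derivative_vecI:
  fixes f :: "'a::real_normed_vector \<Rightarrow> ('b::euclidean_space)^'n"
  assumes "\<And>r. ((\<lambda>x. f x $ r) has_derivative (\<lambda>h. f' h $ r)) (at a)"
  shows "(f has_derivative f') (at a)"
proof (subst has_derivative_componentwise_within, rule ballI)
  fix i :: "'b^'n" assume "i \<in> Basis"
  then obtain r b where i: "i = axis r b" "b \<in> Basis" by (auto simp: Basis_vec_def)
  show "((\<lambda>x. f x \<bullet> i) has_derivative (\<lambda>x. f' x \<bullet> i)) (at a)"
    unfolding i inner_axis by (intro has_derivative_inner_left assms)
qed

context nome
begin

definition log_integral :: "param \<Rightarrow> complex" where
  "log_integral p = B1_integral (b_of p) (t_of p) q"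

definition log_prefactor :: "param \<Rightarrow> complex" where
  "log_prefactor p = B1_prefactor (b_of p) (t_of p) q"

definition log_integrand :: "param \<Rightarrow> complex \<Rightarrow> complex" where
  "log_integrand p z = B1_integrand (b_of p) (t_of p) q z / (2 * of_real pi * \<i> * z)"

lemma log_integrand_eq: "log_integrand p z = qpochs [exp (fst p) * z^2, exp (fst p) / z^2, z^2, 1 / z^2] q /
     (\<Prod>r\<in>UNIV. qpochs [base_pole p (r, True) * z, base_pole p (r, True) / z, base_pole p (r, False) * z, base_pole p (r, False) / z] q)
     / (2 * of_real pi * \<i> * z)"
  unfolding log_integrand_def B1_integrand_def q_div_b_of q_div_b_of_t_of by (simp add: t_of_def base_pole_def)

lemma qpoch_pole_free:
  assumes "z \<in> pole_free (poles p)"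
  shows "qpoch (base_pole p i * z) q \<noteq> 0" "qpoch (base_pole p i / z) q \<noteq> 0"
proof -
  have z: "z \<noteq> 0" "\<And>k. z \<noteq> base_pole p i * q ^ k" "\<And>k. 1 / z \<noteq> base_pole p i * q ^ k"
    using assms polesI[of p i] unfolding pole_free_def by (metis (mono_tags, lifting) mem_Collect_eq)+
  show "qpoch (base_pole p i * z) q \<noteq> 0"
    unfolding qpoch_eq_0_iff using z(1) z(3) by (auto simp: field_simps)
  show "qpoch (base_pole p i / z) q \<noteq> 0"
    unfolding qpoch_eq_0_iff using z(1) z(2) by (auto simp: field_simps)
qed

lemma log_integrand_holomorphic: "log_integrand p holomorphic_on pole_free (poles p)"
  unfolding log_integrand_eq qpochs_def
  by (simp, intro holomorphic_intros) (auto simp: qpoch_pole_free, auto simp: pole_free_def)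

text \<open>By separates_integral_unique every separating path may replace the one selected in B1_integral.\<close>
lemma log_integral_contour:
  assumes "separates (poles p) \<gamma>"
  shows "log_integral p = log_prefactor p * contour_integral \<gamma> (log_integrand p)"
proof -
  have "\<exists>\<gamma>. B1_contour (b_of p) (t_of p) q \<gamma>" using assms unfolding B1_contour_separates inner_poles_eq by blast
  hence "separates (poles p) (SOME \<gamma>. B1_contour (b_of p) (t_of p) q \<gamma>)"
    unfolding B1_contour_separates inner_poles_eq by (rule someI_ex)
  from separates_integral_unique[OF accumulates_at_0_poles this assms log_integrand_holomorphic]
  show ?thesis unfolding log_integral_def B1_integral_def log_prefactor_def log_integrand_def[abs_def] by simp
qed

lemma param_C1_base_pole: "param_C1 (\<lambda>x. base_pole (fst x) i) S"
proof (cases "snd i")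
  case True
  have "param_C1 (\<lambda>x. (\<lambda>p. snd p $ fst i) (fst x)) S"
    by (rule param_C1_linear) (auto intro!: bounded_linear_compose[OF bounded_linear_vec_nth bounded_linear_snd])
  from param_C1_compose[OF this, of exp UNIV] True show ?thesis
    by (simp add: base_pole_def holomorphic_on_exp)
next
  case False
  have "param_C1 (\<lambda>x. (\<lambda>p. fst p - snd p $ fst i) (fst x)) S"
    by (rule param_C1_linear)
       (auto intro!: bounded_linear_sub bounded_linear_compose[OF bounded_linear_vec_nth bounded_linear_snd] bounded_linear_fst simp: algebra_simps)
  from param_C1_compose[OF this, of exp UNIV] False show ?thesis
    by (simp add: base_pole_def holomorphic_on_exp)
qed

lemma param_C1_exp_fst: "param_C1 (\<lambda>x. exp (fst (fst x))) S"
proof -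
  have "param_C1 (\<lambda>x. fst (fst x)) S" by (rule param_C1_linear) (auto intro!: bounded_linear_fst)
  from param_C1_compose[OF this, of exp UNIV] show ?thesis by (simp add: holomorphic_on_exp)
qed

lemma param_C1_qpoch: "param_C1 F S \<Longrightarrow> param_C1 (\<lambda>x. qpoch (F x) q) S"
  using param_C1_compose[of F S "\<lambda>x. qpoch x q" UNIV] qpoch_holomorphic_UNIV by auto

lemma log_integrand_param_C1:
  assumes S: "\<And>p z. (p, z) \<in> S \<Longrightarrow> z \<in> pole_free (poles p)"
  shows "param_C1 (\<lambda>x. log_integrand (fst x) (snd x)) S"
proof -
  have nz: "snd x \<noteq> 0" if "x \<in> S" for x using S[of "fst x" "snd x"] that by (auto simp: pole_free_def)
  have z: "param_C1 (\<lambda>x. snd x ^ n) S" "param_C1 (\<lambda>x. 1 / snd x ^ n) S" "param_C1 (\<lambda>x. snd x) S" "param_C1 (\<lambda>x. 1 / snd x) S" for n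
    by (rule param_C1_const[of S], use nz in \<open>auto intro!: continuous_intros\<close>)+
  have divz: "param_C1 (\<lambda>x. F x / snd x ^ n) S" "param_C1 (\<lambda>x. F x / snd x) S" if "param_C1 F S" for F n
    using param_C1_mult[OF that z(2)[of n]] param_C1_mult[OF that z(4)] by simp_all
  show ?thesis
    unfolding log_integrand_eq qpochs_def list.map prod_list.Cons prod_list.Nil
    by (intro param_C1_divide param_C1_mult param_C1_prod param_C1_qpoch divz z param_C1_base_pole param_C1_exp_fst param_C1_1 finite)
       (use nz S qpoch_pole_free in \<open>auto\<close>)
qed

lemma log_prefactor_eq: "log_prefactor p = (\<Prod>(r, s)\<in>{(r, s). r < s}.
        qpochs [base_pole p (r, True) * base_pole p (s, True), base_pole p (r, True) * base_pole p (s, False),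
          base_pole p (s, True) * base_pole p (r, False), base_pole p (r, False) * base_pole p (s, False)] q)
     * qpoch (exp (fst p)) q ^ 4 * (qpoch q q / 2)"
proof -
  have e: "q * t_of p $ r / (b_of p * t_of p $ s) = base_pole p (r, True) * base_pole p (s, False)" for r s
  proof -
    have "q * t_of p $ r / (b_of p * t_of p $ s) = t_of p $ r * (q / (b_of p * t_of p $ s))" by simp
    thus ?thesis unfolding q_div_b_of_t_of by (simp add: t_of_def base_pole_def)
  qed
  have e2: "q^2 / (b_of p ^ 2 * t_of p $ r * t_of p $ s) = base_pole p (r, False) * base_pole p (s, False)" for r s
  proof -
    have "q^2 / (b_of p ^ 2 * t_of p $ r * t_of p $ s) = (q / (b_of p * t_of p $ r)) * (q / (b_of p * t_of p $ s))"
      by (simp add: power2_eq_square mult_ac)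
    thus ?thesis unfolding q_div_b_of_t_of by (simp add: base_pole_def)
  qed
  have e3: "t_of p $ r = base_pole p (r, True)" for r by (simp add: t_of_def base_pole_def)
  show ?thesis unfolding log_prefactor_def B1_prefactor_def e e2 q_div_b_of unfolding e3 ..
qed

lemma log_prefactor_holomorphic: "param_holomorphic_on log_prefactor V"
proof -
  have "param_C1 (\<lambda>x. log_prefactor (fst x)) (V \<times> {0})"
    unfolding log_prefactor_eq qpochs_def list.map prod_list.Cons prod_list.Nil case_prod_beta
    by (intro param_C1_mult param_C1_prod param_C1_power param_C1_qpoch param_C1_base_pole param_C1_exp_fst param_C1_1 finite)
  from param_C1_imp_holomorphic[OF this] show ?thesis by simp
qed

lemma separable_separates: "separable p \<longleftrightarrow> (\<exists>\<gamma>. separates (poles p) \<gamma>)"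
  using separable_iff_contour[of p] unfolding B1_contour_separates inner_poles_eq .

lemma open_separable: "open {p. separable p}"
proof (rule topological_space_class.openI)
  fix p assume "p \<in> {p. separable p}"
  then obtain \<gamma> where "separates (poles p) \<gamma>" by (auto simp: separable_separates)
  from separates_nearby[OF this] obtain T where "open T" "p \<in> T" "\<And>x. x \<in> T \<Longrightarrow> separates (poles x) \<gamma>"
    unfolding eventually_nhds by blast
  thus "\<exists>T. open T \<and> p \<in> T \<and> T \<subseteq> {p. separable p}" unfolding separable_separates by blast
qed

text \<open>By separates_nearby a single polynomial path serves for all parameters in a ball.\<close>
lemma log_integral_holomorphic: "param_holomorphic_on log_integral {p. separable p}"
  unfolding param_holomorphic_on_def
proof
  fix p0 assume "p0 \<in> {p. separable p}"
  then obtain \<gamma>0 where "separates (poles p0) \<gamma>0" by (auto simp: separable_separates)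
  from separates_polynomial[OF accumulates_at_0_poles this] obtain \<gamma> where \<gamma>: "polynomial_function \<gamma>" "separates (poles p0) \<gamma>" .
  from separates_nearby[OF \<gamma>(2)] obtain T where T: "open T" "p0 \<in> T" "\<And>x. x \<in> T \<Longrightarrow> separates (poles x) \<gamma>"
    unfolding eventually_nhds by blast
  obtain e where e: "e > 0" "ball p0 e \<subseteq> T" using T(1,2) open_contains_ball by blast
  define V where "V = ball p0 e"
  have V: "open V" "convex V" "p0 \<in> V" and sepV: "\<And>p. p \<in> V \<Longrightarrow> separates (poles p) \<gamma>" using e T by (auto simp: V_def)
  obtain \<gamma>' where g': "polynomial_function \<gamma>'" "\<And>x. (\<gamma> has_vector_derivative \<gamma>' x) (at x)"
    by (rule has_vector_derivative_polynomial_function[OF \<gamma>(1)]) blast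
  have C1: "param_C1 (\<lambda>x. log_integrand (fst x) (snd x)) (V \<times> path_image \<gamma>)"
  proof (rule log_integrand_param_C1)
    show "z \<in> pole_free (poles p)" if "(p, z) \<in> V \<times> path_image \<gamma>" for p z
      using separates_path_image[OF sepV] that by blast
  qed
  have "continuous_on {0..1} \<gamma>" "continuous_on {0..1} \<gamma>'"
    using \<gamma> g' by (auto simp: continuous_on_polymonial_function)
  from param_integral_holomorphic[OF C1 V(1,2) this(1) _ this(2)]
  have "param_holomorphic_on (\<lambda>p. integral {0..1} (\<lambda>s. log_integrand p (\<gamma> s) * \<gamma>' s)) V"
    by (simp add: path_image_def)
  hence "param_holomorphic_on (\<lambda>p. log_prefactor p * integral {0..1} (\<lambda>s. log_integrand p (\<gamma> s) * \<gamma>' s)) V"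
    by (intro param_holomorphic_mult log_prefactor_holomorphic)
  from bspec[OF this[unfolded param_holomorphic_on_def] V(3)]
  obtain D where D: "((\<lambda>p. log_prefactor p * integral {0..1} (\<lambda>s. log_integrand p (\<gamma> s) * \<gamma>' s)) has_derivative D) (at p0)"
      "\<forall>c h v. D (c * h, c *s v) = c * D (h, v)" by blast
  have eq: "log_prefactor p * integral {0..1} (\<lambda>s. log_integrand p (\<gamma> s) * \<gamma>' s) = log_integral p" if "p \<in> V" for p
    unfolding log_integral_contour[OF sepV[OF that]] contour_integral_integral vector_derivative_at[OF g'(2)] ..
  have "(log_integral has_derivative D) (at p0)"
    by (rule has_derivative_transform_within_open[OF D(1) V(1,3) eq])
  thus "\<exists>D. (log_integral has_derivative D) (at p0) \<and> (\<forall>c h v. D (c * h, c *s v) = c * D (h, v))" using D(2) by blast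
qed

end

section \<open>Analytic continuation of symmetries\<close>

lemma param_holomorphic_continuous:
  assumes "param_holomorphic_on F V"
  shows "continuous_on V F"
proof (rule continuous_at_imp_continuous_on, rule ballI)
  fix x assume "x \<in> V"
  then obtain D where "(F has_derivative D) (at x)" using assms unfolding param_holomorphic_on_def by blast
  thus "isCont F x" by (rule has_derivative_continuous)
qed

text \<open>Multiplication by complex scalars; a product type is only a real vector space.\<close>
definition cscale :: "complex \<Rightarrow> param \<Rightarrow> param" where
  "cscale c p = (c * fst p, c *s snd p)"

text \<open>Complex differentiability of maps between parameters.\<close>
definition chart_holomorphic_at ::
  "(param \<Rightarrow> param) \<Rightarrow> param \<Rightarrow> bool" where
  "chart_holomorphic_at M x \<longleftrightarrow> (\<exists>D. (M has_derivative D) (at x) \<and> (\<forall>c u. D (cscale c u) = cscale c (D u)))"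

lemma param_holomorphic_compose:
  assumes F: "param_holomorphic_on F V" and M: "\<And>x. x \<in> W \<Longrightarrow> chart_holomorphic_at M x \<and> M x \<in> V"
  shows "param_holomorphic_on (\<lambda>x. F (M x)) W"
  unfolding param_holomorphic_on_def
proof
  fix x assume x: "x \<in> W"
  obtain D where D: "(M has_derivative D) (at x)" "\<And>c u. D (cscale c u) = cscale c (D u)"
    using M[OF x] unfolding chart_holomorphic_at_def by blast
  obtain E where E: "(F has_derivative E) (at (M x))" "\<And>c h v. E (c * h, c *s v) = c * E (h, v)"
    using F M[OF x] unfolding param_holomorphic_on_def by blast
  have "((\<lambda>x. F (M x)) has_derivative (\<lambda>u. E (D u))) (at x)"
    by (rule has_derivative_compose[OF D(1) E(1)])
  moreover have "E (D (c * h, c *s v)) = c * E (D (h, v))" for c h v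
    using D(2)[of c "(h, v)"] E(2)[of c "fst (D (h, v))" "snd (D (h, v))"] by (simp add: cscale_def)
  ultimately show "\<exists>D. ((\<lambda>x. F (M x)) has_derivative D) (at x) \<and> (\<forall>c h v. D (c * h, c *s v) = c * D (h, v))"
    by blast
qed

definition cplx_linear :: "(param \<Rightarrow> param) \<Rightarrow> bool" where
  "cplx_linear M \<longleftrightarrow> bounded_linear M \<and> (\<forall>c p. M (cscale c p) = cscale c (M p))"

lemma cplx_linear_chart: "cplx_linear M \<Longrightarrow> chart_holomorphic_at M x"
  unfolding cplx_linear_def chart_holomorphic_at_def using bounded_linear_imp_has_derivative by blast

text \<open>The complex line that passes through x at 0 and through y at 1.\<close>
definition cline :: "param \<Rightarrow> param \<Rightarrow> complex \<Rightarrow> param" where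
  "cline x y \<theta> = x + cscale \<theta> (y - x)"

lemma cline_0 [simp]: "cline x y 0 = x" by (simp add: cline_def cscale_def prod_eq_iff)
lemma cline_1 [simp]: "cline x y 1 = y" by (simp add: cline_def cscale_def prod_eq_iff)

lemma cplx_linear_cline: "cplx_linear M \<Longrightarrow> M (cline x y \<theta>) = cline (M x) (M y) \<theta>"
proof -
  assume M: "cplx_linear M"
  then interpret bounded_linear M by (simp add: cplx_linear_def)
  have "M (cscale \<theta> (y - x)) = cscale \<theta> (M (y - x))" using M unfolding cplx_linear_def by blast
  thus ?thesis by (simp only: cline_def add diff)
qed

lemma bounded_linear_cscale: "bounded_linear (\<lambda>\<theta>. cscale \<theta> u)"
proof (rule linear_conv_bounded_linear[THEN iffD1])
  show "linear (\<lambda>\<theta>. cscale \<theta> u)"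
    by (rule linearI) (simp_all add: cscale_def prod_eq_iff vec_eq_iff algebra_simps)
qed

lemma cline_has_derivative: "(cline x y has_derivative (\<lambda>h. cscale h (y - x))) (at \<theta>)"
proof -
  have "((\<lambda>\<theta>. x + cscale \<theta> (y - x)) has_derivative (\<lambda>h. 0 + cscale h (y - x))) (at \<theta>)"
    by (intro has_derivative_add has_derivative_const bounded_linear_imp_has_derivative bounded_linear_cscale)
  thus ?thesis by (simp add: cline_def[abs_def])
qed

lemma cline_continuous: "continuous_on S (cline x y)"
  using cline_has_derivative has_derivative_continuous by (intro continuous_at_imp_continuous_on) blast

lemma param_holomorphic_cline:
  assumes F: "param_holomorphic_on F V" and T: "open T" "\<And>\<theta>. \<theta> \<in> T \<Longrightarrow> cline x y \<theta> \<in> V"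
  shows "(\<lambda>\<theta>. F (cline x y \<theta>)) holomorphic_on T"
  unfolding holomorphic_on_open[OF T(1)]
proof
  fix \<theta> assume "\<theta> \<in> T"
  then obtain E where E: "(F has_derivative E) (at (cline x y \<theta>))" "\<And>c h v. E (c * h, c *s v) = c * E (h, v)"
    using F T(2) unfolding param_holomorphic_on_def by blast
  have "((\<lambda>\<theta>. F (cline x y \<theta>)) has_derivative (\<lambda>h. E (cscale h (y - x)))) (at \<theta>)"
    by (rule has_derivative_compose[OF cline_has_derivative E(1)])
  moreover have "E (cscale h u) = E u * h" for h u
    using E(2)[of h "fst u" "snd u"] by (simp add: cscale_def mult.commute)
  ultimately show "\<exists>f'. ((\<lambda>\<theta>. F (cline x y \<theta>)) has_field_derivative f') (at \<theta>)"
    unfolding has_field_derivative_def by auto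
qed

context nome
begin

lemma collision_prod_cline_holomorphic: "(\<lambda>\<theta>. collision_prod (cline x y \<theta>)) holomorphic_on S"
proof -
  have 1: "fst (cline x y \<theta>) = fst x + \<theta> * (fst y - fst x)" for \<theta> by (simp add: cline_def cscale_def)
  have 2: "snd (cline x y \<theta>) $ r = snd x $ r + \<theta> * (snd y $ r - snd x $ r)" for \<theta> r by (simp add: cline_def cscale_def right_diff_distrib)
  have "(\<lambda>\<theta>. base_pole (cline x y \<theta>) i) holomorphic_on S" for i
    unfolding base_pole_def 1 2 by (cases "snd i") (auto intro!: holomorphic_intros)
  thus ?thesis unfolding collision_prod_def by (intro holomorphic_intros) auto
qed

text \<open>On the complex line from x, where h is not 0, to y the zeros of h are isolated.\<close>
lemma dense_nonzero:
  assumes h: "(\<lambda>\<theta>. h (cline x y \<theta>)) holomorphic_on UNIV" "h x \<noteq> 0" and V: "open V" "y \<in> V"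
  shows "\<exists>p\<in>V. h p \<noteq> 0"
proof (cases "h y = 0")
  case True
  obtain r where r: "0 < r" "\<And>z. z \<in> ball 1 r - {1} \<Longrightarrow> h (cline x y z) \<noteq> 0"
    using isolated_zeros[of "\<lambda>\<theta>. h (cline x y \<theta>)" UNIV 1 0] h True by auto
  have "open (cline x y -` V)"
    using open_vimage[OF V(1)] cline_continuous[of UNIV x y] by blast
  moreover have "1 \<in> cline x y -` V" using V by simp
  ultimately obtain e where e: "e > 0" "ball 1 e \<subseteq> cline x y -` V" using open_contains_ball by blast
  define z where "z = (1 + of_real (min r e / 2) :: complex)"
  have "z \<in> ball 1 r - {1}" "z \<in> ball 1 e" using r e by (auto simp: z_def dist_norm)
  thus ?thesis using r(2) e by blast
qed (use V in auto)

text \<open>The relation B1_continuation_value in logarithmic coordinates (continuation_value_iff).\<close>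
definition log_value :: "param \<Rightarrow> complex \<Rightarrow> bool" where
  "log_value p c \<longleftrightarrow> (\<exists>V F. open V \<and> p \<in> V \<and> param_holomorphic_on F V \<and>
     (\<forall>p'\<in>V. separable p' \<longrightarrow> F p' = log_integral p') \<and> F p = c)"

text \<open>The set where F and G differ is open, so it would contain a point where h is not 0.\<close>
lemma agree_dense:
  fixes F G :: "param \<Rightarrow> complex"
  assumes h: "\<And>y. (\<lambda>\<theta>. h (cline x y \<theta>)) holomorphic_on UNIV" "h x \<noteq> 0" and V: "open V" "y \<in> V"
    and FG: "continuous_on V F" "continuous_on V G" "\<And>p. p \<in> V \<Longrightarrow> h p \<noteq> 0 \<Longrightarrow> F p = G p"
  shows "F y = G y"
proof (rule ccontr)
  assume ne: "F y \<noteq> G y"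
  have "open (V \<inter> (\<lambda>p. F p - G p) -` (-{0}))"
    by (rule continuous_open_preimage) (use V FG in \<open>auto intro!: continuous_intros\<close>)
  moreover have "y \<in> V \<inter> (\<lambda>p. F p - G p) -` (-{0})" using ne V by auto
  ultimately obtain p where "p \<in> V \<inter> (\<lambda>p. F p - G p) -` (-{0})" "h p \<noteq> 0"
    using dense_nonzero[OF h] by blast
  thus False using FG(3)[of p] by auto
qed

text \<open>The parameters b = 1/q and t = (q, q, q, q). All reflections fix this point, since the logarithms of
  the t_r are half that of A, and the eight base poles are equal to q.\<close>
definition base_param :: "param" where
  "base_param = (2 * Ln q, \<chi> r. Ln q)"

lemma base_pole_base_param: "base_pole base_param i = q"
  using q_nz by (simp add: base_pole_def base_param_def)

lemma collision_prod_base_param: "collision_prod base_param \<noteq> 0"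
proof -
  have "norm (q * q) < 1" using q_lt_1 mult_strict_mono'[of "norm q" 1 "norm q" 1] by (simp add: norm_mult)
  thus ?thesis by (simp add: collision_prod_def base_pole_base_param qpoch_nz)
qed

text \<open>The parameters with collision_prod p \<noteq> 0 are dense, by agree_dense with the starting point
  base_param.\<close>
lemma log_value_unique: "log_value p c \<Longrightarrow> log_value p c' \<Longrightarrow> c = c'"
proof -
  assume "log_value p c" "log_value p c'"
  then obtain V F V' F' where F: "open V" "p \<in> V" "param_holomorphic_on F V" "\<And>p'. p' \<in> V \<Longrightarrow> separable p' \<Longrightarrow> F p' = log_integral p'" "F p = c"
    and F': "open V'" "p \<in> V'" "param_holomorphic_on F' V'" "\<And>p'. p' \<in> V' \<Longrightarrow> separable p' \<Longrightarrow> F' p' = log_integral p'" "F' p = c'"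
    unfolding log_value_def by blast
  have "F p = F' p"
  proof (rule agree_dense[of collision_prod base_param "V \<inter> V'"])
    show "continuous_on (V \<inter> V') F" "continuous_on (V \<inter> V') F'"
      using param_holomorphic_continuous F(3) F'(3) continuous_on_subset by blast+
    show "F p' = F' p'" if "p' \<in> V \<inter> V'" "collision_prod p' \<noteq> 0" for p'
      using that F(4) F'(4) by (simp add: separable_iff_collision_prod)
  qed (use F F' collision_prod_cline_holomorphic collision_prod_base_param in auto)
  thus ?thesis using F F' by simp
qed

lemma log_value_separable: "separable p \<Longrightarrow> log_value p (log_integral p)"
  unfolding log_value_def using open_separable log_integral_holomorphic by (intro exI[of _ "{p. separable p}"] exI[of _ log_integral]) auto

text \<open>A local biholomorphism. Near chart p it is inverted by chart_inv p, which takes principal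
  logarithms of the quotients by the coordinates of chart p.\<close>
definition chart :: "param \<Rightarrow> param" where
  "chart p = (b_of p, t_of p)"

lemma chart_punctured: "chart p \<in> punctured_params"
  using b_of_nz by (simp add: chart_def punctured_params_def t_of_def)

lemma chart_holomorphic: "chart_holomorphic_at chart p"
  unfolding chart_holomorphic_at_def
proof (intro exI conjI allI)
  let ?D = "\<lambda>u::param. (- (q * exp (- fst p)) * fst u, \<chi> r. exp (snd p $ r) * snd u $ r)"
  have 1: "(b_of has_derivative (\<lambda>u. - (q * exp (- fst p)) * fst u)) (at p)"
  proof -
    have "((\<lambda>a. q * exp (- a)) has_field_derivative - (q * exp (- fst p))) (at (fst p))"
      by (auto intro!: derivative_eq_intros)
    from has_derivative_compose[OF has_derivative_fst[OF has_derivative_ident] this[unfolded has_field_derivative_def]]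
    show ?thesis by (simp add: b_of_def[abs_def])
  qed
  have 2: "(t_of has_derivative (\<lambda>u. \<chi> r. exp (snd p $ r) * snd u $ r)) (at p)"
  proof (rule has_derivative_vecI)
    fix r
    have "((\<lambda>p::param. snd p $ r) has_derivative (\<lambda>u. snd u $ r)) (at p)"
      by (intro bounded_linear_imp_has_derivative bounded_linear_compose[OF bounded_linear_vec_nth bounded_linear_snd])
    from has_derivative_compose[OF this DERIV_exp[unfolded has_field_derivative_def]]
    show "((\<lambda>x. t_of x $ r) has_derivative (\<lambda>u. (\<chi> r. exp (snd p $ r) * snd u $ r) $ r)) (at p)"
      by (simp add: t_of_def)
  qed
  show "(chart has_derivative ?D) (at p)"
    unfolding chart_def[abs_def] by (rule has_derivative_Pair[OF 1 2])
  show "?D (cscale c u) = cscale c (?D u)" for c u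
    by (simp add: cscale_def vec_eq_iff)
qed

lemma chart_continuous: "continuous_on S chart"
proof (rule continuous_at_imp_continuous_on, rule ballI)
  fix x
  show "isCont chart x" using chart_holomorphic[of x] has_derivative_continuous
    unfolding chart_holomorphic_at_def by blast
qed

definition chart_inv :: "param \<Rightarrow> param \<Rightarrow> param" where
  "chart_inv p x = (fst p - Ln (fst x / b_of p), \<chi> r. snd p $ r + Ln (snd x $ r / t_of p $ r))"

definition chart_dom :: "param \<Rightarrow> param set" where
  "chart_dom p = {x. fst x / b_of p \<notin> \<real>\<^sub>\<le>\<^sub>0 \<and> (\<forall>r\<in>UNIV. snd x $ r / t_of p $ r \<notin> \<real>\<^sub>\<le>\<^sub>0)}"

lemma t_of_nz: "t_of p $ r \<noteq> 0" by (simp add: t_of_def)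

lemma open_chart_dom: "open (chart_dom p)"
proof -
  have o: "open (-\<real>\<^sub>\<le>\<^sub>0 :: complex set)" by (intro open_Compl closed_nonpos_Reals_complex)
  have "chart_dom p = (\<lambda>x. fst x / b_of p) -` (-\<real>\<^sub>\<le>\<^sub>0) \<inter> (\<Inter>r\<in>UNIV. (\<lambda>x. snd x $ r / t_of p $ r) -` (-\<real>\<^sub>\<le>\<^sub>0))"
    by (auto simp: chart_dom_def)
  also have "open \<dots>"
    by (intro open_Int open_INT finite ballI open_vimage o continuous_intros) (auto simp: b_of_nz t_of_nz)
  finally show ?thesis .
qed

lemma chart_dom_self: "chart p \<in> chart_dom p"
  by (simp add: chart_dom_def chart_def b_of_nz t_of_nz)

lemma chart_inv_self: "chart_inv p (chart p) = p"
  by (simp add: chart_inv_def chart_def b_of_nz t_of_nz prod_eq_iff vec_eq_iff)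

lemma chart_dom_nz:
  fixes x :: "param"
  assumes "x \<in> chart_dom p"
  shows "fst x \<noteq> 0" "snd x $ r \<noteq> 0"
proof -
  have "fst x / b_of p \<notin> \<real>\<^sub>\<le>\<^sub>0" "snd x $ r / t_of p $ r \<notin> \<real>\<^sub>\<le>\<^sub>0" using assms by (auto simp: chart_dom_def)
  thus "fst x \<noteq> 0" "snd x $ r \<noteq> 0" by (metis div_0 nonpos_Reals_zero_I)+
qed

lemma chart_chart_inv: "x \<in> chart_dom p \<Longrightarrow> chart (chart_inv p x) = x"
proof -
  assume x: "x \<in> chart_dom p"
  note nz = chart_dom_nz[OF x]
  have "b_of (chart_inv p x) = fst x"
  proof -
    have "b_of (chart_inv p x) = b_of p * exp (Ln (fst x / b_of p))"
      by (simp add: b_of_def chart_inv_def exp_add[symmetric])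
    thus ?thesis using nz b_of_nz[of p] by simp
  qed
  moreover have "t_of (chart_inv p x) $ r = snd x $ r" for r
  proof -
    have "t_of (chart_inv p x) $ r = t_of p $ r * exp (Ln (snd x $ r / t_of p $ r))"
      by (simp add: t_of_def chart_inv_def exp_add)
    thus ?thesis using nz t_of_nz[of p] by simp
  qed
  ultimately show ?thesis by (simp add: chart_def prod_eq_iff vec_eq_iff)
qed

lemma chart_inv_holomorphic:
  assumes x: "x \<in> chart_dom p"
  shows "chart_holomorphic_at (chart_inv p) x"
  unfolding chart_holomorphic_at_def
proof (intro exI conjI allI)
  let ?D = "\<lambda>u::param. (- (1 / fst x) * fst u, \<chi> r. 1 / (snd x $ r) * snd u $ r)"
  note nz = chart_dom_nz[OF x]
  have 1: "((\<lambda>x. fst p - Ln (fst x / b_of p)) has_derivative (\<lambda>u. - (1 / fst x) * fst u)) (at x)"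
  proof -
    have "((\<lambda>b. fst p - Ln (b / b_of p)) has_field_derivative - (1 / fst x)) (at (fst x))"
      using x nz b_of_nz[of p] by (auto intro!: derivative_eq_intros simp: chart_dom_def)
    from has_derivative_compose[OF has_derivative_fst[OF has_derivative_ident] this[unfolded has_field_derivative_def]]
    show ?thesis by simp
  qed
  have 2: "((\<lambda>x. \<chi> r. snd p $ r + Ln (snd x $ r / t_of p $ r)) has_derivative (\<lambda>u. \<chi> r. 1 / (snd x $ r) * snd u $ r)) (at x)"
  proof (rule has_derivative_vecI)
    fix r
    have l: "((\<lambda>p::param. snd p $ r) has_derivative (\<lambda>u. snd u $ r)) (at x)"
      by (intro bounded_linear_imp_has_derivative bounded_linear_compose[OF bounded_linear_vec_nth bounded_linear_snd])
    have "((\<lambda>b. snd p $ r + Ln (b / t_of p $ r)) has_field_derivative 1 / (snd x $ r)) (at (snd x $ r))"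
      using x nz t_of_nz[of p] by (auto intro!: derivative_eq_intros simp: chart_dom_def)
    from has_derivative_compose[OF l this[unfolded has_field_derivative_def]]
    show "((\<lambda>x. (\<chi> r. snd p $ r + Ln (snd x $ r / t_of p $ r)) $ r) has_derivative (\<lambda>u. (\<chi> r. 1 / (snd x $ r) * snd u $ r) $ r)) (at x)"
      by simp
  qed
  show "(chart_inv p has_derivative ?D) (at x)"
    unfolding chart_inv_def[abs_def] by (rule has_derivative_Pair[OF 1 2])
  show "?D (cscale c u) = cscale c (?D u)" for c u
    by (simp add: cscale_def vec_eq_iff)
qed

text \<open>Extensions are transported in one direction by chart and in the other by chart_inv p.\<close>
lemma continuation_value_iff: "B1_continuation_value (b_of p) (t_of p) q c \<longleftrightarrow> log_value p c"
proof
  assume "B1_continuation_value (b_of p) (t_of p) q c"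
  then obtain V F where F: "open V" "chart p \<in> V" "param_holomorphic_on F V"
     "\<And>b' t'. (b', t') \<in> V \<Longrightarrow> (\<exists>\<gamma>. B1_contour b' t' q \<gamma>) \<Longrightarrow> F (b', t') = B1_integral b' t' q" "F (chart p) = c"
    unfolding B1_continuation_value_def chart_def by blast
  show "log_value p c" unfolding log_value_def
  proof (intro exI conjI ballI impI)
    show "open (chart -` V)" using open_vimage[OF F(1)] chart_continuous by blast
    show "param_holomorphic_on (\<lambda>p. F (chart p)) (chart -` V)"
      by (rule param_holomorphic_compose[OF F(3)]) (auto simp: chart_holomorphic)
    show "F (chart p') = log_integral p'" if "p' \<in> chart -` V" "separable p'" for p'
      using F(4)[of "b_of p'" "t_of p'"] that separable_iff_contour by (auto simp: chart_def log_integral_def)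
  qed (use F in auto)
next
  assume "log_value p c"
  then obtain V F where F: "open V" "p \<in> V" "param_holomorphic_on F V" "\<And>p'. p' \<in> V \<Longrightarrow> separable p' \<Longrightarrow> F p' = log_integral p'" "F p = c"
    unfolding log_value_def by blast
  have ci: "continuous_on (chart_dom p) (chart_inv p)"
  proof (rule continuous_at_imp_continuous_on, rule ballI)
    fix x assume "x \<in> chart_dom p"
    from chart_inv_holomorphic[OF this] show "isCont (chart_inv p) x"
      using has_derivative_continuous unfolding chart_holomorphic_at_def by blast
  qed
  define W where "W = chart_dom p \<inter> chart_inv p -` V"
  have W: "open W" unfolding W_def by (rule continuous_open_preimage[OF ci open_chart_dom F(1)])
  show "B1_continuation_value (b_of p) (t_of p) q c"
    unfolding B1_continuation_value_def
  proof (rule exI[of _ W], rule exI[of _ "\<lambda>x. F (chart_inv p x)"], intro conjI)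
    show "(b_of p, t_of p) \<in> W" using F(2) chart_dom_self[of p] chart_inv_self[of p] by (simp add: W_def chart_def)
    show "W \<subseteq> punctured_params"
    proof
      fix x assume "x \<in> W"
      hence "chart (chart_inv p x) = x" by (intro chart_chart_inv) (simp add: W_def)
      thus "x \<in> punctured_params" using chart_punctured by metis
    qed
    show "param_holomorphic_on (\<lambda>x. F (chart_inv p x)) W"
      by (rule param_holomorphic_compose[OF F(3)]) (auto simp: W_def chart_inv_holomorphic)
    show "\<forall>(b', t')\<in>W. (\<exists>\<gamma>. B1_contour b' t' q \<gamma>) \<longrightarrow> F (chart_inv p (b', t')) = B1_integral b' t' q"
    proof (clarify)
      fix b' t' \<gamma> assume w: "(b', t') \<in> W" and g: "B1_contour b' t' q \<gamma>"
      define p' where "p' = chart_inv p (b', t')"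
      have "chart p' = (b', t')" unfolding p'_def using w by (intro chart_chart_inv) (simp add: W_def)
      hence e: "b_of p' = b'" "t_of p' = t'" by (auto simp: chart_def)
      have "separable p'" unfolding separable_iff_contour e using g by blast
      moreover have "p' \<in> V" using w by (simp add: W_def p'_def)
      ultimately show "F (chart_inv p (b', t')) = B1_integral b' t' q"
        using F(4)[of p'] by (simp add: log_integral_def e p'_def[symmetric])
    qed
    show "F (chart_inv p (b_of p, t_of p)) = c" using F(5) chart_inv_self[of p] by (simp add: chart_def)
  qed (rule W)
qed

text \<open>Where a contour exists, the integral is itself the only continuation value; so the case distinction
  in the definition of B1 disappears.\<close>
lemma B1_eq_The: "B1 (b_of p) (t_of p) q = (THE c. log_value p c)"
proof (cases "separable p")
  case True
  hence "(THE c. log_value p c) = log_integral p"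
    using log_value_separable log_value_unique by (intro the_equality) blast+
  thus ?thesis using True separable_iff_contour by (simp add: B1_def log_integral_def)
next
  case False
  moreover have "B1_continuation_value (b_of p) (t_of p) q = log_value p"
    by (rule ext) (rule continuation_value_iff)
  ultimately show ?thesis using separable_iff_contour by (simp add: B1_def)
qed

text \<open>The identity theorem on the complex line from x0 to y. The points of this line at which the integral
  is not defined for the line or for its image under M are the zeros of an entire function that is
  not 0 at x0. They are countable, and their complement is connected.\<close>
lemma log_integral_invariant_everywhere:
  assumes M: "cplx_linear M" and x0: "collision_prod x0 \<noteq> 0" "collision_prod (M x0) \<noteq> 0"
    and N: "open N" "x0 \<in> N" "\<And>p. p \<in> N \<Longrightarrow> separable p \<Longrightarrow> separable (M p) \<Longrightarrow> log_integral p = log_integral (M p)"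
    and y: "separable y" "separable (M y)"
  shows "log_integral y = log_integral (M y)"
proof -
  (* The zeros of e are the points where one of the two integrals has no contour. *)
  define e where "e \<theta> = collision_prod (cline x0 y \<theta>) * collision_prod (cline (M x0) (M y) \<theta>)" for \<theta>
  have e: "e holomorphic_on UNIV" unfolding e_def by (intro holomorphic_intros collision_prod_cline_holomorphic)
  have e0: "e 0 \<noteq> 0" using x0 by (simp add: e_def)
  have e1: "e 1 \<noteq> 0" using y by (simp add: e_def separable_iff_collision_prod)
  define T where "T = {\<theta>. e \<theta> \<noteq> 0}"
  have "T = e -` (-{0})" by (auto simp: T_def)
  hence opT: "open T"
    using open_vimage[of "-{0}" e] holomorphic_on_imp_continuous_on[OF e] by auto
  have "connected T"
  proof -
    have "connected (UNIV - {\<theta>. e \<theta> = 0})"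
    proof (cases "e constant_on UNIV")
      case True
      hence "{\<theta>. e \<theta> = 0} = {}" using e0 unfolding constant_on_def by auto
      thus ?thesis using convex_connected[OF convex_UNIV] by simp
    next
      case False
      have "countable {\<theta>\<in>UNIV. e \<theta> = 0}"
        by (rule holomorphic_countable_zeros[OF e _ _ _ False]) auto
      thus ?thesis by (intro connected_open_diff_countable) auto
    qed
    moreover have "UNIV - {\<theta>. e \<theta> = 0} = T" by (auto simp: T_def)
    ultimately show ?thesis by simp
  qed
  have goodT: "separable (cline x0 y \<theta>)" "separable (cline (M x0) (M y) \<theta>)" if "\<theta> \<in> T" for \<theta>
    using that by (auto simp: T_def e_def separable_iff_collision_prod)
  have h1: "(\<lambda>\<theta>. log_integral (cline x0 y \<theta>)) holomorphic_on T"
    by (rule param_holomorphic_cline[OF log_integral_holomorphic opT]) (use goodT in auto)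
  have h2: "(\<lambda>\<theta>. log_integral (cline (M x0) (M y) \<theta>)) holomorphic_on T"
    by (rule param_holomorphic_cline[OF log_integral_holomorphic opT]) (use goodT in auto)
  define U where "U = T \<inter> cline x0 y -` N"
  have opU: "open U" unfolding U_def using opT open_vimage[OF N(1)] cline_continuous by blast
  have "0 \<in> U" using e0 N by (simp add: U_def T_def)
  have "log_integral (cline x0 y 1) = log_integral (cline (M x0) (M y) 1)"
  proof (rule analytic_continuation_open[OF opU opT _ \<open>connected T\<close> _ h1 h2])
    show "U \<noteq> {}" using \<open>0 \<in> U\<close> by blast
    show "U \<subseteq> T" by (auto simp: U_def)
    show "log_integral (cline x0 y \<theta>) = log_integral (cline (M x0) (M y) \<theta>)" if "\<theta> \<in> U" for \<theta>
      using N(3)[of "cline x0 y \<theta>"] that goodT[of \<theta>] cplx_linear_cline[OF M, of x0 y \<theta>] by (simp add: U_def)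
    show "1 \<in> T" using e1 by (simp add: T_def)
  qed
  thus ?thesis by simp
qed

text \<open>The composition with M of an extension near p is an extension near M p. It has the right value at y if
  both y and M y are separable, hence by density whenever y is.\<close>
lemma log_value_transfer:
  assumes M: "cplx_linear M" "\<And>p. M (M p) = p" and x0: "collision_prod x0 \<noteq> 0" "collision_prod (M x0) \<noteq> 0"
    and inv: "\<And>p. separable p \<Longrightarrow> separable (M p) \<Longrightarrow> log_integral p = log_integral (M p)" and p: "log_value p c"
  shows "log_value (M p) c"
proof -
  obtain V F where F: "open V" "p \<in> V" "param_holomorphic_on F V" "\<And>p'. p' \<in> V \<Longrightarrow> separable p' \<Longrightarrow> F p' = log_integral p'" "F p = c"
    using p unfolding log_value_def by blast
  have "linear M" using M(1) by (auto simp: cplx_linear_def bounded_linear.linear)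
  have contM: "continuous_on S M" for S using M(1) by (auto simp: cplx_linear_def linear_continuous_on)
  define W where "W = M -` V"
  have W: "open W" unfolding W_def using open_vimage[OF F(1) contM] .
  have Fh: "param_holomorphic_on (\<lambda>x. F (M x)) W"
    by (rule param_holomorphic_compose[OF F(3)]) (auto simp: W_def cplx_linear_chart[OF M(1)])
  have "F (M y) = log_integral y" if y: "y \<in> W" "separable y" for y
  proof (rule agree_dense[of "\<lambda>p. collision_prod p * collision_prod (M p)" x0 "W \<inter> {p. separable p}" y "\<lambda>x. F (M x)" log_integral])
    show "(\<lambda>\<theta>. collision_prod (cline x0 y \<theta>) * collision_prod (M (cline x0 y \<theta>))) holomorphic_on UNIV" for y
      unfolding cplx_linear_cline[OF M(1)] by (intro holomorphic_intros collision_prod_cline_holomorphic)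
    show "continuous_on (W \<inter> {p. separable p}) (\<lambda>x. F (M x))"
      by (rule continuous_on_subset[OF param_holomorphic_continuous[OF Fh]]) simp
    show "continuous_on (W \<inter> {p. separable p}) log_integral"
      by (rule continuous_on_subset[OF param_holomorphic_continuous[OF log_integral_holomorphic]]) simp
    show "F (M x) = log_integral x" if "x \<in> W \<inter> {p. separable p}" "collision_prod x * collision_prod (M x) \<noteq> 0" for x
      using that F(4)[of "M x"] inv[of x] by (auto simp: W_def separable_iff_collision_prod)
  qed (use W open_separable y x0 in auto)
  thus ?thesis unfolding log_value_def
    using W Fh F(2,5) M(2) by (intro exI[of _ W] exI[of _ "\<lambda>x. F (M x)"]) (auto simp: W_def)
qed

text \<open>A symmetry of the integral on a nonempty open set extends to all parameters, also to those at which
  B1 is defined by continuation.\<close>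
theorem B1_invariant:
  assumes M: "cplx_linear M" "\<And>p. M (M p) = p" and x0: "collision_prod x0 \<noteq> 0" "collision_prod (M x0) \<noteq> 0"
    and N: "open N" "x0 \<in> N" "\<And>p. p \<in> N \<Longrightarrow> separable p \<Longrightarrow> separable (M p) \<Longrightarrow> log_integral p = log_integral (M p)"
  shows "B1 (b_of p) (t_of p) q = B1 (b_of (M p)) (t_of (M p)) q"
proof -
  have inv: "log_integral y = log_integral (M y)" if "separable y" "separable (M y)" for y
    by (rule log_integral_invariant_everywhere[OF M(1) x0 N that])
  have "log_value p c \<longleftrightarrow> log_value (M p) c" for c
    using log_value_transfer[OF M x0 inv] M(2) by metis
  hence "log_value p = log_value (M p)" by (rule ext)
  thus ?thesis unfolding B1_eq_The by simp
qed

end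

text \<open>In the numeral type the least element is 4 = 0.\<close>
section \<open>Reflections that permute the parameters\<close>

lemma prod_pairs_4:
  fixes g :: "4 \<Rightarrow> 4 \<Rightarrow> complex"
  shows "(\<Prod>(r, s)\<in>{(r, s). r < s}. g r s) = g 4 1 * g 4 2 * g 4 3 * g 1 2 * g 1 3 * g 2 3"
proof -
  have "{(r::4, s). r < s} = {(4, 1), (4, 2), (4, 3), (1, 2), (1, 3), (2, 3)}"
  proof -
    have "(r < s) = ((r, s) \<in> {(4, 1), (4, 2), (4, 3), (1, 2), (1, 3), (2, 3)})" for r s :: 4
      using exhaust_4[of r] exhaust_4[of s] by (elim disjE) (simp_all add: less_bit0_def bit0.Rep_numeral bit0.Rep_1)
    thus ?thesis by auto
  qed
  thus ?thesis by simp
qed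

context nome
begin

text \<open>In the prefactor only the pairs {t_r, q/(b t_r)} matter, not the order of their members. In this
  form an exchange of the members is a change of the product index.\<close>
definition pair_factor :: "param \<Rightarrow> 4 \<Rightarrow> 4 \<Rightarrow> complex" where
  "pair_factor p r s = (\<Prod>x\<in>UNIV. \<Prod>y\<in>UNIV. qpoch (base_pole p (r, x) * base_pole p (s, y)) q)"

definition denom_factor :: "param \<Rightarrow> complex \<Rightarrow> 4 \<Rightarrow> complex" where
  "denom_factor p z r = (\<Prod>x\<in>UNIV. qpoch (base_pole p (r, x) * z) q * qpoch (base_pole p (r, x) / z) q)"

lemma log_prefactor_pairs: "log_prefactor p = (\<Prod>(r, s)\<in>{(r, s). r < s}. pair_factor p r s) * qpoch (exp (fst p)) q ^ 4 * (qpoch q q / 2)"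
  unfolding log_prefactor_eq pair_factor_def qpochs_def UNIV_bool by (simp add: mult_ac)

lemma log_integrand_den: "log_integrand p z = qpochs [exp (fst p) * z^2, exp (fst p) / z^2, z^2, 1 / z^2] q / (\<Prod>r\<in>UNIV. denom_factor p z r) / (2 * of_real pi * \<i> * z)"
proof -
  have "denom_factor p z r = qpochs [base_pole p (r, True) * z, base_pole p (r, True) / z, base_pole p (r, False) * z, base_pole p (r, False) / z] q" for r
    by (simp add: denom_factor_def qpochs_def UNIV_bool mult_ac)
  thus ?thesis unfolding log_integrand_eq by simp
qed

lemma pair_factor_commute: "pair_factor p r s = pair_factor p s r"
  unfolding pair_factor_def by (subst prod.swap) (simp add: mult.commute)

lemma log_integral_some: "log_integral p = log_prefactor p * contour_integral (SOME \<gamma>. separates (poles p) \<gamma>) (log_integrand p)"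
  unfolding log_integral_def B1_integral_def log_prefactor_def log_integrand_def[abs_def] B1_contour_separates inner_poles_eq ..

text \<open>A transposition of two of the pairs {t_r, q/(b t_r)} and exchanges within them leave the poles, the
  integrand and the prefactor unchanged.\<close>
lemma log_integral_permute:
  fixes j k :: 4 and f :: "4 \<Rightarrow> bool"
  assumes fst: "fst p' = fst p"
    and bp: "\<And>r x. base_pole p' (r, x) = base_pole p (Transposition.transpose j k r, x = f r)"
  shows "log_integral p' = log_integral p"
proof -
  let ?\<pi> = "Transposition.transpose j k"
  have re: "(\<Prod>x\<in>UNIV. h (x = c)) = (\<Prod>x\<in>UNIV. h x)" for h :: "bool \<Rightarrow> complex" and c :: bool
    by (cases c) (simp_all add: UNIV_bool mult.commute)
  have pf: "pair_factor p' r s = pair_factor p (?\<pi> r) (?\<pi> s)" for r s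
    unfolding pair_factor_def bp re[of "\<lambda>y. qpoch (base_pole p (?\<pi> r, x) * base_pole p (?\<pi> s, y)) q" for x]
    by (rule re[of "\<lambda>x. \<Prod>y\<in>UNIV. qpoch (base_pole p (?\<pi> r, x) * base_pole p (?\<pi> s, y)) q"])
  have df: "denom_factor p' z r = denom_factor p z (?\<pi> r)" for z r
    unfolding denom_factor_def bp by (rule re[of "\<lambda>x. qpoch (base_pole p (?\<pi> r, x) * z) q * qpoch (base_pole p (?\<pi> r, x) / z) q"])
  have "(\<Prod>(r, s)\<in>{(r, s). r < s}. pair_factor p (?\<pi> r) (?\<pi> s)) = (\<Prod>(r, s)\<in>{(r, s). r < s}. pair_factor p r s)"
  proof -
    note c = pair_factor_commute[of p 1 4] pair_factor_commute[of p 2 4] pair_factor_commute[of p 3 4]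
      pair_factor_commute[of p 2 1] pair_factor_commute[of p 3 1] pair_factor_commute[of p 3 2]
    show ?thesis unfolding prod_pairs_4
      using exhaust_4[of j] exhaust_4[of k]
      by (elim disjE) (simp_all add: Transposition.transpose_def c mult_ac)
  qed
  hence 1: "log_prefactor p' = log_prefactor p" unfolding log_prefactor_pairs pf fst by simp
  have "(\<Prod>r\<in>UNIV. denom_factor p z (?\<pi> r)) = (\<Prod>r\<in>UNIV. denom_factor p z r)" for z
    by (rule prod.reindex_bij_betw) (rule bij_transpose)
  hence 2: "log_integrand p' = log_integrand p" unfolding log_integrand_den[abs_def] df fst by simp
  have "poles p' = poles p"
  proof -
    have "base_pole p' (r, x) * q ^ k \<in> poles p" for r x k unfolding bp by (rule polesI)
    moreover have "base_pole p (r, x) * q ^ k \<in> poles p'" for r x k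
    proof -
      have "((x = f (?\<pi> r)) = f (?\<pi> r)) = x" by blast
      hence "base_pole p (r, x) = base_pole p' (?\<pi> r, x = f (?\<pi> r))"
        using bp[of "?\<pi> r" "x = f (?\<pi> r)"] by simp
      thus ?thesis by (simp only: polesI)
    qed
    ultimately show ?thesis by (auto elim!: polesE)
  qed
  thus ?thesis unfolding log_integral_some 1 2 by simp
qed

text \<open>The multiplicative action of the reflection in \<alpha> in logarithmic coordinates, which is the
  reflection about the point (a/2, ..., a/2).\<close>
definition refl_log :: "real^4 \<Rightarrow> param \<Rightarrow> param" where
  "refl_log \<alpha> p = (fst p, \<chi> j. snd p $ j -
     of_real (2 / (\<alpha> \<bullet> \<alpha>)) * of_real (\<alpha> $ j) * (\<Sum>i\<in>UNIV. of_real (\<alpha> $ i) * (snd p $ i - fst p / 2)))"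

lemma fst_refl_log [simp]: "fst (refl_log \<alpha> p) = fst p"
  by (simp add: refl_log_def)

lemma cplx_linear_refl: "cplx_linear (refl_log \<alpha>)"
proof -
  define S where "S p = (\<Sum>i\<in>UNIV. of_real (\<alpha> $ i) * (snd p $ i - fst p / 2))" for p :: "param"
  have r: "refl_log \<alpha> p = (fst p, \<chi> j. snd p $ j - of_real (2 / (\<alpha> \<bullet> \<alpha>)) * of_real (\<alpha> $ j) * S p)" for p
    by (simp add: refl_log_def S_def)
  have "S (x + y) = S x + S y" "S (t *\<^sub>R x) = t *\<^sub>R S x" for x y t
    by (simp_all add: S_def sum_4 scaleR_conv_of_real[where 'a = complex] algebra_simps add_divide_distrib)
  hence "linear (refl_log \<alpha>)"
    unfolding r by (intro linearI)
       (simp_all add: prod_eq_iff vec_eq_iff scaleR_conv_of_real[where 'a = complex] algebra_simps add_divide_distrib)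
  moreover have "refl_log \<alpha> (cscale c p) = cscale c (refl_log \<alpha> p)" for c p
    by (simp add: refl_log_def cscale_def prod_eq_iff vec_eq_iff sum_4 algebra_simps)
  ultimately show ?thesis by (simp add: cplx_linear_def linear_conv_bounded_linear)
qed

lemma refl_log_involution:
  assumes "\<alpha> \<noteq> 0"
  shows "refl_log \<alpha> (refl_log \<alpha> p) = p"
proof -
  define c where "c = complex_of_real (2 / (\<alpha> \<bullet> \<alpha>))"
  define s where "s = (\<Sum>i\<in>UNIV. of_real (\<alpha> $ i) * (snd p $ i - fst p / 2))"
  have n: "(\<Sum>i\<in>UNIV. of_real (\<alpha> $ i) * (of_real (\<alpha> $ i) :: complex)) = of_real (\<alpha> \<bullet> \<alpha>)"
    by (simp add: inner_vec_def)
  have s': "(\<Sum>i\<in>UNIV. of_real (\<alpha> $ i) * (snd (refl_log \<alpha> p) $ i - fst p / 2)) = s - c * s * of_real (\<alpha> \<bullet> \<alpha>)"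
  proof -
    have "of_real (\<alpha> $ i) * (snd (refl_log \<alpha> p) $ i - fst p / 2) =
      of_real (\<alpha> $ i) * (snd p $ i - fst p / 2) - c * s * (of_real (\<alpha> $ i) * of_real (\<alpha> $ i))" for i
    proof -
      have e: "snd (refl_log \<alpha> p) $ i = snd p $ i - c * of_real (\<alpha> $ i) * s" by (simp add: refl_log_def c_def s_def)
      show ?thesis unfolding e by (simp add: algebra_simps)
    qed
    hence "(\<Sum>i\<in>UNIV. of_real (\<alpha> $ i) * (snd (refl_log \<alpha> p) $ i - fst p / 2)) =
      s - c * s * (\<Sum>i\<in>UNIV. of_real (\<alpha> $ i) * (of_real (\<alpha> $ i) :: complex))"
      by (simp only: sum_subtractf sum_distrib_left[symmetric] s_def)
    thus ?thesis unfolding n .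
  qed
  have "c * of_real (\<alpha> \<bullet> \<alpha>) = 2" using assms by (simp add: c_def)
  hence s'': "s - c * s * of_real (\<alpha> \<bullet> \<alpha>) = - s" by (simp add: algebra_simps) 
  show ?thesis
    using s' unfolding s'' by (simp add: refl_log_def[of \<alpha> "refl_log \<alpha> p"]) (simp add: refl_log_def prod_eq_iff vec_eq_iff c_def[symmetric] s_def[symmetric])
qed

lemma refl_log_base_param: "refl_log \<alpha> base_param = base_param"
  by (simp add: refl_log_def base_param_def)

text \<open>All reflections fix base_param. So an identity near this point is enough.\<close>
lemma B1_refl:
  assumes "\<alpha> \<noteq> 0" and N: "open N" "base_param \<in> N" "\<And>p. p \<in> N \<Longrightarrow> log_integral p = log_integral (refl_log \<alpha> p)"
  shows "B1 (b_of p) (t_of p) q = B1 (b_of (refl_log \<alpha> p)) (t_of (refl_log \<alpha> p)) q"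
  by (rule B1_invariant[OF cplx_linear_refl refl_log_involution[OF assms(1)], of base_param N])
     (use assms refl_log_base_param collision_prod_base_param in auto)

lemma base_pole_log: "base_pole p (r, x) = exp (if x then snd p $ r else fst p - snd p $ r)"
  by (simp add: base_pole_def)

lemma sum_delta_4: "(\<Sum>i\<in>UNIV. of_real (axis j (1::real) $ i) * (h i :: complex)) = h j"
  by (simp add: axis_def if_distrib[of of_real] if_distrib[of "\<lambda>x. x * _"] cong: if_cong)

text \<open>This reflection exchanges t_j with q/(b t_j).\<close>
lemma log_integral_refl_axis:
  assumes c: "c \<in> {1, -1}"
  shows "log_integral (refl_log (c *\<^sub>R axis j 1) p) = log_integral p"
proof (rule log_integral_permute[where j = j and k = j and f = "\<lambda>r. r \<noteq> j"])
  fix r x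
  have cc: "c * c = 1" using c by auto
  have nth: "snd (refl_log (c *\<^sub>R axis j 1) p) $ r = (if r = j then fst p - snd p $ r else snd p $ r)"
  proof -
    have "(\<Sum>i\<in>UNIV. of_real ((c *\<^sub>R axis j (1::real)) $ i) * (snd p $ i - fst p / 2)) = of_real c * (snd p $ j - fst p / 2)"
      using sum_delta_4[of j "\<lambda>i. of_real c * (snd p $ i - fst p / 2)"] by (simp add: mult_ac)
    moreover have "(c *\<^sub>R axis j (1::real)) \<bullet> (c *\<^sub>R axis j 1) = (1::real)" using cc by (simp add: inner_axis_axis)
    ultimately have "snd (refl_log (c *\<^sub>R axis j 1) p) $ r =
        snd p $ r - of_real (2 / 1) * of_real ((c *\<^sub>R axis j (1::real)) $ r) * (of_real c * (snd p $ j - fst p / 2))"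
      by (simp only: refl_log_def snd_conv vec_lambda_beta)
    thus ?thesis using c by (auto simp: axis_def algebra_simps)
  qed
  thus "base_pole (refl_log (c *\<^sub>R axis j 1) p) (r, x) = base_pole p (Transposition.transpose j j r, x = (r \<noteq> j))"
    unfolding base_pole_log nth by auto
qed (simp add: refl_log_def)

text \<open>For c \<noteq> d this reflection exchanges t_j with t_k, and for c = d it exchanges t_j with q/(b t_k) and
  t_k with q/(b t_j).\<close>
lemma log_integral_refl_long:
  assumes c: "c \<in> {1, -1}" "d \<in> {1, -1}" and jk: "j \<noteq> k"
  shows "log_integral (refl_log (c *\<^sub>R axis j 1 + d *\<^sub>R axis k 1) p) = log_integral p"
proof (rule log_integral_permute[where j = j and k = k and f = "\<lambda>r. \<not> (c = d \<and> (r = j \<or> r = k))"])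
  let ?\<alpha> = "c *\<^sub>R axis j 1 + d *\<^sub>R axis k (1::real)"
  fix r x
  have cc: "c * c = 1" "d * d = 1" using c by auto
  have oc: "of_real c * of_real c = (1::complex)" "of_real d * of_real d = (1::complex)"
    using cc by (metis of_real_1 of_real_mult)+
  define v where "v i = snd p $ i - fst p / 2" for i
  have "(\<Sum>i\<in>UNIV. of_real (?\<alpha> $ i) * v i) = of_real c * v j + of_real d * v k"
    using sum_delta_4[of j "\<lambda>i. of_real c * v i"] sum_delta_4[of k "\<lambda>i. of_real d * v i"]
    by (simp add: distrib_left distrib_right sum.distrib mult_ac)
  moreover have "?\<alpha> \<bullet> ?\<alpha> = 2"
    using cc jk by (simp add: inner_add_left inner_add_right inner_axis_axis)
  ultimately have s: "snd (refl_log ?\<alpha> p) $ r = snd p $ r - of_real (2 / 2) * of_real (?\<alpha> $ r) * (of_real c * v j + of_real d * v k)"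
    unfolding v_def by (simp only: refl_log_def snd_conv vec_lambda_beta)
  have nth: "snd (refl_log ?\<alpha> p) $ r = (if r = j then fst p / 2 - of_real (c * d) * v k else if r = k then fst p / 2 - of_real (c * d) * v j else snd p $ r)"
    unfolding s using jk c by (auto simp: axis_def v_def algebra_simps)
  thus "base_pole (refl_log ?\<alpha> p) (r, x) = base_pole p (Transposition.transpose j k r, x = (\<not> (c = d \<and> (r = j \<or> r = k))))"
    unfolding base_pole_log nth using c jk by (auto simp: Transposition.transpose_def v_def)
qed (simp add: refl_log_def)

end

section \<open>The half-sum reflection\<close>

definition half_root :: "real^4" where
  "half_root = (\<chi> j. if j = 1 \<or> j = 2 then 1/2 else -1/2)"

text \<open>With S = exp (a/2) and x, y, u, v for the exponentials of \<alpha>, \<eta>, \<gamma>, \<delta>, these are the parameters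
  t = (S x y, S x/y, S u v, S u/v). The reflection in half_root exchanges x and u
  (refl_half_root_product_coords).\<close>
definition product_coords :: "complex \<Rightarrow> complex \<Rightarrow> complex \<Rightarrow> complex \<Rightarrow> complex \<Rightarrow> param" where
  "product_coords a \<alpha> \<eta> \<gamma> \<delta> = (a, \<chi> j. a / 2 + (if j = 1 then \<alpha> + \<eta> else if j = 2 then \<alpha> - \<eta> else if j = 3 then \<gamma> + \<delta> else \<gamma> - \<delta>))"

lemma product_coords_surj: "\<exists>\<alpha> \<eta> \<gamma> \<delta>. p = product_coords (fst p) \<alpha> \<eta> \<gamma> \<delta>"
  by (intro exI[of _ "(snd p $ 1 + snd p $ 2 - fst p) / 2"] exI[of _ "(snd p $ 1 - snd p $ 2) / 2"]
      exI[of _ "(snd p $ 3 + snd p $ 4 - fst p) / 2"] exI[of _ "(snd p $ 3 - snd p $ 4) / 2"])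
     (simp add: product_coords_def prod_eq_iff vec_eq_iff forall_4 field_simps)

context nome
begin

lemma half_root_norm: "half_root \<bullet> half_root = 1"
  by (simp add: half_root_def inner_vec_def sum_4)

lemma refl_half_root_product_coords: "refl_log half_root (product_coords a \<alpha> \<eta> \<gamma> \<delta>) = product_coords a \<gamma> \<eta> \<alpha> \<delta>"
  unfolding refl_log_def half_root_norm
  by (simp add: product_coords_def half_root_def prod_eq_iff vec_eq_iff forall_4 sum_4 field_simps)

lemma base_pole_product_coords:
  "base_pole (product_coords a \<alpha> \<eta> \<gamma> \<delta>) (1, True) = exp (a / 2) * exp (\<alpha> + \<eta>)"
  "base_pole (product_coords a \<alpha> \<eta> \<gamma> \<delta>) (1, False) = exp (a / 2) * exp (- \<alpha> - \<eta>)"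
  "base_pole (product_coords a \<alpha> \<eta> \<gamma> \<delta>) (2, True) = exp (a / 2) * exp (\<alpha> - \<eta>)"
  "base_pole (product_coords a \<alpha> \<eta> \<gamma> \<delta>) (2, False) = exp (a / 2) * exp (\<eta> - \<alpha>)"
  "base_pole (product_coords a \<alpha> \<eta> \<gamma> \<delta>) (3, True) = exp (a / 2) * exp (\<gamma> + \<delta>)"
  "base_pole (product_coords a \<alpha> \<eta> \<gamma> \<delta>) (3, False) = exp (a / 2) * exp (- \<gamma> - \<delta>)"
  "base_pole (product_coords a \<alpha> \<eta> \<gamma> \<delta>) (4, True) = exp (a / 2) * exp (\<gamma> - \<delta>)"
  "base_pole (product_coords a \<alpha> \<eta> \<gamma> \<delta>) (4, False) = exp (a / 2) * exp (\<delta> - \<gamma>)"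
  by (simp_all add: base_pole_log product_coords_def exp_add[symmetric] field_simps)

lemma log_prefactor_product_coords: "log_prefactor (product_coords a \<alpha> \<eta> \<gamma> \<delta>) = log_prefactor (product_coords a \<gamma> \<eta> \<alpha> \<delta>)"
proof -
  have m: "exp (a / 2) * exp X * (exp (a / 2) * exp Y) = exp a * exp (X + Y)" for X Y
    by (simp add: exp_add[symmetric])
  have f: "fst (product_coords a \<alpha> \<eta> \<gamma> \<delta>) = a" "fst (product_coords a \<gamma> \<eta> \<alpha> \<delta>) = a" by (simp_all add: product_coords_def)
  show ?thesis
    unfolding log_prefactor_pairs prod_pairs_4 pair_factor_def UNIV_bool f
    by (simp add: base_pole_product_coords m) (simp add: algebra_simps)
qed

lemma separates_circle:
  assumes "\<And>i. norm (base_pole p i) < 1"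
  shows "separates (poles p) (circlepath 0 1)"
proof (rule separatesI)
  have small: "norm z < 1 \<and> z \<noteq> 0" if z: "z \<in> poles p" for z
  proof -
    obtain i k where z: "z = base_pole p i * q ^ k" using z by (rule polesE)
    have "norm (base_pole p i) * norm q ^ k \<le> norm (base_pole p i) * 1"
      using q_lt_1 by (intro mult_left_mono power_le_one) auto
    hence "norm z < 1" using assms[of i] unfolding z norm_mult norm_power by linarith
    thus ?thesis using base_pole_nz q_nz by (simp add: z)
  qed
  hence big: "norm (1 / z) > 1" if "z \<in> poles p" for z using that by (simp add: norm_divide)
  show "path_image (circlepath 0 1) \<subseteq> pole_free (poles p)"
    using small big by (fastforce simp: pole_free_def norm_divide)
  show "winding_number (circlepath 0 1) 0 = 1" by (simp add: winding_number_circlepath_centre)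
  fix z assume z: "z \<in> poles p"
  show "winding_number (circlepath 0 1) z = 1" using small[OF z] by (simp add: winding_number_circlepath)
  have "1 / z \<notin> cball 0 1" using big[OF z] by simp
  thus "winding_number (circlepath 0 1) (1 / z) = 0"
    by (intro winding_number_zero_outside[of _ "cball 0 1"]) auto
qed auto

lemma log_integral_circle:
  assumes "\<And>i. norm (base_pole p i) < 1"
  shows "log_integral p = log_prefactor p * circle_mean (\<lambda>z. qpochs [exp (fst p) * z^2, exp (fst p) / z^2, z^2, 1 / z^2] q / (\<Prod>r\<in>UNIV. denom_factor p z r))"
  unfolding log_integral_contour[OF separates_circle[OF assms]] log_integrand_den[abs_def] circle_mean_contour ..

end

context rogers_annulus
begin

lemma base_pole_small:
  assumes a: "exp (a / 2) = \<sigma>" and annulus: "exp \<alpha> \<in> annulus" "exp \<eta> \<in> annulus" "exp \<gamma> \<in> annulus" "exp \<delta> \<in> annulus"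
  shows "norm (base_pole (product_coords a \<alpha> \<eta> \<gamma> \<delta>) i) < 1"
proof -
  have e: "norm (\<sigma> * exp (u + v)) < 1" "norm (\<sigma> * exp (u - v)) < 1" "norm (\<sigma> * exp (- u - v)) < 1" "norm (\<sigma> * exp (v - u)) < 1"
    if "exp u \<in> annulus" "exp v \<in> annulus" for u v
    using annulus_small[OF that] by (simp_all add: exp_add exp_diff exp_minus field_simps)
  obtain r x where i: "i = (r, x)" by (cases i)
  show ?thesis unfolding i using exhaust_4[of r] e[OF annulus(1,2)] e[OF annulus(3,4)]
    by (cases x) (elim disjE; simp add: base_pole_product_coords a)+
qed

lemma denom_factor_kernel_denom:
  assumes a: "exp (a / 2) = \<sigma>"
  shows "(\<Prod>r\<in>UNIV. denom_factor (product_coords a \<alpha> \<eta> \<gamma> \<delta>) z r) = kernel_denom (exp \<alpha>) (exp \<eta>) z * kernel_denom (exp \<gamma>) (exp \<delta>) z"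
  unfolding UNIV_4
  by (simp add: denom_factor_def UNIV_bool base_pole_product_coords a kernel_denom_def exp_add exp_diff exp_minus field_simps)

text \<open>If the base poles lie in the unit disc, the unit circle is a contour; the denominator of the
  integrand then consists of the two kernels.\<close>
lemma log_integral_double_kernel:
  assumes a: "exp (a / 2) = \<sigma>" and annulus: "exp \<alpha> \<in> annulus" "exp \<eta> \<in> annulus" "exp \<gamma> \<in> annulus" "exp \<delta> \<in> annulus"
  shows "log_integral (product_coords a \<alpha> \<eta> \<gamma> \<delta>) = log_prefactor (product_coords a \<alpha> \<eta> \<gamma> \<delta>) * double_kernel (exp \<alpha>) (exp \<eta>) (exp \<gamma>) (exp \<delta>)"
proof -
  have "exp a = \<beta>" unfolding \<sigma>[symmetric] a[symmetric] by (simp add: exp_double[symmetric])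
  hence n: "qpochs [exp (fst (product_coords a \<alpha> \<eta> \<gamma> \<delta>)) * z^2, exp (fst (product_coords a \<alpha> \<eta> \<gamma> \<delta>)) / z^2, z^2, 1 / z^2] q = weyl_denom z * hgauge z" for z
    by (simp add: qpochs_def product_coords_def weyl_denom_def hgauge_def mult_ac)
  show ?thesis
    unfolding log_integral_circle[OF base_pole_small[OF assms]] denom_factor_kernel_denom[OF a] n double_kernel_def ..
qed

lemma log_integral_symmetric_circle:
  assumes a: "exp (a / 2) = \<sigma>" and annulus: "exp \<alpha> \<in> annulus" "exp \<eta> \<in> annulus" "exp \<gamma> \<in> annulus"
    and d: "norm (exp \<delta>) = 1" "(exp \<delta>)^2 \<noteq> 1"
  shows "log_integral (product_coords a \<alpha> \<eta> \<gamma> \<delta>) = log_integral (product_coords a \<gamma> \<eta> \<alpha> \<delta>)"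
  unfolding log_integral_double_kernel[OF a annulus circle_annulus[OF d(1)]] log_integral_double_kernel[OF a annulus(3,2,1) circle_annulus[OF d(1)]] log_prefactor_product_coords[of a \<alpha>]
    double_kernel_symmetric[OF annulus d] ..

end

context nome
begin

text \<open>An open set containing base_param on which \<sigma> = exp (a/2) and the numbers x, y, u, v of
  product_coords satisfy the assumptions of rogers_annulus with \<rho> = exp (- Re a/8). The factor 8 is
  more than enough for |\<sigma>| \<rho>^2 < 1, as this number is exp (Re a/4). The first condition is \<beta> \<noteq> q.\<close>
definition symmetric_region :: "param set" where
  "symmetric_region = {p. exp (fst p) \<noteq> q \<and> Re (fst p) < 0 \<and> (\<forall>r\<in>UNIV. 8 * \<bar>Re (snd p $ r - fst p / 2)\<bar> < - Re (fst p))}"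

lemma open_symmetric_region: "open symmetric_region"
proof -
  have eq: "symmetric_region = {p. exp (fst p) \<noteq> q} \<inter> {p. Re (fst p) < 0} \<inter> (\<Inter>r\<in>UNIV. {p. 8 * \<bar>Re (snd p $ r - fst p / 2)\<bar> < - Re (fst p)})"
    by (auto simp: symmetric_region_def)
  have o1: "open {p::param. exp (fst p) \<noteq> q}"
    by (rule open_Collect_neq; intro continuous_intros)
  have re: "continuous_on UNIV (\<lambda>p::param. Re (fst p))"
    by (intro continuous_intros)
  hence o2: "open {p::param. Re (fst p) < 0}"
    by (rule open_Collect_less) (rule continuous_on_const)
  have o3: "open {p::param. 8 * \<bar>Re (snd p $ r - fst p / 2)\<bar> < - Re (fst p)}" for r
  proof (rule open_Collect_less)
    have "continuous_on UNIV (\<lambda>p::param. fst p * (1 / 2))"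
      by (intro continuous_intros)
    hence "continuous_on UNIV (\<lambda>p::param. fst p / 2)" by simp
    thus "continuous_on UNIV (\<lambda>p::param. 8 * \<bar>Re (snd p $ r - fst p / 2)\<bar>)"
      by (intro continuous_on_mult continuous_on_const continuous_on_rabs continuous_on_Re continuous_on_diff
          continuous_on_component continuous_on_snd continuous_on_id)
    show "continuous_on UNIV (\<lambda>p::param. - Re (fst p))"
      by (rule continuous_on_minus[OF re])
  qed
  show ?thesis unfolding eq by (intro open_Int o1 o2 open_INT finite ballI o3)
qed

lemma base_param_symmetric_region: "base_param \<in> symmetric_region"
proof -
  have "exp (2 * Ln q) = q * q" using q_nz by (simp add: exp_double power2_eq_square)
  moreover have "q * q \<noteq> q" using q_nz q_lt_1 by auto
  moreover have "Re (Ln q) < 0" using q_nz q_lt_1 by simp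
  ultimately show ?thesis by (simp add: symmetric_region_def base_param_def)
qed

lemma product_coords_cline: "product_coords a \<alpha> \<eta> \<gamma> \<tau> = cline (product_coords a \<alpha> \<eta> \<gamma> 0) (product_coords a \<alpha> \<eta> \<gamma> 1) \<tau>"
  by (simp add: product_coords_def cline_def cscale_def prod_eq_iff vec_eq_iff forall_4) (simp add: algebra_simps)

text \<open>By double_kernel_symmetric the identity holds if \<delta> is imaginary and exp \<delta> is not \<plusminus> 1. Both sides
  are holomorphic in \<delta> on a strip around the imaginary axis, which gives it for the remaining \<delta>.\<close>
lemma log_integral_half_root:
  assumes p: "p \<in> symmetric_region"
  shows "log_integral p = log_integral (refl_log half_root p)"
proof -
  define a where "a = fst p"
  obtain \<alpha> \<eta> \<gamma> \<delta> where pe: "p = product_coords a \<alpha> \<eta> \<gamma> \<delta>" using product_coords_surj[of p] a_def by blast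
  define \<kappa> where "\<kappa> = - Re a / 8"
  have P: "exp a \<noteq> q" "Re a < 0" "\<And>r. \<bar>Re (snd p $ r - a / 2)\<bar> < \<kappa>"
    using p by (auto simp: symmetric_region_def a_def \<kappa>_def field_simps)
  have "\<bar>Re (\<alpha> + \<eta>)\<bar> < \<kappa>" "\<bar>Re (\<alpha> - \<eta>)\<bar> < \<kappa>" "\<bar>Re (\<gamma> + \<delta>)\<bar> < \<kappa>" "\<bar>Re (\<gamma> - \<delta>)\<bar> < \<kappa>"
    using P(3)[of 1] P(3)[of 2] P(3)[of 3] P(3)[of 4] by (simp_all add: pe product_coords_def)
  hence R: "\<bar>Re \<alpha>\<bar> < \<kappa>" "\<bar>Re \<eta>\<bar> < \<kappa>" "\<bar>Re \<gamma>\<bar> < \<kappa>" "\<bar>Re \<delta>\<bar> < \<kappa>" by auto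
  have \<kappa>: "\<kappa> > 0" using P(2) by (simp add: \<kappa>_def)
  interpret R: rogers_annulus q "exp a" "exp (a / 2)" "exp \<kappa>"
  proof unfold_locales
    show "exp (a / 2) ^ 2 = exp a" by (simp add: exp_double[symmetric])
    show "norm (exp a) < 1" using P(2) by (simp add: norm_exp_eq_Re)
    have "norm (exp (a / 2)) * exp \<kappa> ^ 2 = exp (Re a / 2 + 2 * \<kappa>)"
      by (simp add: norm_exp_eq_Re exp_add exp_double)
    also have "\<dots> < 1" using P(2) by (simp add: \<kappa>_def)
    finally show "norm (exp (a / 2)) * exp \<kappa> ^ 2 < 1" .
  qed (use P \<kappa> in auto)
  have annulus: "exp w \<in> R.annulus" if "\<bar>Re w\<bar> < \<kappa>" for w
    using that by (auto simp: R.annulus_def norm_exp_eq_Re exp_minus[symmetric] inverse_eq_divide[symmetric])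
  define T where "T = {\<tau>. \<bar>Re \<tau>\<bar> < \<kappa>}"
  have T: "open T" "convex T"
  proof -
    show "open T" unfolding T_def by (intro open_Collect_less continuous_intros)
    have "T = {\<tau>. Re \<tau> < \<kappa>} \<inter> {\<tau>. Re \<tau> > - \<kappa>}" by (auto simp: T_def)
    thus "convex T" using convex_Int[OF convex_halfspace_Re_lt convex_halfspace_Re_gt] by metis
  qed
  have separable: "separable (product_coords a u \<eta> v \<tau>)" if "\<tau> \<in> T" "\<bar>Re u\<bar> < \<kappa>" "\<bar>Re v\<bar> < \<kappa>" for u v \<tau>
    unfolding separable_separates using separates_circle[OF R.base_pole_small[OF refl annulus annulus annulus annulus]] that R T_def by blast
  have hol: "(\<lambda>\<tau>. log_integral (product_coords a u \<eta> v \<tau>)) holomorphic_on T" if "\<bar>Re u\<bar> < \<kappa>" "\<bar>Re v\<bar> < \<kappa>" for u v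
  proof -
    have "(\<lambda>\<tau>. log_integral (cline (product_coords a u \<eta> v 0) (product_coords a u \<eta> v 1) \<tau>)) holomorphic_on T"
      by (rule param_holomorphic_cline[OF log_integral_holomorphic T(1)]) (use separable that in \<open>simp add: product_coords_cline[symmetric]\<close>)
    thus ?thesis by (simp only: product_coords_cline[symmetric])
  qed
  (* For \<tau> in U the number exp \<tau> is on the unit circle and its square is not 1, because 3 < \<pi>. *)
  define U where "U = (\<lambda>s::real. \<i> * of_real s) ` {0<..<3}"
  have "log_integral (product_coords a \<alpha> \<eta> \<gamma> \<delta>) - log_integral (product_coords a \<gamma> \<eta> \<alpha> \<delta>) = 0"
  proof (rule analytic_continuation[of "\<lambda>\<tau>. log_integral (product_coords a \<alpha> \<eta> \<gamma> \<tau>) - log_integral (product_coords a \<gamma> \<eta> \<alpha> \<tau>)" T U \<i>])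
    show "(\<lambda>\<tau>. log_integral (product_coords a \<alpha> \<eta> \<gamma> \<tau>) - log_integral (product_coords a \<gamma> \<eta> \<alpha> \<tau>)) holomorphic_on T"
      using R by (intro holomorphic_intros hol)
    show "connected T" using T by (simp add: convex_connected)
    show "U \<subseteq> T" "\<i> \<in> T" "\<delta> \<in> T" using \<kappa> R by (auto simp: U_def T_def)
    show "\<i> islimpt U"
      unfolding islimpt_approachable
    proof (intro allI impI)
      fix e :: real assume "e > 0"
      define s where "s = 1 + min e 1 / 2"
      have "\<i> * of_real s \<in> U" unfolding U_def by (rule imageI) (use \<open>e > 0\<close> in \<open>auto simp: s_def\<close>)
      moreover have "dist (\<i> * of_real s) \<i> = min e 1 / 2"
      proof -
        have e': "\<i> * of_real s - \<i> = \<i> * of_real (min e 1 / 2)" by (simp add: s_def distrib_left)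
        show ?thesis unfolding dist_norm e' using \<open>e > 0\<close> by (simp add: norm_mult)
      qed
      ultimately show "\<exists>x'\<in>U. x' \<noteq> \<i> \<and> dist x' \<i> < e"
        using \<open>e > 0\<close> by (intro bexI[of _ "\<i> * of_real s"]) (auto simp: min_def split: if_splits)
    qed
    show "log_integral (product_coords a \<alpha> \<eta> \<gamma> \<tau>) - log_integral (product_coords a \<gamma> \<eta> \<alpha> \<tau>) = 0" if "\<tau> \<in> U" for \<tau>
    proof -
      from that obtain s where "s \<in> {0<..<3}" "\<tau> = \<i> * of_real s" unfolding U_def by blast
      hence s: "0 < s" "s < 3" "\<tau> = \<i> * of_real s" by simp_all
      have "(exp \<tau>)^2 = cis (2 * s)" by (simp add: s exp_double[symmetric] cis_conv_exp mult_ac)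
      moreover have "cis (2 * s) \<noteq> 1"
      proof
        assume "cis (2 * s) = 1"
        hence "cos (2 * s) = 1" by (simp add: complex_eq_iff)
        then obtain k :: int where "2 * s = of_int k * 2 * pi" by (auto simp: cos_one_2pi_int)
        hence "s = of_int k * pi" by simp
        hence k: "0 < of_int k * pi" "of_int k * pi < 3" using s by auto
        hence "0 < k" by (simp add: zero_less_mult_iff)
        hence "(1::real) \<le> of_int k" by linarith
        from mult_right_mono[OF this, of pi] have "pi \<le> of_int k * pi" by (simp only: mult_1 pi_ge_zero)
        thus False using k(2) pi_gt3 by linarith
      qed
      ultimately show ?thesis
        using R.log_integral_symmetric_circle[OF refl annulus annulus annulus, of \<alpha> \<eta> \<gamma> \<tau>] R s by (simp add: norm_exp_eq_Re)
    qed
  qed (use T in auto)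
  thus ?thesis unfolding pe refl_half_root_product_coords by simp
qed

section \<open>The Weyl group\<close>

definition log_B1 :: "param \<Rightarrow> complex" where
  "log_B1 p = B1 (b_of p) (t_of p) q"

lemma log_B1_refl:
  assumes "\<alpha> \<noteq> 0" "\<And>p. log_integral (refl_log \<alpha> p) = log_integral p"
  shows "log_B1 (refl_log \<alpha> p) = log_B1 p"
  unfolding log_B1_def by (rule B1_refl[OF assms(1), of UNIV, symmetric]) (auto simp: assms)

lemma half_root_nz: "half_root \<noteq> 0"
  using half_root_norm by auto

lemma log_B1_half_root: "log_B1 (refl_log half_root p) = log_B1 p"
  unfolding log_B1_def by (rule B1_refl[OF half_root_nz open_symmetric_region base_param_symmetric_region log_integral_half_root, symmetric])

definition flip :: "(4 \<Rightarrow> bool) \<Rightarrow> param \<Rightarrow> param" where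
  "flip f p = (fst p, \<chi> j. if f j then snd p $ j else fst p - snd p $ j)"

lemma log_B1_flip: "log_B1 (flip f p) = log_B1 p"
proof -
  have "linear (flip f)"
    by (rule linearI) (simp_all add: flip_def prod_eq_iff vec_eq_iff scaleR_diff_right)
  moreover have "flip f (cscale c p) = cscale c (flip f p)" for c p
    by (simp add: flip_def cscale_def prod_eq_iff vec_eq_iff right_diff_distrib)
  ultimately have 1: "cplx_linear (flip f)" by (simp add: cplx_linear_def linear_conv_bounded_linear)
  have 2: "flip f (flip f p) = p" for p by (simp add: flip_def prod_eq_iff vec_eq_iff)
  have 3: "flip f base_param = base_param" by (simp add: flip_def base_param_def prod_eq_iff vec_eq_iff)
  have 4: "log_integral (flip f p) = log_integral p" for p
    by (rule log_integral_permute[where j = 1 and k = 1 and f = f]) (auto simp: flip_def base_pole_log)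
  show ?thesis unfolding log_B1_def
    by (rule B1_invariant[OF 1 2, of base_param UNIV, symmetric]) (auto simp: 3 4 collision_prod_base_param)
qed

text \<open>Every half-sum root differs from half_root by sign changes of coordinates, and these are the
  exchanges flip.\<close>
lemma refl_half_root:
  fixes \<alpha> :: "real^4"
  assumes "\<And>j. \<alpha> $ j \<in> {1/2, -1/2}"
  shows "refl_log \<alpha> p = flip (\<lambda>j. \<alpha> $ j = half_root $ j) (refl_log half_root (flip (\<lambda>j. \<alpha> $ j = half_root $ j) p))"
proof -
  define f where "f = (\<lambda>j. \<alpha> $ j = half_root $ j)"
  define \<epsilon> where "\<epsilon> j = (if f j then 1 else -1 :: real)" for j
  have h: "half_root $ j \<in> {1/2, -1/2}" for j by (simp add: half_root_def)
  have \<alpha>: "\<alpha> $ j = \<epsilon> j * half_root $ j" for j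
    using assms[of j] h[of j] by (auto simp: \<epsilon>_def f_def)
  have \<epsilon>2: "\<epsilon> j * \<epsilon> j = 1" for j by (simp add: \<epsilon>_def)
  have "\<alpha> \<bullet> \<alpha> = (\<Sum>j\<in>UNIV. (\<epsilon> j * \<epsilon> j) * (half_root $ j * half_root $ j))"
    by (simp add: inner_vec_def \<alpha> mult_ac)
  hence n: "\<alpha> \<bullet> \<alpha> = 1" using half_root_norm by (simp add: \<epsilon>2 inner_vec_def)
  have fl: "snd (flip f p) $ j - fst p / 2 = of_real (\<epsilon> j) * (snd p $ j - fst p / 2)" for j p
    by (simp add: flip_def \<epsilon>_def field_simps)
  define S where "S = (\<Sum>i\<in>UNIV. of_real (\<alpha> $ i) * (snd p $ i - fst p / 2))"
  have S: "(\<Sum>i\<in>UNIV. of_real (half_root $ i) * (snd (flip f p) $ i - fst p / 2)) = S"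
    unfolding S_def fl \<alpha> by (simp add: mult_ac)
  have f1: "fst (flip f p) = fst p" for p by (simp add: flip_def)
  have r1: "snd (refl_log \<alpha> p) $ j = snd p $ j - 2 * of_real (\<alpha> $ j) * S" for j
    unfolding refl_log_def S_def n by simp
  have r2: "snd (refl_log half_root (flip f p)) $ j = snd (flip f p) $ j - 2 * of_real (half_root $ j) * S" for j
    unfolding refl_log_def[of half_root] f1 S half_root_norm by simp
  have "snd (refl_log \<alpha> p) $ j = snd (flip f (refl_log half_root (flip f p))) $ j" for j
    unfolding r1 flip_def[of f "refl_log half_root _"] using r2[of j] \<alpha>[of j]
    by (simp add: f1 \<epsilon>_def flip_def)
  thus ?thesis by (simp add: prod_eq_iff vec_eq_iff f1 f_def[symmetric])
qed

lemma root_cases: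
  assumes "\<alpha> \<in> root_system_F4"
  obtains (short) c j where "\<alpha> = c *\<^sub>R axis j 1" "c \<in> {1, -1}"
    | (half) "\<forall>j. vec_nth \<alpha> j \<in> {1/2, -1/2}"
    | (long) c d j k where "\<alpha> = c *\<^sub>R axis j 1 + d *\<^sub>R axis k 1" "c \<in> {1, -1}" "d \<in> {1, -1}" "j \<noteq> k"
  using assms unfolding root_system_F4_def Un_iff mem_Collect_eq by blast

lemma root_nz: "\<alpha> \<in> root_system_F4 \<Longrightarrow> \<alpha> \<noteq> 0"
proof (erule root_cases)
  fix c j assume "\<alpha> = c *\<^sub>R axis j 1" "c \<in> {1, -1}"
  hence "vec_nth \<alpha> j \<noteq> 0" by (auto simp: axis_def)
  thus "\<alpha> \<noteq> 0" by auto
next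
  assume "\<forall>j. vec_nth \<alpha> j \<in> {1/2, -1/2}"
  hence "vec_nth \<alpha> 1 \<in> {1/2, -1/2}" by blast
  thus "\<alpha> \<noteq> 0" by auto
next
  fix c d j k assume "\<alpha> = c *\<^sub>R axis j 1 + d *\<^sub>R axis k 1" "c \<in> {1, -1}" "d \<in> {1, -1}" "j \<noteq> k"
  hence "vec_nth \<alpha> j \<noteq> 0" by (auto simp: axis_def)
  thus "\<alpha> \<noteq> 0" by auto
qed

lemma log_B1_root:
  assumes "\<alpha> \<in> root_system_F4"
  shows "log_B1 (refl_log \<alpha> p) = log_B1 p"
  using assms
proof (cases rule: root_cases)
  case (short c j)
  thus ?thesis using log_integral_refl_axis log_B1_refl[OF root_nz[OF assms]] by blast
next
  case half
  show ?thesis unfolding refl_half_root[OF spec[OF half]] log_B1_flip log_B1_half_root ..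
next
  case (long c d j k)
  thus ?thesis using log_integral_refl_long log_B1_refl[OF root_nz[OF assms]] by blast
qed

text \<open>The multiplicative action on a choice of logarithms of A and t.\<close>
definition weyl_act :: "(real^4 \<Rightarrow> real^4) \<Rightarrow> param \<Rightarrow> param" where
  "weyl_act w p = (fst p, \<chi> j. complexify w (\<chi> i. snd p $ i - fst p / 2) $ j + fst p / 2)"

lemma weyl_act_reflection: "weyl_act (root_reflection \<alpha>) p = refl_log \<alpha> p"
proof -
  define v where "v = (\<chi> i. snd p $ i - fst p / 2)"
  have re: "Re (\<Sum>i\<in>UNIV. of_real (\<alpha> $ i) * v $ i) = \<alpha> \<bullet> (\<chi> i. Re (v $ i))"
    and im: "Im (\<Sum>i\<in>UNIV. of_real (\<alpha> $ i) * v $ i) = \<alpha> \<bullet> (\<chi> i. Im (v $ i))"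
    by (simp_all add: inner_vec_def)
  have "complexify (root_reflection \<alpha>) v $ j =
      v $ j - of_real (2 / (\<alpha> \<bullet> \<alpha>)) * of_real (\<alpha> $ j) * (\<Sum>i\<in>UNIV. of_real (\<alpha> $ i) * v $ i)" for j
  proof -
    have "of_real (2 / (\<alpha> \<bullet> \<alpha>)) * of_real (\<alpha> $ j) * z = of_real (2 / (\<alpha> \<bullet> \<alpha>) * \<alpha> $ j) * z" for z :: complex
      by simp
    thus ?thesis
      by (simp only: complexify_def vec_lambda_beta root_reflection_def complex_eq_iff complex.sel
          minus_complex.sel Re_complex_of_real Im_complex_of_real times_complex.sel re im)
         (simp add: mult_ac)
  qed
  thus ?thesis by (simp add: weyl_act_def refl_log_def v_def[symmetric] prod_eq_iff vec_eq_iff) (simp add: v_def)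
qed

lemma weyl_act_comp: "weyl_act (\<lambda>x. w1 (w2 x)) p = weyl_act w1 (weyl_act w2 p)"
  by (simp add: weyl_act_def complexify_def)

lemma weyl_act_id: "weyl_act (\<lambda>x. x) p = p"
  by (simp add: weyl_act_def complexify_def prod_eq_iff vec_eq_iff complex_eq_iff)

lemma root_reflection_involution: "\<alpha> \<noteq> 0 \<Longrightarrow> root_reflection \<alpha> (root_reflection \<alpha> v) = v"
  by (simp add: root_reflection_def inner_diff_right algebra_simps scaleR_left_distrib[symmetric] diff_divide_distrib)

lemma reflection_Bij: "\<alpha> \<in> root_system_F4 \<Longrightarrow> root_reflection \<alpha> \<in> Bij UNIV"
  using root_reflection_involution[OF root_nz] involuntory_imp_bij[of "root_reflection \<alpha>"]
  by (auto simp: Bij_def extensional_def bij_def)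

lemma log_B1_weyl:
  assumes "w \<in> weyl_group_F4"
  shows "\<forall>p. log_B1 (weyl_act w p) = log_B1 p"
proof -
  interpret W: group "BijGroup (UNIV :: (real^4) set)" by (rule group_BijGroup)
  have car: "root_reflection ` root_system_F4 \<subseteq> carrier (BijGroup UNIV)"
    using reflection_Bij by (auto simp: BijGroup_def)
  have mult: "f \<otimes>\<^bsub>BijGroup UNIV\<^esub> g = (\<lambda>x. f (g x))" if "f \<in> carrier (BijGroup UNIV)" "g \<in> carrier (BijGroup UNIV)"
    for f g :: "real^4 \<Rightarrow> real^4"
    using that by (simp add: BijGroup_def compose_def restrict_def)
  have one: "\<one>\<^bsub>BijGroup (UNIV :: (real^4) set)\<^esub> = (\<lambda>x. x)"
    by (simp add: BijGroup_def restrict_def)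
  have refl: "log_B1 (weyl_act h p) = log_B1 p" if "h \<in> root_reflection ` root_system_F4" for h p
  proof -
    from that obtain \<alpha> where "h = root_reflection \<alpha>" "\<alpha> \<in> root_system_F4" by blast
    thus ?thesis by (simp only: weyl_act_reflection log_B1_root)
  qed
  show ?thesis
    using assms unfolding weyl_group_F4_def
  proof (induction rule: generate.induct)
    case one
    thus ?case unfolding \<open>\<one>\<^bsub>BijGroup UNIV\<^esub> = (\<lambda>x. x)\<close> by (simp add: weyl_act_id)
  next
    case (incl h)
    thus ?case using refl by blast
  next
    case (inv h)
    show ?case
    proof
      fix p
      have h: "h \<in> carrier (BijGroup UNIV)" using inv car by blast
      have "(\<lambda>x. h ((inv\<^bsub>BijGroup UNIV\<^esub> h) x)) = (\<lambda>x. x)"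
        using W.r_inv[OF h] mult[OF h W.inv_closed[OF h]] one by simp
      hence "weyl_act h (weyl_act (inv\<^bsub>BijGroup UNIV\<^esub> h) p) = p"
        unfolding weyl_act_comp[symmetric] by (simp only: weyl_act_id)
      thus "log_B1 (weyl_act (inv\<^bsub>BijGroup UNIV\<^esub> h) p) = log_B1 p" using refl[OF inv] by metis
    qed
  next
    case (eng h1 h2)
    hence "h1 \<in> carrier (BijGroup UNIV)" "h2 \<in> carrier (BijGroup UNIV)"
      using W.generate_in_carrier[OF car] by blast+
    hence "weyl_act (h1 \<otimes>\<^bsub>BijGroup UNIV\<^esub> h2) p = weyl_act h1 (weyl_act h2 p)" for p
      by (simp only: mult weyl_act_comp)
    thus ?case using eng.IH by metis
  qed
qed

lemma t_of_period: "t_of (fst p, snd p + (\<chi> j. if j = i then 2 * of_real pi * \<i> else 0)) = t_of p"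
  by (simp add: t_of_def vec_eq_iff exp_add)

text \<open>Adding 2 \<pi> \<i> to l_1 does not change t, but after the reflection in half_root the coordinates
  of l have changed by \<plusminus> \<pi> \<i>, so that t has become -t.\<close>
lemma B1_minus: "B1 (b_of p) (- t_of p) q = log_B1 p"
proof -
  define p1 where "p1 = refl_log half_root p"
  define p2 where "p2 = (fst p1, snd p1 + (\<chi> j. if j = 1 then 2 * of_real pi * \<i> else 0))"
  have "log_B1 p = log_B1 p1" unfolding p1_def log_B1_half_root ..
  also have "\<dots> = log_B1 p2"
    using t_of_period[of p1 1] by (simp add: log_B1_def p2_def b_of_def)
  also have "\<dots> = log_B1 (refl_log half_root p2)" unfolding log_B1_half_root ..
  also have "\<dots> = B1 (b_of p) (- t_of p) q"
  proof -
    have "refl_log half_root p2 = (fst p, snd p + (\<chi> j. if j = 2 then - (of_real pi * \<i>) else of_real pi * \<i>))"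
    proof -
      have "p2 = p1 + (0, \<chi> j. if j = 1 then 2 * of_real pi * \<i> else 0)" by (simp add: p2_def prod_eq_iff)
      moreover have "linear (refl_log half_root)" using cplx_linear_refl[of half_root] by (simp add: cplx_linear_def bounded_linear.linear)
      ultimately have "refl_log half_root p2 = refl_log half_root p1 + refl_log half_root (0, \<chi> j. if j = 1 then 2 * of_real pi * \<i> else 0)"
        by (simp add: linear_add)
      also have "refl_log half_root p1 = p" unfolding p1_def by (rule refl_log_involution[OF half_root_nz])
      also have "refl_log half_root (0, \<chi> j. if j = 1 then 2 * of_real pi * \<i> else 0) = (0, \<chi> j. if j = 2 then - (of_real pi * \<i>) else of_real pi * \<i>)"
        unfolding refl_log_def half_root_norm by (simp add: half_root_def vec_eq_iff forall_4 sum_4)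
      finally show ?thesis by (simp add: prod_eq_iff)
    qed
    moreover have "exp (x + of_real pi * \<i>) = - exp x" "exp (x - of_real pi * \<i>) = - exp x" for x :: complex
      by (simp_all add: exp_add exp_diff)
    ultimately show ?thesis by (auto simp: log_B1_def b_of_def t_of_def vec_eq_iff intro!: arg_cong[of _ _ "\<lambda>t. B1 _ t q"])
  qed
  finally show ?thesis by simp
qed

end

theorem corollary4p3:
  fixes q b :: complex and t u :: "complex^4" and w :: "real^4 \<Rightarrow> real^4"
  assumes "0 < norm q" and "norm q < 1"
    and "b \<noteq> 0"
    and "\<And>r. t$r \<noteq> 0"
    and "w \<in> weyl_group_F4"
    and "u \<in> mult_action (q / b) w t"
  shows "B1 b t q = B1 b u q"
proof -
  interpret nome q using assms by unfold_locales auto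
  from assms(6) obtain a l v where alv: "exp a = q / b" "\<And>j. exp (l$j) = t$j"
      "v = (\<chi> j. exp (complexify w (\<chi> i. l$i - a / 2) $ j + a / 2))" "u = v \<or> u = - v"
    unfolding mult_action_def by blast
  have b: "b_of (a, l) = b"
    using alv(1) assms(3) q_nz by (simp add: b_of_def exp_minus)
  have t: "t_of (a, l) = t" by (simp add: t_of_def vec_eq_iff alv(2))
  have v: "t_of (weyl_act w (a, l)) = v" "b_of (weyl_act w (a, l)) = b"
    using b by (simp_all add: t_of_def b_of_def weyl_act_def alv(3))
  have "B1 b t q = log_B1 (a, l)" by (simp add: log_B1_def b t)
  also have "\<dots> = log_B1 (weyl_act w (a, l))" using log_B1_weyl[OF assms(5)] by simp
  also have "\<dots> = B1 b u q"
    using alv(4) B1_minus[of "weyl_act w (a, l)"] by (auto simp: log_B1_def v)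
  finally show ?thesis .
qed

end
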